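(* Let $\Phi^n=(\varphi_e^n)_{e\in I_n}$, $n\in\mathbb N$, and $\Phi=(\varphi_e)_{e\in I}$ be elements of $\mathrm{CIFS}(X)$ with $I_n\subset I\subset\mathbb N$ such that $(\Phi^n,0)_n$ converges regularly to $(\Phi,0)$ (where $0$ denotes the zero potential). Then $$\lim_{n\to\infty}\dim_H(\Lambda_{\Phi^n})=\dim_H(\Lambda_\Phi),$$ where $\Lambda_\Phi=\pi_\Phi(I^{\mathbb N})$ and $\Lambda_{\Phi^n}=\pi_{\Phi^n}(I_n^{\mathbb N})$ are the limit sets and $\dim_H$ is Hausdorff dimension.
   Context: **Conformal iterated function systems.** Let $X\subset\mathbb R^D$, $D\ge1$, be a fixed compact connected set with $X=\overline{\mathrm{Int}(X)}$, and let $\mathbb N=\{1,2,\dots\}$. $\mathrm{CIFS}(X)$ is the set of all families $\Phi=(\varphi_e:X\to X)_{e\in I}$, with $I\subset\mathbb N$ and $\mathrm{card}(I)\ge2$ ($I$ finite or infinite), of injective contractions with Lipschitz constants globally bounded away from $1$ (bounded above by a common constant $<1$) such that: (b) (open set condition) $\varphi_a(\mathrm{Int}X)\cap\varphi_b(\mathrm{Int}X)=\emptyset$ for all $a\ne b$ in $I$; (c) there is an open connected set $W\supset X$ such that every $\varphi_e$ extends to a $C^1$ conformal diffeomorphism of $W$ into $W$; (d) (cone property) there are $\gamma,l>0$, $\gamma<\pi/2$, such that for every $x\in X$ there is an open cone $\mathrm{Con}(x,\gamma,l)\subset\mathrm{Int}(X)$ with vertex $x$, central angle of measure $\gamma$ and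 altitude $l$; (e) there are constants $L_\Phi\ge1$, $\alpha_\Phi>0$ with $\big||\varphi_e'(y)|-|\varphi_e'(x)|\big|\le \frac{L_\Phi}{\Vert(\varphi_e')^{-1}\Vert_X}\Vert y-x\Vert^{\alpha_\Phi}$ for all $e\in I$, $x,y\in X$. Here $|\varphi'(x)|$ is the operator norm of the derivative and $\Vert h\Vert_\Omega=\sup_{\omega\in\Omega}|h(\omega)|$ denotes supremum norms. **Symbolic notation.** For $\omega\in I^{\mathbb N}$ let $\omega_{|k}=\omega_1\cdots\omega_k$; for a finite word $\omega=\omega_1\cdots\omega_k$ let $\varphi_\omega=\varphi_{\omega_1}\circ\cdots\circ\varphi_{\omega_k}$ and $[\omega]=\{\tau\in\mathbb N^{\mathbb N}:\tau_{|k}=\omega\}$. The coding map $\pi_\Phi:I^{\mathbb N}\to X$ is defined by $\{\pi_\Phi(\omega)\}=\bigcap_k\varphi_{\omega_{|k}}(X)$. Let $\sigma$ be the left shift and $S_kg=\sum_{n=0}^{k-1}g\circ\sigma^n$. **Pressure.** For $J\subset\mathbb N$ and continuous $g:J^{\mathbb N}\to\mathbb R$ let $Z_n(g)=\sum_{\omega\in J^n}\exp\sup_{\tau\in[\omega]\cap J^{\mathbb N}}S_ng(\tau)$ and $\mathcal P(g)=\lim_n\frac1n\log Z_n(g)\in\mathbb R\cup\{+\infty\}$. The geometric potential of $\Phi$ is $\zeta(\omega)=\log|\varphi_{\omega_1}'(\pi_\Phi(\sigma\omega))|$, $\omega\in I^{\mathbb N}$; $\zeta^n$ is the geometric potential of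 $\Phi^n$. **Regular convergence with zero potentials.** On $\mathrm{CIFS}(X)$ consider the metric $$\rho(\Phi^1,\Phi^2)=\sum_{i\in I_1\cap I_2}2^{-i}\big(\Vert\varphi_i^1-\varphi_i^2\Vert_X+\Vert(\varphi_i^1)'-(\varphi_i^2)'\Vert_X\big)+\sum_{i\in I_1\triangle I_2}2^{-i}.$$ $(\Phi^n,0)_n$ converges regularly to $(\Phi,0)$ if $\Phi^n\to\Phi$ in the $\rho$-metric and if for every $s\in\mathbb R$ with $\mathcal P(s\zeta)<\infty$ there exist $k\in\mathbb N$ and $C>0$ such that for all $n\in\mathbb N$ and all $\omega\in(I_n)^k$ $$\exp\sup_{\tau\in I_n^{\mathbb N}\cap[\omega]}S_k(s\zeta^n)(\tau)\le C\exp\sup_{\rho\in I^{\mathbb N}\cap[\omega]}S_k(s\zeta)(\rho).$$ *)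

theory Defs
  imports "HOL-Analysis.Analysis"
begin

section \<open>Hausdorff dimension\<close>

text \<open>
  The case distinction in the gauge realises the conventions \<open>0\<^sup>0 = 1\<close> for nonempty sets and
  \<open>diam(\<emptyset>)\<^sup>s = 0\<close>; in the library, \<open>0 powr 0 = 0\<close>.
\<close>

definition hausdorff_gauge :: "real \<Rightarrow> 'a::metric_space set \<Rightarrow> ennreal" where
  "hausdorff_gauge s U =
     (if U = {} then 0 else if s = 0 then 1 else ennreal (diameter U powr s))"

text \<open>
  Boundedness is required explicitly because \<^const>\<open>diameter\<close> is meaningless on unbounded sets.
  Finite covers are included by padding with empty sets.
\<close>

definition delta_covers :: "real \<Rightarrow> 'a::metric_space set \<Rightarrow> (nat \<Rightarrow> 'a set) set" where
  "delta_covers \<delta> A =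
     {U. A \<subseteq> (\<Union>i. U i) \<and> (\<forall>i. bounded (U i) \<and> diameter (U i) \<le> \<delta>)}"

definition hausdorff_measure :: "real \<Rightarrow> 'a::metric_space set \<Rightarrow> ennreal" where
  "hausdorff_measure s A =
     (SUP \<delta>\<in>{0<..}. INF U\<in>delta_covers \<delta> A. \<Sum>i. hausdorff_gauge s (U i))"

definition hausdorff_dim :: "'a::metric_space set \<Rightarrow> ennreal" where
  "hausdorff_dim A = Inf {ennreal s | s. 0 \<le> s \<and> hausdorff_measure s A = 0}"

section \<open>Conformal diffeomorphisms\<close>

definition C1_on :: "'a::euclidean_space set \<Rightarrow> ('a \<Rightarrow> 'a) \<Rightarrow> bool" where
  "C1_on W f \<longleftrightarrow>
     (\<exists>f' :: 'a \<Rightarrow> 'a \<Rightarrow>\<^sub>L 'a.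
        (\<forall>w\<in>W. (f has_derivative blinfun_apply (f' w)) (at w)) \<and> continuous_on W f')"

text \<open>
  Conformal means that the derivative at every point is a similarity; it may reverse
  orientation.  For dimension one this only says that the derivative does not vanish.
\<close>

definition conformal_on :: "'a::euclidean_space set \<Rightarrow> ('a \<Rightarrow> 'a) \<Rightarrow> bool" where
  "conformal_on W f \<longleftrightarrow>
     (\<forall>w\<in>W. \<exists>c>0. \<exists>T. orthogonal_transformation T \<and>
        (f has_derivative (\<lambda>v. c *\<^sub>R T v)) (at w))"

text \<open>``Into'': a diffeomorphism from \<open>W\<close> onto an open subset of \<open>W\<close>.\<close>

definition C1_conformal_diffeo_into :: "'a::euclidean_space set \<Rightarrow> ('a \<Rightarrow> 'a) \<Rightarrow> bool" where
  "C1_conformal_diffeo_into W f \<longleftrightarrow>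
     f ` W \<subseteq> W \<and> open (f ` W) \<and> inj_on f W \<and>
     C1_on W f \<and> C1_on (f ` W) (inv_into W f) \<and> conformal_on W f"

text \<open>
  The derivative on \<open>X\<close> is taken within \<open>X\<close>, so that it depends only on the values of the map
  on \<open>X\<close>.  If \<open>X\<close> has the cone property below, it is unique at every point of \<open>X\<close>, the boundary
  included, and hence agrees with the derivative of any differentiable extension.
\<close>

definition deriv_on :: "'a::euclidean_space set \<Rightarrow> ('a \<Rightarrow> 'a) \<Rightarrow> 'a \<Rightarrow> 'a \<Rightarrow> 'a" where
  "deriv_on X f x = frechet_derivative f (at x within X)"

definition sup_norm_on :: "'a set \<Rightarrow> ('a \<Rightarrow> 'b::real_normed_vector) \<Rightarrow> real" where
  "sup_norm_on X h = (SUP x\<in>X. norm (h x))"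

definition sup_onorm_on :: "'a set \<Rightarrow> ('a \<Rightarrow> 'b::real_normed_vector \<Rightarrow> 'b) \<Rightarrow> real" where
  "sup_onorm_on X h = (SUP x\<in>X. onorm (h x))"

section \<open>Conformal iterated function systems\<close>

text \<open>
  The open cone with vertex \<open>x\<close>, axis direction the unit vector \<open>u\<close>, opening (apex) angle
  \<open>\<gamma>\<close> and altitude \<open>l\<close>; the angle between axis and boundary is \<open>\<gamma>/2\<close>.
\<close>

definition open_cone :: "'a::euclidean_space \<Rightarrow> 'a \<Rightarrow> real \<Rightarrow> real \<Rightarrow> 'a set" where
  "open_cone x u \<gamma> l =
     {y. norm (y - x) * cos (\<gamma> / 2) < (y - x) \<bullet> u \<and> (y - x) \<bullet> u < l}"

definition cone_property :: "'a::euclidean_space set \<Rightarrow> bool" where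
  "cone_property X \<longleftrightarrow>
     (\<exists>\<gamma> l. 0 < \<gamma> \<and> \<gamma> < pi / 2 \<and> 0 < l \<and>
        (\<forall>x\<in>X. \<exists>u. norm u = 1 \<and> open_cone x u \<gamma> l \<subseteq> interior X))"

text \<open>
  A system is a pair of an index set and a family of maps, of which only the maps with index in
  \<open>I\<close>, restricted to \<open>X\<close>, matter.  The alphabet is the set of positive natural numbers.
\<close>

definition CIFS :: "'a::euclidean_space set \<Rightarrow> (nat set \<times> (nat \<Rightarrow> 'a \<Rightarrow> 'a)) set" where
  "CIFS X = {(I, \<phi>).
     0 \<notin> I \<and> (\<exists>a\<in>I. \<exists>b\<in>I. a \<noteq> b) \<and>
     (\<forall>e\<in>I. \<phi> e ` X \<subseteq> X \<and> inj_on (\<phi> e) X) \<and>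
     (\<exists>c<1. \<forall>e\<in>I. c-lipschitz_on X (\<phi> e)) \<and>
     (\<forall>a\<in>I. \<forall>b\<in>I. a \<noteq> b \<longrightarrow> \<phi> a ` interior X \<inter> \<phi> b ` interior X = {}) \<and>
     (\<exists>W. open W \<and> connected W \<and> X \<subseteq> W \<and>
        (\<forall>e\<in>I. \<exists>\<psi>. (\<forall>x\<in>X. \<psi> x = \<phi> e x) \<and> C1_conformal_diffeo_into W \<psi>)) \<and>
     cone_property X \<and>
     (\<exists>L\<ge>1. \<exists>\<alpha>>0. \<forall>e\<in>I. \<forall>x\<in>X. \<forall>y\<in>X.
        \<bar>onorm (deriv_on X (\<phi> e) y) - onorm (deriv_on X (\<phi> e) x)\<bar>
          \<le> L / sup_onorm_on X (\<lambda>z. inv (deriv_on X (\<phi> e) z)) * norm (y - x) powr \<alpha>)}"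

section \<open>Symbolic notation and limit sets\<close>

text \<open>
  Infinite words are functions on \<^typ>\<open>nat\<close> indexed from \<open>0\<close>, so the first letter of
  \<open>\<omega>\<close> is \<open>\<omega> 0\<close>; finite words are lists.
\<close>

definition seqs :: "nat set \<Rightarrow> (nat \<Rightarrow> nat) set" where
  "seqs J = {\<omega>. \<forall>i. \<omega> i \<in> J}"

definition words :: "nat set \<Rightarrow> nat \<Rightarrow> nat list set" where
  "words J n = {w. length w = n \<and> set w \<subseteq> J}"

definition prefix_of :: "(nat \<Rightarrow> nat) \<Rightarrow> nat \<Rightarrow> nat list" where
  "prefix_of \<omega> k = map \<omega> [0..<k]"

definition cylinder :: "nat list \<Rightarrow> (nat \<Rightarrow> nat) set" where
  "cylinder w = {\<tau>. prefix_of \<tau> (length w) = w}"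

definition shift :: "(nat \<Rightarrow> nat) \<Rightarrow> nat \<Rightarrow> nat" where
  "shift \<omega> = (\<lambda>i. \<omega> (Suc i))"

definition birkhoff_sum :: "nat \<Rightarrow> ((nat \<Rightarrow> nat) \<Rightarrow> real) \<Rightarrow> (nat \<Rightarrow> nat) \<Rightarrow> real" where
  "birkhoff_sum k g \<omega> = (\<Sum>n<k. g ((shift ^^ n) \<omega>))"

definition word_map :: "(nat \<Rightarrow> 'a \<Rightarrow> 'a) \<Rightarrow> nat list \<Rightarrow> 'a \<Rightarrow> 'a" where
  "word_map \<phi> w = foldr (\<lambda>e f. \<phi> e \<circ> f) w id"

definition coding_map :: "'a set \<Rightarrow> (nat \<Rightarrow> 'a \<Rightarrow> 'a) \<Rightarrow> (nat \<Rightarrow> nat) \<Rightarrow> 'a" where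
  "coding_map X \<phi> \<omega> = the_elem (\<Inter>k. word_map \<phi> (prefix_of \<omega> k) ` X)"

definition limit_set :: "'a set \<Rightarrow> nat set \<times> (nat \<Rightarrow> 'a \<Rightarrow> 'a) \<Rightarrow> 'a set" where
  "limit_set X \<Phi> = (case \<Phi> of (I, \<phi>) \<Rightarrow> coding_map X \<phi> ` seqs I)"

section \<open>Pressure\<close>

text \<open>
  \<open>exp (sup S\<^sub>n g)\<close> over \<open>[w] \<inter> J\<^sup>\<nat>\<close>, where \<open>n\<close> is the length of \<open>w\<close>.  The supremum is taken
  after the exponential, in \<open>[0, \<infinity>]\<close>, so that \<open>sup S\<^sub>n g = \<infinity>\<close> yields \<open>\<infinity>\<close>.
\<close>

definition exp_sup_cyl :: "nat set \<Rightarrow> ((nat \<Rightarrow> nat) \<Rightarrow> real) \<Rightarrow> nat list \<Rightarrow> ennreal" where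
  "exp_sup_cyl J g w =
     (SUP \<tau>\<in>cylinder w \<inter> seqs J. ennreal (exp (birkhoff_sum (length w) g \<tau>)))"

definition partition_fun :: "nat set \<Rightarrow> ((nat \<Rightarrow> nat) \<Rightarrow> real) \<Rightarrow> nat \<Rightarrow> ennreal" where
  "partition_fun J g n = (\<Sum>\<^sub>\<infinity>w\<in>words J n. exp_sup_cyl J g w)"

definition elog :: "ennreal \<Rightarrow> ereal" where
  "elog z = (if z = 0 then -\<infinity> else if z = \<infinity> then \<infinity> else ereal (ln (enn2real z)))"

definition pressure :: "nat set \<Rightarrow> ((nat \<Rightarrow> nat) \<Rightarrow> real) \<Rightarrow> ereal" where
  "pressure J g = lim (\<lambda>n. ereal (1 / real n) * elog (partition_fun J g n))"

definition geometric_potential ::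
    "'a::euclidean_space set \<Rightarrow> (nat \<Rightarrow> 'a \<Rightarrow> 'a) \<Rightarrow> (nat \<Rightarrow> nat) \<Rightarrow> real" where
  "geometric_potential X \<phi> \<omega> =
     ln (onorm (deriv_on X (\<phi> (\<omega> 0)) (coding_map X \<phi> (shift \<omega>))))"

section \<open>Regular convergence\<close>

definition rho_dist ::
    "'a::euclidean_space set \<Rightarrow> nat set \<times> (nat \<Rightarrow> 'a \<Rightarrow> 'a) \<Rightarrow>
       nat set \<times> (nat \<Rightarrow> 'a \<Rightarrow> 'a) \<Rightarrow> real" where
  "rho_dist X \<Phi>\<^sub>1 \<Phi>\<^sub>2 = (case \<Phi>\<^sub>1 of (I\<^sub>1, \<phi>\<^sub>1) \<Rightarrow> case \<Phi>\<^sub>2 of (I\<^sub>2, \<phi>\<^sub>2) \<Rightarrow>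
     (\<Sum>\<^sub>\<infinity>i\<in>I\<^sub>1 \<inter> I\<^sub>2. (1 / 2) ^ i *
        (sup_norm_on X (\<lambda>x. \<phi>\<^sub>1 i x - \<phi>\<^sub>2 i x) +
         sup_onorm_on X (\<lambda>x v. deriv_on X (\<phi>\<^sub>1 i) x v - deriv_on X (\<phi>\<^sub>2 i) x v))) +
     (\<Sum>\<^sub>\<infinity>i\<in>(I\<^sub>1 - I\<^sub>2) \<union> (I\<^sub>2 - I\<^sub>1). (1 / 2) ^ i))"

text \<open>
  Regular convergence of \<open>(\<Phi>\<^sup>n, 0)\<close> to \<open>(\<Phi>, 0)\<close>.  The word length \<open>k\<close> must be positive: for
  \<open>k = 0\<close> the comparison would be vacuous.
\<close>

definition converges_regularly_zero ::
    "'a::euclidean_space set \<Rightarrow> (nat \<Rightarrow> nat set \<times> (nat \<Rightarrow> 'a \<Rightarrow> 'a)) \<Rightarrow>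
       nat set \<times> (nat \<Rightarrow> 'a \<Rightarrow> 'a) \<Rightarrow> bool" where
  "converges_regularly_zero X \<Phi>s \<Phi> \<longleftrightarrow>
     (\<lambda>n. rho_dist X (\<Phi>s n) \<Phi>) \<longlonglongrightarrow> 0 \<and>
     (\<forall>s::real. pressure (fst \<Phi>) (\<lambda>\<omega>. s * geometric_potential X (snd \<Phi>) \<omega>) < \<infinity> \<longrightarrow>
        (\<exists>k\<ge>1. \<exists>C>0. \<forall>n. \<forall>w\<in>words (fst (\<Phi>s n)) k.
           exp_sup_cyl (fst (\<Phi>s n)) (\<lambda>\<omega>. s * geometric_potential X (snd (\<Phi>s n)) \<omega>) w
             \<le> ennreal C *
               exp_sup_cyl (fst \<Phi>) (\<lambda>\<omega>. s * geometric_potential X (snd \<Phi>) \<omega>) w))"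

end

theory Submission
  imports Defs "HOL-Library.Sublist"
begin

text \<open>
  Let \<open>|\<phi>\<^sub>w'(x)|\<close> be the ratio of the similarity that is the derivative at \<open>x\<close> of the map of a
  finite word \<open>w\<close> (below: \<open>word_scaling\<close>).  Condition (e) makes these ratios at any two points of
  \<open>X\<close> comparable, with a constant \<open>K\<close> that does not depend on the word (lemma \<open>distortion\<close>).  Hence
  it does not matter at which points of \<open>X\<close> sums over words are evaluated, as long as one can afford
  a constant factor.

  The dimension of the limit set is caught between two criteria, each of which asks for a single
  inequality.  If a finite set of letters \<open>F\<close>, a length \<open>m\<close> and lower bounds \<open>\<delta>(w)\<close> for
  \<open>|\<phi>\<^sub>w'|\<close> satisfy \<open>\<Sum> \<delta>(w)\<^sup>t \<ge> 1\<close>, summed over the words of length \<open>m\<close> in \<open>F\<close>, then the dimension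
  is at least \<open>t\<close> (lemma \<open>hausdorff_dim_limit_set_ge\<close>).  This is the mass distribution principle:
  words that block every infinite path in the tree of words have total weight at least one
  (\<open>kraft_inequality\<close>), while by the open set condition and the cones only boundedly many images of
  size \<open>r\<close> meet a set of diameter \<open>r\<close> (\<open>card_stopping_words_le\<close>).  In the other direction, if the
  partition function of \<open>s\<zeta>\<close> is less than one for some length, then by submultiplicativity it tends
  to zero along the multiples of this length, and covering the limit set by the images of \<open>X\<close> under
  all words of such a length shows that the dimension is at most \<open>s\<close>
  (\<open>hausdorff_dim_limit_set_le\<close>).  The criteria fit together (\<open>partition_fun_le\<close>): if the first one
  fails for \<open>t\<close>, whatever \<open>F\<close> and \<open>m\<close>, then the partition functions of \<open>s\<zeta>\<close> decay exponentially
  for every \<open>s > t\<close>.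

  Lower semicontinuity follows because the first criterion concerns only finitely many maps and is
  therefore inherited by all systems that are close enough in the \<open>\<rho>\<close>-metric
  (\<open>eventually_dim_greater\<close>).

  For upper semicontinuity let \<open>s\<close> exceed the dimension of the limit system.  Its partition
  functions tend to zero, so its pressure at \<open>s\<close> is finite and regular convergence provides \<open>k\<close> and
  \<open>C\<close>.  Over words of length \<open>kj\<close> the terms of the partition functions of all approximating systems
  are then dominated by one summable function (\<open>block_bound\<close>), and each single term is asymptotically
  at most a constant times the term of the limit system.  As in dominated convergence, the partition
  function of length \<open>kj\<close> of the approximating systems is eventually less than one, and the second
  criterion applies to them (\<open>eventually_dim_less\<close>).  The distortion constants of the approximating
  systems vary with the system; they occur only inside the two criteria, where the system is fixed.
\<close>

section \<open>Derivatives on sets with cones, and disjoint balls\<close>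

lemma onorm_similarity:
  fixes f :: "'a::euclidean_space \<Rightarrow> 'a"
  assumes "\<And>v. norm (f v) = k * norm v" "0 \<le> k"
  shows "onorm f = k"
proof -
  obtain b :: 'a where b: "b \<in> Basis" using nonempty_Basis by blast
  have "norm (f x) / norm x \<le> k" for x
    using assms by (cases "x = 0") (auto simp: divide_simps)
  moreover have "norm (f b) / norm b = k"
    using assms b by auto
  ultimately show ?thesis
    unfolding onorm_def by (metis (mono_tags, lifting) cSup_eq_maximum imageE rangeI)
qed

lemma has_derivative_along_ray:
  fixes f :: "'a::real_normed_vector \<Rightarrow> 'b::real_normed_vector"
  assumes f: "(f has_derivative A) (at x within X)" and "0 < d"
    and sub: "\<And>t. 0 < t \<Longrightarrow> t < d \<Longrightarrow> x + t *\<^sub>R v \<in> X"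
  shows "((\<lambda>t. (f (x + t *\<^sub>R v) - f x) /\<^sub>R t) \<longlongrightarrow> A v) (at_right 0)"
proof -
  let ?p = "\<lambda>t::real. x + t *\<^sub>R v"
  have p: "(?p has_derivative (\<lambda>t. t *\<^sub>R v)) (at 0 within {0<..<d})"
    by (auto intro!: derivative_eq_intros)
  have "?p ` {0<..<d} \<subseteq> X" using sub by auto
  then have "(f has_derivative A) (at (?p 0) within ?p ` {0<..<d})"
    using f by (auto intro: has_derivative_subset)
  from has_derivative_in_compose[OF p this]
  have "((\<lambda>t. f (?p t)) has_vector_derivative A v) (at 0 within {0<..<d})"
    using f linear_scale[OF has_derivative_linear[OF f]] by (simp add: has_vector_derivative_def)
  then have "((\<lambda>t. ((f (?p t) - f x) - t *\<^sub>R A v) /\<^sub>R \<bar>t\<bar>) \<longlongrightarrow> 0) (at 0 within {0<..<d})"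
    by (simp add: has_vector_derivative_def has_derivative_at_within)
  then have "((\<lambda>t. (f (?p t) - f x) /\<^sub>R t - A v) \<longlongrightarrow> 0) (at 0 within {0<..<d})"
    by (rule Lim_transform_eventually)
      (auto simp: eventually_at_filter scaleR_diff_right intro!: always_eventually)
  then have "((\<lambda>t. (f (?p t) - f x) /\<^sub>R t) \<longlongrightarrow> A v) (at 0 within {0<..<d})"
    by (simp add: LIM_zero_iff)
  moreover have "at 0 within {0<..<d} = at_right (0::real)"
    using \<open>0 < d\<close> by (intro at_within_nhd[of _ "{..<d}"]) auto
  ultimately show ?thesis by simp
qed

text \<open>
  At a boundary point of \<open>X\<close> the derivative within \<open>X\<close> is unique as soon as \<open>X\<close> contains a cone with
  this vertex: the derivative is determined along the open set of directions of the cone, and a linear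
  map is determined by its values on an open set.
\<close>

lemma has_derivative_within_cone_unique:
  fixes f :: "'a::real_normed_vector \<Rightarrow> 'b::real_normed_vector"
  assumes A: "(f has_derivative A) (at x within X)" and B: "(f has_derivative B) (at x within X)"
    and "0 < \<rho>"
    and cone: "\<And>v t. v \<in> ball a \<rho> \<Longrightarrow> 0 < t \<Longrightarrow> t \<le> 1 \<Longrightarrow> x + t *\<^sub>R v \<in> X"
  shows "A = B"
proof
  have eq: "A v = B v" if "v \<in> ball a \<rho>" for v
  proof -
    have "((\<lambda>t. (f (x + t *\<^sub>R v) - f x) /\<^sub>R t) \<longlongrightarrow> A v) (at_right 0)"
      "((\<lambda>t. (f (x + t *\<^sub>R v) - f x) /\<^sub>R t) \<longlongrightarrow> B v) (at_right 0)"
      using A B cone[OF that] by (intro has_derivative_along_ray[where d = 1 and X = X]; simp)+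
    then show ?thesis using tendsto_unique trivial_limit_at_right_real by blast
  qed
  have lin: "linear A" "linear B" using A B has_derivative_linear by blast+
  fix w :: 'a
  \<comment> \<open>A step small enough for \<open>a + s *\<^sub>R w\<close> to remain in the ball of directions.\<close>
  define s where "s = \<rho> / (2 * (norm w + 1))"
  have s: "s > 0" unfolding s_def using \<open>0 < \<rho>\<close> by (simp add: add_nonneg_pos)
  have "s * norm w < s * (2 * (norm w + 1))"
    using s by (intro mult_strict_left_mono) (auto simp: add_nonneg_pos)
  also have "\<dots> = \<rho>"
    unfolding s_def by (simp add: add_nonneg_eq_0_iff)
  finally have "a + s *\<^sub>R w \<in> ball a \<rho>" using s by (simp add: dist_norm)
  from eq[OF this] eq[of a] \<open>0 < \<rho>\<close> s show "A w = B w"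
    by (simp add: linear_add[OF lin(1)] linear_add[OF lin(2)] linear_scale[OF lin(1)] linear_scale[OF lin(2)])
qed

text \<open>
  Difference quotients along a direction that points into \<open>X\<close> are bounded by the Lipschitz constant.
  For a similarity, one such direction determines the norm.
\<close>

lemma lipschitz_derivative_bound:
  fixes f :: "'a::real_normed_vector \<Rightarrow> 'b::real_normed_vector"
  assumes A: "(f has_derivative A) (at x within X)" and "c-lipschitz_on X f" "x \<in> X"
    and cone: "\<And>t. 0 < t \<Longrightarrow> t \<le> 1 \<Longrightarrow> x + t *\<^sub>R v \<in> X"
  shows "norm (A v) \<le> c * norm v"
proof (rule tendsto_upperbound)
  show "((\<lambda>t. norm ((f (x + t *\<^sub>R v) - f x) /\<^sub>R t)) \<longlongrightarrow> norm (A v)) (at_right 0)"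
    using A cone by (intro tendsto_norm has_derivative_along_ray[where d = 1 and X = X]) auto
  have "norm ((f (x + t *\<^sub>R v) - f x) /\<^sub>R t) \<le> c * norm v" if "0 < t" "t < 1" for t :: real
  proof -
    have "norm (f (x + t *\<^sub>R v) - f x) \<le> c * norm (t *\<^sub>R v)"
      using lipschitz_onD[OF assms(2) cone assms(3), of t] that by (simp add: dist_norm)
    then show ?thesis using that by (simp add: divide_simps mult_ac)
  qed
  then show "\<forall>\<^sub>F t in at_right 0. norm ((f (x + t *\<^sub>R v) - f x) /\<^sub>R t) \<le> c * norm v"
    unfolding eventually_at_right_field by (intro exI[of _ 1]) auto
qed auto

text \<open>
  A quantitative form of openness.  The image of the ball is open by invariance of domain.  Running
  from the image of the centre along a segment of length less than \<open>m * r\<close>, the local inverse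
  is \<open>1 / m\<close>-Lipschitz and so stays inside a smaller closed ball; by compactness the segment cannot
  leave the image.
\<close>

lemma ball_subset_image_of_expanding:
  fixes f :: "'a::euclidean_space \<Rightarrow> 'a"
  assumes inj: "inj_on f (ball q r)" and "0 < m" "0 < r"
    and der: "\<And>x. x \<in> ball q r \<Longrightarrow> (f has_derivative f' x) (at x)"
    and exp: "\<And>x v. x \<in> ball q r \<Longrightarrow> m * norm v \<le> norm (f' x v)"
  shows "ball (f q) (m * r) \<subseteq> f ` ball q r"
proof
  let ?B = "ball q r"
  define S where "S = f ` ?B"
  define g where "g = inv_into ?B f"
  have cont: "continuous_on ?B f"
    using der by (meson continuous_at_imp_continuous_on has_derivative_continuous)
  have S: "open S" unfolding S_def using invariance_of_domain[OF cont open_ball inj] .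
  have gf: "g (f x) = x" if "x \<in> ?B" for x using inj that by (simp add: g_def)
  have gder: "\<exists>g'. (g has_derivative g') (at y) \<and> onorm g' \<le> 1 / m" if "y \<in> S" for y
  proof -
    obtain x where x: "x \<in> ?B" "y = f x" using \<open>y \<in> S\<close> S_def by auto
    have lin: "linear (f' x)" using der[OF x(1)] has_derivative_linear by blast
    have "inj (f' x)"
      unfolding linear_injective_0[OF lin]
    proof (intro allI impI)
      fix v assume "f' x v = 0"
      with exp[OF x(1), of v] \<open>0 < m\<close> show "v = 0" by (simp add: mult_le_0_iff)
    qed
    then obtain g' where g': "linear g'" "\<forall>v. f' x (g' v) = v"
      using linear_injective_isomorphism[OF lin] by blast
    have "(g has_derivative g') (at (f x))"
    proof (rule has_derivative_inverse_strong[OF open_ball x(1) cont gf der[OF x(1)]])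
      show "f' x \<circ> g' = id" using g'(2) by (simp add: fun_eq_iff)
    qed
    moreover have "onorm g' \<le> 1 / m"
    proof (rule onorm_bound)
      fix v show "norm (g' v) \<le> 1 / m * norm v"
        using exp[OF x(1), of "g' v"] g' \<open>0 < m\<close> by (simp add: field_simps)
    qed (use \<open>0 < m\<close> in auto)
    ultimately show ?thesis using x by blast
  qed
  then obtain g' where g': "\<And>y. y \<in> S \<Longrightarrow> (g has_derivative g' y) (at y)" "\<And>y. y \<in> S \<Longrightarrow> onorm (g' y) \<le> 1 / m"
    by metis
  fix y assume y: "y \<in> ball (f q) (m * r)"
  define z where "z t = f q + t *\<^sub>R (y - f q)" for t
  have contz: "continuous_on UNIV z" unfolding z_def by (intro continuous_intros)
  define R where "R = norm (y - f q) / m"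
  have "R < r" using y \<open>0 < m\<close> by (simp add: R_def dist_norm norm_minus_commute field_simps)
  have "0 \<le> R" using \<open>0 < m\<close> by (simp add: R_def)
  show "y \<in> f ` ?B"
  proof (rule ccontr)
    assume "y \<notin> f ` ?B"
    \<comment> \<open>The first time \<open>t0\<close> at which the segment would leave the image.\<close>
    define T where "T = {0..1} \<inter> z -` (- S)"
    have "compact T" unfolding T_def using S contz
      by (intro compact_Int_closed continuous_closed_vimage) (auto simp: continuous_on_eq_continuous_at)
    moreover have "1 \<in> T" using \<open>y \<notin> f ` ?B\<close> by (simp add: T_def S_def z_def)
    ultimately obtain t0 where t0: "t0 \<in> T" "\<And>t. t \<in> T \<Longrightarrow> t0 \<le> t"
      using compact_attains_inf[of T] by auto
    have "z 0 \<in> S" using \<open>0 < r\<close> by (simp add: z_def S_def)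
    with t0 have "t0 > 0" by (auto simp: T_def less_le)
    have before: "z t \<in> S" if "0 \<le> t" "t < t0" for t
      using t0 that by (force simp: T_def)
    have "z t \<in> f ` cball q R" if "t \<in> {0..<t0}" for t
    proof -
      have sub: "closed_segment (f q) (z t) \<subseteq> S"
      proof
        fix w assume "w \<in> closed_segment (f q) (z t)"
        then obtain u where u: "0 \<le> u" "u \<le> 1" "w = (1 - u) *\<^sub>R f q + u *\<^sub>R z t"
          by (auto simp: closed_segment_def)
        then have "w = z (u * t)" by (simp add: z_def algebra_simps)
        moreover have "u * t \<le> 1 * t" using u that by (intro mult_right_mono) auto
        ultimately show "w \<in> S" using u that before[of "u * t"] by auto
      qed
      have "norm (g (z t) - g (f q)) \<le> 1 / m * norm (z t - f q)"
        using sub g' by (intro differentiable_bound[of "closed_segment (f q) (z t)" g g'])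
          (auto intro: has_derivative_at_withinI)
      moreover have "g (f q) = q" using gf \<open>0 < r\<close> by simp
      moreover have "norm (z t - f q) \<le> norm (y - f q)"
        using that t0 by (auto simp: z_def T_def intro!: mult_left_le_one_le)
      ultimately have "norm (g (z t) - q) \<le> R"
        using \<open>0 < m\<close> unfolding R_def by (metis (no_types, lifting) divide_right_mono less_imp_le
            mult.commute mult.right_neutral order_trans times_divide_eq_right)
      moreover have "f (g (z t)) = z t"
        using before[of t] that gf unfolding S_def by fastforce
      ultimately show ?thesis by (metis dist_norm image_iff mem_cball norm_minus_commute)
    qed
    moreover have "closed (z -` (f ` cball q R))"
    proof (intro continuous_closed_vimage compact_imp_closed compact_continuous_image)
      show "continuous_on (cball q R) f" using \<open>R < r\<close> by (intro continuous_on_subset[OF cont]) auto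
    qed (use contz in \<open>auto simp: continuous_on_eq_continuous_at\<close>)
    ultimately have "closure {0..<t0} \<subseteq> z -` (f ` cball q R)"
      by (intro closure_minimal) auto
    moreover have "t0 \<in> closure {0..<t0}" using \<open>t0 > 0\<close> by (simp add: closure_atLeastLessThan)
    ultimately have "z t0 \<in> f ` cball q R" by (metis subsetD vimageD)
    then have "z t0 \<in> S" using \<open>R < r\<close> unfolding S_def by auto
    with t0 show False by (simp add: T_def)
  qed
qed

text \<open>
  Comparison of volumes.
\<close>

lemma card_disjoint_balls_le:
  fixes z :: "'i \<Rightarrow> 'a::euclidean_space"
  assumes "finite A" "0 < \<rho>" "0 < R"
    and disj: "disjoint_family_on (\<lambda>i. ball (z i) \<rho>) A"
    and sub: "\<And>i. i \<in> A \<Longrightarrow> ball (z i) \<rho> \<subseteq> ball z0 R"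
  shows "real (card A) \<le> (R / \<rho>) ^ DIM('a)"
proof -
  define V where "V = unit_ball_vol (real DIM('a))"
  have V: "V > 0" by (simp add: V_def)
  have "real (card A) * (V * \<rho> ^ DIM('a)) = (\<Sum>i\<in>A. measure lebesgue (ball (z i) \<rho>))"
    using \<open>0 < \<rho>\<close> by (simp add: content_ball V_def)
  also have "\<dots> = measure lebesgue (\<Union>i\<in>A. ball (z i) \<rho>)"
  proof (rule measure_finite_Union[symmetric])
    show "emeasure lebesgue (ball (z i) \<rho>) \<noteq> \<infinity>" if "i \<in> A" for i
      using emeasure_lborel_ball_finite[of "z i" \<rho>] by (simp add: less_top)
  qed (use \<open>finite A\<close> disj in auto)
  also have "\<dots> \<le> measure lebesgue (ball z0 R)"
    using sub by (intro measure_mono_fmeasurable) (auto intro!: fmeasurable.finite_UN \<open>finite A\<close>)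
  also have "\<dots> = V * R ^ DIM('a)"
    using \<open>0 < R\<close> by (simp add: content_ball V_def)
  finally show ?thesis using V \<open>0 < \<rho>\<close> by (simp add: field_simps power_divide)
qed

section \<open>Sums of extended nonnegative reals\<close>

lemma ennreal_summable_on: "(f :: 'b \<Rightarrow> ennreal) summable_on S"
  by (intro nonneg_summable_on_complete) simp

lemma ennreal_infsum_le:
  fixes f :: "'a \<Rightarrow> ennreal"
  assumes "\<And>S. finite S \<Longrightarrow> S \<subseteq> A \<Longrightarrow> sum f S \<le> b"
  shows "infsum f A \<le> b"
  using assms by (subst nonneg_infsum_complete) (auto intro!: SUP_least)

lemma ennreal_sum_le_infsum:
  fixes f :: "'a \<Rightarrow> ennreal"
  assumes "finite S" "S \<subseteq> A"
  shows "sum f S \<le> infsum f A"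
  using assms by (subst nonneg_infsum_complete) (auto intro!: SUP_upper)

text \<open>
  This replaces dominated convergence: outside a suitable finite set, a summable majorant is
  negligible.
\<close>

lemma ennreal_infsum_small_tail:
  fixes f :: "'i \<Rightarrow> ennreal"
  assumes fin: "infsum f A < \<infinity>" and "0 < \<epsilon>"
  obtains S where "finite S" "S \<subseteq> A" "infsum f (A - S) < \<epsilon>"
proof -
  define T where "T = infsum f A"
  show ?thesis
  proof (cases "T = 0")
    case True
    then show ?thesis using that[of "{}"] \<open>0 < \<epsilon>\<close> by (simp add: T_def)
  next
    case False
    have "T - \<epsilon> < T" using fin False \<open>0 < \<epsilon>\<close> by (intro ennreal_between) (auto simp: T_def zero_less_iff_neq_zero)
    also have "T = (SUP S\<in>{S. finite S \<and> S \<subseteq> A}. sum f S)"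
      unfolding T_def by (rule nonneg_infsum_complete) simp
    finally obtain S where S: "finite S" "S \<subseteq> A" "T - \<epsilon> < sum f S" unfolding less_SUP_iff by blast
    have "infsum f (S \<union> (A - S)) = infsum f S + infsum f (A - S)"
      by (rule infsum_Un_disjoint) (auto intro: ennreal_summable_on)
    moreover have "S \<union> (A - S) = A" using S by auto
    ultimately have split: "T = sum f S + infsum f (A - S)" using S by (simp add: T_def)
    have "infsum f (A - S) < \<epsilon>"
    proof (rule ccontr)
      assume "\<not> ?thesis"
      then have "sum f S + \<epsilon> \<le> T" unfolding split by (simp add: add_left_mono)
      then have "sum f S \<le> T - \<epsilon>" by (simp add: ennreal_le_minus_iff)
      then show False using S(3) by simp
    qed
    then show ?thesis using that S by blast
  qed
qed

lemma ennreal_le_suminf: "f i \<le> (\<Sum>i. f i :: ennreal)"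
proof (rule ccontr)
  assume "\<not> ?thesis"
  then have "(\<Sum>i. f i) < f i" by simp
  from ennreal_suminf_lessD[OF this] show False by blast
qed

section \<open>A Kraft inequality for infinite trees\<close>

text \<open>
  Think of \<open>W\<close> as a set of nodes of the tree of words over \<open>G\<close> that every infinite path meets, a word
  carrying the product of the weights of its letters.  Suppose that the total weight of \<open>W\<close> is less than
  one.  The weights of the letters sum to at least one, so from a node below which \<open>W\<close> has relative
  weight less than one it is possible to pass to a child with the same property.  The infinite path
  built in this way avoids \<open>W\<close>.  Arguing along a path takes the place of a product measure on the space
  of sequences, and it works for infinite \<open>W\<close>.
\<close>

lemma kraft_inequality:
  fixes q :: "'g \<Rightarrow> real"
  assumes "finite G" and q: "\<And>g. g \<in> G \<Longrightarrow> 0 \<le> q g" "1 \<le> sum q G"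
    and bar: "\<And>\<omega>. (\<forall>i. \<omega> i \<in> G) \<Longrightarrow> \<exists>k. map \<omega> [0..<k] \<in> W"
  shows "1 \<le> (\<integral>\<^sup>+v. ennreal (prod_list (map q v)) * indicator W v \<partial>count_space (lists G))"
proof (rule ccontr)
  define h where "h v u = ennreal (prod_list (map q u)) * indicator W (v @ u)" for v u
  define M where "M v = (\<integral>\<^sup>+u. h v u \<partial>count_space (lists G))" for v
  have nonneg: "0 \<le> prod_list (map q u)" if "u \<in> lists G" for u
    using that q by (induction u) auto
  \<comment> \<open>The words that properly extend \<open>v\<close> are distributed among the children of \<open>v\<close>.\<close>
  have step: "(\<Sum>g\<in>G. ennreal (q g) * M (v @ [g])) \<le> M v" for v
  proof -
    have "ennreal (q g) * M (v @ [g])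
        = (\<integral>\<^sup>+u. h v u * indicator ((#) g ` lists G) u \<partial>count_space UNIV)" if "g \<in> G" for g
    proof -
      have "ennreal (q g) * M (v @ [g]) = (\<integral>\<^sup>+u. ennreal (q g) * h (v @ [g]) u \<partial>count_space (lists G))"
        unfolding M_def by (simp add: nn_integral_cmult)
      also have "\<dots> = (\<integral>\<^sup>+u. h v (g # u) \<partial>count_space (lists G))"
        using that q nonneg by (intro nn_integral_cong) (simp add: h_def ennreal_mult mult.assoc)
      also have "\<dots> = (\<integral>\<^sup>+u. h v u \<partial>count_space ((#) g ` lists G))"
        by (intro nn_integral_bij_count_space) (auto simp: bij_betw_def)
      finally show ?thesis by (simp add: nn_integral_count_space_indicator)
    qed
    then have "(\<Sum>g\<in>G. ennreal (q g) * M (v @ [g]))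
        = (\<integral>\<^sup>+u. (\<Sum>g\<in>G. h v u * indicator ((#) g ` lists G) u) \<partial>count_space UNIV)"
      by (simp add: nn_integral_sum)
    also have "\<dots> \<le> (\<integral>\<^sup>+u. h v u * indicator (lists G) u \<partial>count_space UNIV)"
    proof (intro nn_integral_mono)
      fix u
      show "(\<Sum>g\<in>G. h v u * indicator ((#) g ` lists G) u) \<le> h v u * indicator (lists G) u"
      proof (cases "u \<in> lists G \<and> u \<noteq> []")
        case True
        then obtain a u' where u: "u = a # u'" "a \<in> G" "u' \<in> lists G" by (cases u) auto
        have "(\<Sum>g\<in>G. h v u * indicator ((#) g ` lists G) u) = (\<Sum>g\<in>G. if g = a then h v u else 0)"
          using u by (intro sum.cong) (auto simp: indicator_def)
        then show ?thesis using u \<open>finite G\<close> by simp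
      next
        case False
        then have "u \<notin> (#) g ` lists G" if "g \<in> G" for g using that by auto
        then show ?thesis by (simp add: sum.neutral)
      qed
    qed
    finally show ?thesis by (simp add: M_def nn_integral_count_space_indicator)
  qed
  assume neg: "\<not> ?thesis"
  define P where "P n v \<longleftrightarrow> v \<in> lists G \<and> M v < 1 \<and> (n = 0 \<longrightarrow> v = [])" for n :: nat and v
  have "\<exists>y. P (Suc n) y \<and> (\<exists>g\<in>G. y = x @ [g])" if x: "P n x" for n x
  proof (rule ccontr)
    assume "\<not> ?thesis"
    then have "\<not> P (Suc n) (x @ [g])" if "g \<in> G" for g using that by blast
    then have ge: "1 \<le> M (x @ [g])" if "g \<in> G" for g using that x by (auto simp: P_def not_less)
    have "1 \<le> ennreal (sum q G)" using q(2) by (simp add: ennreal_1[symmetric] del: ennreal_1)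
    also have "\<dots> = (\<Sum>g\<in>G. ennreal (q g) * 1)" using q by (simp add: sum_ennreal)
    also have "\<dots> \<le> (\<Sum>g\<in>G. ennreal (q g) * M (x @ [g]))"
      using ge by (intro sum_mono mult_left_mono) auto
    also have "\<dots> \<le> M x" by (rule step)
    finally show False using x by (simp add: P_def not_less[symmetric])
  qed
  moreover have "P 0 []" using neg by (simp add: P_def M_def h_def)
  ultimately obtain f where f: "\<And>n. P n (f n)" "\<And>n. \<exists>g\<in>G. f (Suc n) = f n @ [g]"
    using dependent_nat_choice[of P "\<lambda>n x y. \<exists>g\<in>G. y = x @ [g]"] by metis
  then obtain \<omega> where \<omega>: "\<And>n. \<omega> n \<in> G" "\<And>n. f (Suc n) = f n @ [\<omega> n]" by metis
  have prefix: "map \<omega> [0..<k] = f k" for k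
  proof (induction k)
    case 0
    then show ?case using f(1)[of 0] by (simp add: P_def)
  qed (simp add: \<omega>(2))
  obtain k where "map \<omega> [0..<k] \<in> W" using bar \<omega>(1) by blast
  then have "h (f k) [] = 1" by (simp add: h_def prefix)
  moreover have "h (f k) [] \<le> M (f k)"
    unfolding M_def by (intro nn_integral_ge_point) auto
  moreover have "M (f k) < 1" using f(1) by (simp add: P_def)
  ultimately show False by simp
qed

section \<open>Coverings and Hausdorff dimension\<close>

text \<open>
  Sums over an arbitrary countable index type are more convenient for covers by cylinder sets than
  sequences of sets.
\<close>

lemma hausdorff_dim_leI:
  fixes A :: "'a::metric_space set"
  assumes "0 \<le> s"
    and cover: "\<And>\<delta> \<epsilon>. 0 < \<delta> \<Longrightarrow> 0 < \<epsilon> \<Longrightarrow> \<exists>(P :: 'i::countable set) V. A \<subseteq> (\<Union>p\<in>P. V p) \<and>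
        (\<forall>p\<in>P. bounded (V p) \<and> diameter (V p) \<le> \<delta>) \<and>
        (\<Sum>\<^sub>\<infinity>p\<in>P. hausdorff_gauge s (V p)) \<le> ennreal \<epsilon>"
  shows "hausdorff_dim A \<le> ennreal s"
proof -
  have "(INF U\<in>delta_covers \<delta> A. \<Sum>i. hausdorff_gauge s (U i)) = 0" if "0 < \<delta>" for \<delta>
  proof (rule antisym[OF ennreal_le_epsilon])
    fix \<epsilon> :: real assume "0 < \<epsilon>"
    obtain P :: "'i set" and V where PV: "A \<subseteq> (\<Union>p\<in>P. V p)"
      "\<And>p. p \<in> P \<Longrightarrow> bounded (V p) \<and> diameter (V p) \<le> \<delta>"
      "(\<Sum>\<^sub>\<infinity>p\<in>P. hausdorff_gauge s (V p)) \<le> ennreal \<epsilon>"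
      using cover[OF \<open>0 < \<delta>\<close> \<open>0 < \<epsilon>\<close>] by blast
    define U where "U i = (if i \<in> to_nat ` P then V (from_nat i) else {})" for i
    have "A \<subseteq> (\<Union>i. U i)"
    proof
      fix x assume "x \<in> A"
      then obtain p where "p \<in> P" "x \<in> V p" using PV(1) by auto
      then have "x \<in> U (to_nat p)" by (simp add: U_def)
      then show "x \<in> (\<Union>i. U i)" by blast
    qed
    then have U: "U \<in> delta_covers \<delta> A"
      using PV(2) \<open>0 < \<delta>\<close> by (auto simp: delta_covers_def U_def)
    have "((\<lambda>i. hausdorff_gauge s (U i)) has_sum (\<Sum>\<^sub>\<infinity>i. hausdorff_gauge s (U i))) UNIV"
      by (intro has_sum_infsum ennreal_summable_on)
    then have "(\<Sum>i. hausdorff_gauge s (U i)) = (\<Sum>\<^sub>\<infinity>i. hausdorff_gauge s (U i))"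
      using has_sum_imp_sums sums_unique by metis
    also have "\<dots> = (\<Sum>\<^sub>\<infinity>i\<in>to_nat ` P. hausdorff_gauge s (U i))"
      by (rule infsum_cong_neutral) (auto simp: U_def hausdorff_gauge_def)
    also have "\<dots> = (\<Sum>\<^sub>\<infinity>p\<in>P. hausdorff_gauge s (U (to_nat p)))"
      by (subst infsum_reindex) (auto simp: o_def)
    also have "\<dots> = (\<Sum>\<^sub>\<infinity>p\<in>P. hausdorff_gauge s (V p))"
      by (rule infsum_cong) (simp add: U_def)
    finally show "(INF U\<in>delta_covers \<delta> A. \<Sum>i. hausdorff_gauge s (U i)) \<le> 0 + ennreal \<epsilon>"
      using PV(3) U by (auto intro!: INF_lower2[of U])
  qed auto
  then have "hausdorff_measure s A = 0"
    unfolding hausdorff_measure_def by (simp add: SUP_eq_const)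
  then show ?thesis
    unfolding hausdorff_dim_def using \<open>0 \<le> s\<close> by (intro Inf_lower) auto
qed

text \<open>
  The mass distribution principle.  For \<open>s < t\<close> and sets of diameter at most one the \<open>t\<close>-th power of the
  diameter is at most the \<open>s\<close>-th power, so a common lower bound for all covers at the exponent \<open>t\<close>
  rules out that the Hausdorff measure vanishes at a smaller exponent.
\<close>

lemma hausdorff_dim_geI:
  fixes A :: "'a::metric_space set"
  assumes "0 < t" "0 < \<epsilon>"
    and cover: "\<And>U. A \<subseteq> (\<Union>i. U i) \<Longrightarrow> (\<And>i. bounded (U i)) \<Longrightarrow>
      \<epsilon> \<le> (\<Sum>i. ennreal (diameter (U i) powr t))"
  shows "ennreal t \<le> hausdorff_dim A"
  unfolding hausdorff_dim_def
proof (rule Inf_greatest, clarify)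
  fix s :: real assume s: "0 \<le> s" "hausdorff_measure s A = 0"
  show "ennreal t \<le> ennreal s"
  proof (rule ccontr)
    assume "\<not> ?thesis"
    then have "s < t" using s by (simp add: not_le ennreal_less_iff)
    have "(INF U\<in>delta_covers 1 A. \<Sum>i. hausdorff_gauge s (U i)) \<le> hausdorff_measure s A"
      unfolding hausdorff_measure_def by (rule SUP_upper) simp
    with s \<open>0 < \<epsilon>\<close> have "(INF U\<in>delta_covers 1 A. \<Sum>i. hausdorff_gauge s (U i)) < \<epsilon>" by simp
    then obtain U where U: "U \<in> delta_covers 1 A" "(\<Sum>i. hausdorff_gauge s (U i)) < \<epsilon>"
      unfolding INF_less_iff by blast
    have "ennreal (diameter (U i) powr t) \<le> hausdorff_gauge s (U i)" for i
    proof (cases "U i = {}")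
      case False
      have "bounded (U i)" "diameter (U i) \<le> 1" using U(1) by (auto simp: delta_covers_def)
      moreover have "0 \<le> diameter (U i)" using diameter_ge_0 \<open>bounded (U i)\<close> by blast
      ultimately have "diameter (U i) powr t \<le> (if s = 0 then 1 else diameter (U i) powr s)"
        using \<open>s < t\<close> \<open>0 < t\<close> by (auto intro: powr_mono' powr_le1)
      with False show ?thesis by (auto simp: hausdorff_gauge_def ennreal_1[symmetric] simp del: ennreal_1)
    qed (simp add: hausdorff_gauge_def \<open>0 < t\<close>)
    then have "(\<Sum>i. ennreal (diameter (U i) powr t)) \<le> (\<Sum>i. hausdorff_gauge s (U i))"
      by (intro suminf_le) auto
    also have "\<dots> < \<epsilon>" by (rule U)
    also have "\<epsilon> \<le> (\<Sum>i. ennreal (diameter (U i) powr t))"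
      using U(1) by (intro cover) (auto simp: delta_covers_def)
    finally show False by simp
  qed
qed

text \<open>
  Replaces the diameters of a cover by slightly larger, strictly positive radii.  Sets with at most one
  point have diameter zero, but a stopping time needs a positive scale.
\<close>

lemma diameter_powr_cover_sum:
  fixes U :: "nat \<Rightarrow> 'a::metric_space set"
  assumes "0 < t" "0 < \<epsilon>" "\<epsilon> \<le> 1/2" and U: "\<And>i. bounded (U i)"
    and small: "(\<Sum>i. ennreal (diameter (U i) powr t)) < ennreal \<epsilon>"
  obtains r where "\<And>i. 0 < r i" "\<And>i. r i < 1" "\<And>i. diameter (U i) \<le> r i"
    "(\<Sum>i. ennreal (r i powr t)) \<le> ennreal (2 * \<epsilon>)"
proof
  \<comment> \<open>The geometric series adds a total of \<open>\<epsilon>\<close>.\<close>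
  define b where "b i = diameter (U i) powr t + \<epsilon> * (1 / 2) ^ Suc i" for i
  define r where "r i = b i powr (1 / t)" for i
  have b: "0 < b i" for i unfolding b_def using \<open>0 < \<epsilon>\<close> by (intro add_nonneg_pos) auto
  have rb: "r i powr t = b i" for i using b[of i] \<open>0 < t\<close> by (simp add: r_def powr_powr)
  show "0 < r i" for i using b[of i] by (simp add: r_def)
  have "diameter (U i) powr t < \<epsilon>" for i
  proof -
    have "ennreal (diameter (U i) powr t) < ennreal \<epsilon>" using small by (rule ennreal_suminf_lessD)
    then show ?thesis by (simp add: ennreal_less_iff)
  qed
  moreover have "\<epsilon> * (1 / 2) ^ Suc i \<le> \<epsilon> * 1" for i
    using \<open>0 < \<epsilon>\<close> by (intro mult_left_mono power_le_one) auto
  ultimately have "b i < 1" for i using \<open>\<epsilon> \<le> 1/2\<close> unfolding b_def by (smt (verit) field_sum_of_halves)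
  then show "r i < 1" for i
    unfolding r_def using b[of i] \<open>0 < t\<close> powr_less_mono2[of "1 / t" "b i" 1] by simp
  show "diameter (U i) \<le> r i" for i
  proof -
    have "0 \<le> diameter (U i)" using U diameter_ge_0 by blast
    then have "diameter (U i) = (diameter (U i) powr t) powr (1 / t)"
      using \<open>0 < t\<close> by (simp add: powr_powr)
    also have "\<dots> \<le> r i"
      unfolding r_def b_def using \<open>0 < t\<close> \<open>0 < \<epsilon>\<close> by (intro powr_mono2) auto
    finally show ?thesis .
  qed
  have geo: "(\<Sum>i. ennreal (\<epsilon> * (1 / 2) ^ Suc i)) = ennreal \<epsilon>"
    using \<open>0 < \<epsilon>\<close> sums_mult[OF power_half_series, of \<epsilon>] by (intro suminf_ennreal_eq) auto
  have "(\<Sum>i. ennreal (r i powr t))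
      = (\<Sum>i. ennreal (diameter (U i) powr t) + ennreal (\<epsilon> * (1 / 2) ^ Suc i))"
    unfolding rb b_def using \<open>0 < \<epsilon>\<close> by (intro suminf_cong ennreal_plus) auto
  also have "\<dots> = (\<Sum>i. ennreal (diameter (U i) powr t)) + ennreal \<epsilon>"
    by (simp only: suminf_add[symmetric, OF summableI summableI] geo)
  also have "\<dots> \<le> ennreal \<epsilon> + ennreal \<epsilon>"
    using small by (intro add_mono) auto
  also have "\<dots> = ennreal (2 * \<epsilon>)" using \<open>0 < \<epsilon>\<close> by (simp flip: ennreal_plus)
  finally show "(\<Sum>i. ennreal (r i powr t)) \<le> ennreal (2 * \<epsilon>)" .
qed

section \<open>Partition functions and pressure\<close>

lemma finite_words: "finite F \<Longrightarrow> finite (words F n)"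
  unfolding words_def by (rule finite_subset[OF _ finite_lists_length_eq[of F n]]) auto

lemma words_0 [simp]: "words J 0 = {[]}" by (auto simp: words_def)

lemma shift_funpow: "(shift ^^ n) \<omega> = (\<lambda>i. \<omega> (i + n))"
  by (induction n) (auto simp: shift_def)

lemma shift_funpow_seqs: "\<omega> \<in> seqs J \<Longrightarrow> (shift ^^ n) \<omega> \<in> seqs J"
  by (simp add: shift_funpow seqs_def)

lemma prefix_of_add: "prefix_of \<omega> (m + n) = prefix_of \<omega> m @ prefix_of ((shift ^^ m) \<omega>) n"
  by (rule nth_equalityI) (auto simp: prefix_of_def nth_append shift_funpow)

lemma prefix_of_in_words: "\<omega> \<in> seqs J \<Longrightarrow> prefix_of \<omega> n \<in> words J n"
  by (auto simp: prefix_of_def words_def seqs_def)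

lemma length_prefix_of [simp]: "length (prefix_of \<omega> n) = n" by (simp add: prefix_of_def)

lemma prefix_of_Suc: "prefix_of \<omega> (Suc n) = \<omega> 0 # prefix_of (shift \<omega>) n"
  using prefix_of_add[of \<omega> 1 n] by (simp add: prefix_of_def)

lemma cylinder_append: "\<tau> \<in> cylinder (u @ v) \<longleftrightarrow> \<tau> \<in> cylinder u \<and> (shift ^^ length u) \<tau> \<in> cylinder v"
  by (auto simp: cylinder_def prefix_of_add)

lemma birkhoff_sum_add:
  "birkhoff_sum (m + n) g \<tau> = birkhoff_sum m g \<tau> + birkhoff_sum n g ((shift ^^ m) \<tau>)"
  by (induction n) (auto simp: birkhoff_sum_def shift_funpow add_ac)

lemma exp_sup_cyl_append:
  "exp_sup_cyl J g (u @ v) \<le> exp_sup_cyl J g u * exp_sup_cyl J g v"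
  unfolding exp_sup_cyl_def[of J g "u @ v"]
proof (rule SUP_least)
  fix \<tau> assume \<tau>: "\<tau> \<in> cylinder (u @ v) \<inter> seqs J"
  let ?\<tau>' = "(shift ^^ length u) \<tau>"
  have "ennreal (exp (birkhoff_sum (length (u @ v)) g \<tau>))
      = ennreal (exp (birkhoff_sum (length u) g \<tau>)) * ennreal (exp (birkhoff_sum (length v) g ?\<tau>'))"
    by (simp add: birkhoff_sum_add exp_add ennreal_mult)
  also have "\<dots> \<le> exp_sup_cyl J g u * exp_sup_cyl J g v"
    unfolding exp_sup_cyl_def using \<tau>
    by (intro mult_mono SUP_upper) (auto simp: cylinder_append shift_funpow_seqs)
  finally show "ennreal (exp (birkhoff_sum (length (u @ v)) g \<tau>)) \<le> exp_sup_cyl J g u * exp_sup_cyl J g v" .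
qed

text \<open>
  Only the inequality is needed; it can be checked on finite sets of words, which avoids rearranging
  infinite sums.
\<close>

lemma infsum_words_add_le:
  fixes f g :: "nat list \<Rightarrow> ennreal"
  shows "(\<Sum>\<^sub>\<infinity>w\<in>words J (k + l). f (take k w) * g (drop k w)) \<le> infsum f (words J k) * infsum g (words J l)"
proof (rule ennreal_infsum_le)
  fix S assume S: "finite S" "S \<subseteq> words J (k + l)"
  let ?s = "\<lambda>w. (take k w, drop k w)"
  have inj: "inj_on ?s S" by (rule inj_onI) (metis append_take_drop_id prod.inject)
  have "(\<Sum>w\<in>S. f (take k w) * g (drop k w)) = (\<Sum>(u, v)\<in>?s ` S. f u * g v)"
    by (simp add: sum.reindex[OF inj])
  also have "\<dots> \<le> (\<Sum>(u, v)\<in>take k ` S \<times> drop k ` S. f u * g v)"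
    using S by (intro sum_mono2) auto
  also have "\<dots> = sum f (take k ` S) * sum g (drop k ` S)"
    by (simp add: sum_product sum.cartesian_product)
  also have "\<dots> \<le> infsum f (words J k) * infsum g (words J l)"
    using S by (intro mult_mono ennreal_sum_le_infsum)
      (fastforce simp: words_def dest: in_set_takeD in_set_dropD)+
  finally show "(\<Sum>w\<in>S. f (take k w) * g (drop k w)) \<le> infsum f (words J k) * infsum g (words J l)" .
qed

lemma partition_fun_add_le: "partition_fun J g (k + l) \<le> partition_fun J g k * partition_fun J g l"
proof -
  have "partition_fun J g (k + l) \<le> (\<Sum>\<^sub>\<infinity>w\<in>words J (k + l). exp_sup_cyl J g (take k w) * exp_sup_cyl J g (drop k w))"
    unfolding partition_fun_def using exp_sup_cyl_append[of J g "take k w" "drop k w" for w]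
    by (intro infsum_mono ennreal_summable_on) auto
  also have "\<dots> \<le> partition_fun J g k * partition_fun J g l"
    unfolding partition_fun_def by (rule infsum_words_add_le)
  finally show ?thesis .
qed

lemma partition_fun_mult_le:
  assumes "partition_fun J g 0 \<le> 1"
  shows "partition_fun J g (m * n) \<le> partition_fun J g m ^ n"
proof (induction n)
  case (Suc n)
  have "partition_fun J g (m * Suc n) \<le> partition_fun J g m * partition_fun J g (m * n)"
    using partition_fun_add_le[of J g m "m * n"] by simp
  also have "\<dots> \<le> partition_fun J g m * partition_fun J g m ^ n"
    using Suc by (intro mult_left_mono) auto
  finally show ?case by simp
qed (use assms in simp)

text \<open>
  Fekete's lemma.  The limit may be \<open>-\<infinity>\<close>, so it is taken in the extended reals.
\<close>

lemma subadditive_tendsto_INF: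
  fixes x :: "nat \<Rightarrow> real"
  assumes sub: "\<And>m n. x (m + n) \<le> x m + x n"
  shows "(\<lambda>n. ereal (x n / real n)) \<longlonglongrightarrow> (INF n\<in>{1..}. ereal (x n / real n))"
proof (rule order_tendstoI)
  fix a assume "a < (INF n\<in>{1..}. ereal (x n / real n))"
  then have "a < ereal (x n / real n)" if "1 \<le> n" for n
    using that by (meson INF_lower atLeast_iff less_le_trans)
  then show "\<forall>\<^sub>F n in sequentially. a < ereal (x n / real n)"
    unfolding eventually_sequentially by blast
next
  fix a assume "(INF n\<in>{1..}. ereal (x n / real n)) < a"
  then obtain m where m: "1 \<le> m" "ereal (x m / real m) < a" by (auto simp: INF_less_iff)
  define B where "B = Max (x ` {..<m})"
  define C where "C = B + \<bar>x m\<bar>"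
  have B: "x r \<le> B" if "r < m" for r using that by (simp add: B_def)
  have mult: "x (q * m) \<le> real q * x m + x 0" for q
  proof (induction q)
    case (Suc q)
    then show ?case using sub[of m "q * m"] by (simp add: algebra_simps)
  qed simp
  have bound: "x n / real n \<le> x m / real m + (C + \<bar>x 0\<bar>) / real n" if "1 \<le> n" for n
  proof -
    have "x n \<le> x (n div m * m) + x (n mod m)" using sub[of "n div m * m" "n mod m"] by simp
    also have "\<dots> \<le> real (n div m) * x m + \<bar>x 0\<bar> + B"
      using mult[of "n div m"] B[of "n mod m"] m by simp
    also have "real (n div m) * x m \<le> real n * (x m / real m) + \<bar>x m\<bar>"
    proof -
      have "real n = real (n div m) * real m + real (n mod m)"
        by (metis div_mult_mod_eq of_nat_add of_nat_mult)
      then have "real n * (x m / real m) = real (n div m) * x m + real (n mod m) / real m * x m"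
        using m by (simp add: field_simps)
      moreover have "\<bar>real (n mod m) / real m * x m\<bar> \<le> 1 * \<bar>x m\<bar>"
        unfolding abs_mult using m by (intro mult_right_mono) (auto simp: field_simps)
      ultimately show ?thesis by linarith
    qed
    finally have "x n \<le> real n * (x m / real m) + (C + \<bar>x 0\<bar>)" by (simp add: C_def)
    then show ?thesis using that m by (simp add: field_simps)
  qed
  have "(\<lambda>n. x m / real m + (C + \<bar>x 0\<bar>) / real n) \<longlonglongrightarrow> x m / real m + 0"
    by (intro tendsto_add tendsto_const lim_const_over_n)
  then have "\<forall>\<^sub>F n in sequentially. ereal (x m / real m + (C + \<bar>x 0\<bar>) / real n) < a"
    using m by (intro order_tendstoD(2)[where y = "ereal (x m / real m)"]) auto
  then show "\<forall>\<^sub>F n in sequentially. ereal (x n / real n) < a"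
    using eventually_ge_at_top[of 1]
    by eventually_elim (use bound in \<open>meson ereal_less_eq(3) le_less_trans\<close>)
qed

text \<open>
  The pressure is a limit, and an upper bound for it has a meaning only because the limit exists.
  This is where submultiplicativity enters.
\<close>

lemma pressure_less_top:
  assumes "\<And>n. partition_fun J g n \<noteq> 0" "\<And>n. partition_fun J g n < \<infinity>"
  shows "pressure J g < \<infinity>"
proof -
  define x where "x n = ln (enn2real (partition_fun J g n))" for n
  have pos: "0 < enn2real (partition_fun J g n)" for n
    using assms by (simp add: enn2real_positive_iff zero_less_iff_neq_zero)
  have "x (m + n) \<le> x m + x n" for m n
  proof -
    have "enn2real (partition_fun J g (m + n)) \<le> enn2real (partition_fun J g m * partition_fun J g n)"
      using partition_fun_add_le assms by (intro enn2real_mono) (auto simp: ennreal_mult_less_top)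
    then have "ln (enn2real (partition_fun J g (m + n))) \<le> ln (enn2real (partition_fun J g m) * enn2real (partition_fun J g n))"
      using pos by (subst ln_le_cancel_iff) (auto simp: enn2real_mult)
    then show ?thesis using pos[of m] pos[of n] by (simp add: x_def ln_mult)
  qed
  then have "(\<lambda>n. ereal (x n / real n)) \<longlonglongrightarrow> (INF n\<in>{1..}. ereal (x n / real n))"
    by (rule subadditive_tendsto_INF)
  moreover have "ereal (1 / real n) * elog (partition_fun J g n) = ereal (x n / real n)" for n
    using assms by (auto simp: elog_def x_def less_top[symmetric] less_imp_neq)
  ultimately have "pressure J g = (INF n\<in>{1..}. ereal (x n / real n))"
    unfolding pressure_def by (simp add: limI)
  also have "\<dots> \<le> ereal (x 1 / real 1)" by (rule INF_lower) simp
  also have "\<dots> < \<infinity>" by simp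
  finally show ?thesis .
qed

section \<open>Conformal systems: distortion and coding\<close>

text \<open>
  The ratio \<open>|\<phi>\<^sub>e'(x)|\<close> of the similarity \<open>\<phi>\<^sub>e'(x)\<close>.
\<close>

definition scaling :: "'a::euclidean_space set \<Rightarrow> (nat \<Rightarrow> 'a \<Rightarrow> 'a) \<Rightarrow> nat \<Rightarrow> 'a \<Rightarrow> real" where
  "scaling X \<phi> e x = onorm (deriv_on X (\<phi> e) x)"

text \<open>
  The chain rule is built into the definition: for points of \<open>X\<close> this is \<open>|\<phi>\<^sub>w'(x)|\<close> by lemma
  \<open>has_derivative_word_map\<close> below.
\<close>

primrec word_scaling ::
    "'a::euclidean_space set \<Rightarrow> (nat \<Rightarrow> 'a \<Rightarrow> 'a) \<Rightarrow> nat list \<Rightarrow> 'a \<Rightarrow> real" where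
  "word_scaling X \<phi> [] x = 1"
| "word_scaling X \<phi> (e # w) x = scaling X \<phi> e (word_map \<phi> w x) * word_scaling X \<phi> w x"

lemma word_map_Nil [simp]: "word_map \<phi> [] x = x"
  and word_map_Cons [simp]: "word_map \<phi> (e # w) x = \<phi> e (word_map \<phi> w x)"
  by (simp_all add: word_map_def)

lemma word_map_append: "word_map \<phi> (u @ v) x = word_map \<phi> u (word_map \<phi> v x)"
  by (induction u) auto

lemma word_scaling_append:
  "word_scaling X \<phi> (u @ v) x = word_scaling X \<phi> u (word_map \<phi> v x) * word_scaling X \<phi> v x"
  by (induction u) (auto simp: word_map_append)

text \<open>
  The consequences of the axioms on which the dimension estimates rest.  The assumption
  \<open>hoelder\<close> is condition (e) in multiplicative form, and \<open>cone\<close> says that a ball of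
  directions of fixed radius points into the interior at each point of \<open>X\<close>, which is the cone property
  without reference to angles.
\<close>

locale conformal_system =
  fixes X :: "'a::euclidean_space set" and I :: "nat set" and \<phi> :: "nat \<Rightarrow> 'a \<Rightarrow> 'a"
    and c h \<rho> L \<alpha> :: real
  assumes compact: "compact X" and nonempty: "X \<noteq> {}" and letters: "I \<noteq> {}"
    and maps: "\<And>e. e \<in> I \<Longrightarrow> \<phi> e ` X \<subseteq> X"
    and inj: "\<And>e. e \<in> I \<Longrightarrow> inj_on (\<phi> e) X"
    and c: "0 < c" "c < 1" and lipschitz: "\<And>e. e \<in> I \<Longrightarrow> c-lipschitz_on X (\<phi> e)"
    and osc: "\<And>a b. a \<in> I \<Longrightarrow> b \<in> I \<Longrightarrow> a \<noteq> b \<Longrightarrow> \<phi> a ` interior X \<inter> \<phi> b ` interior X = {}"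
    and similarity: "\<And>e x. e \<in> I \<Longrightarrow> x \<in> X \<Longrightarrow> \<exists>T. orthogonal_transformation T \<and>
          (\<phi> e has_derivative (\<lambda>v. scaling X \<phi> e x *\<^sub>R T v)) (at x within X)"
    and scaling_pos: "\<And>e x. e \<in> I \<Longrightarrow> x \<in> X \<Longrightarrow> 0 < scaling X \<phi> e x"
    and scaling_le: "\<And>e x. e \<in> I \<Longrightarrow> x \<in> X \<Longrightarrow> scaling X \<phi> e x \<le> c"
    and hoelder: "\<And>e x y. e \<in> I \<Longrightarrow> x \<in> X \<Longrightarrow> y \<in> X \<Longrightarrow>
          scaling X \<phi> e y \<le> scaling X \<phi> e x * exp (L * dist x y powr \<alpha>)"
    and L: "0 \<le> L" and \<alpha>: "0 < \<alpha>"
    and h: "0 < h" and \<rho>: "0 < \<rho>"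
    and cone: "\<And>x. x \<in> X \<Longrightarrow> \<exists>a. norm a \<le> h \<and>
          (\<forall>v\<in>ball a \<rho>. \<forall>t. 0 < t \<and> t \<le> 1 \<longrightarrow> x + t *\<^sub>R v \<in> interior X)"
begin

abbreviation "D \<equiv> word_scaling X \<phi>"
abbreviation "\<Delta> \<equiv> diameter X"

definition "K = exp (L * \<Delta> powr \<alpha> / (1 - c powr \<alpha>))"

lemma bounded: "bounded X" using compact compact_imp_bounded by blast

lemma dist_le_diameter: "x \<in> X \<Longrightarrow> y \<in> X \<Longrightarrow> dist x y \<le> \<Delta>"
  using diameter_bounded_bound[OF bounded] .

lemma diameter_nonneg: "0 \<le> \<Delta>" using diameter_ge_0[OF bounded] .

lemma word_map_in: "set w \<subseteq> I \<Longrightarrow> x \<in> X \<Longrightarrow> word_map \<phi> w x \<in> X"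
proof (induction w)
  case (Cons e w)
  then show ?case using maps[of e] by auto
qed simp

lemma inj_word_map: "set w \<subseteq> I \<Longrightarrow> inj_on (word_map \<phi> w) X"
proof (induction w)
  case (Cons e w)
  have "inj_on (\<phi> e) X" using Cons.prems inj by simp
  then show ?case
    using Cons.IH Cons.prems word_map_in[of w] unfolding inj_on_def by auto
qed (simp add: inj_on_def)

lemma lipschitz_word_map:
  "set w \<subseteq> I \<Longrightarrow> x \<in> X \<Longrightarrow> y \<in> X \<Longrightarrow> dist (word_map \<phi> w x) (word_map \<phi> w y) \<le> c ^ length w * dist x y"
proof (induction w)
  case (Cons e w)
  have "dist (word_map \<phi> (e # w) x) (word_map \<phi> (e # w) y) \<le> c * dist (word_map \<phi> w x) (word_map \<phi> w y)"
    using Cons.prems lipschitz[of e] word_map_in[of w] by (simp add: lipschitz_onD)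
  also have "\<dots> \<le> c * (c ^ length w * dist x y)"
    using Cons c by (intro mult_left_mono) auto
  finally show ?case by (simp add: mult_ac)
qed simp

lemma word_scaling_pos: "set w \<subseteq> I \<Longrightarrow> x \<in> X \<Longrightarrow> 0 < D w x"
  by (induction w) (auto intro!: mult_pos_pos scaling_pos word_map_in)

lemma word_scaling_le: "set w \<subseteq> I \<Longrightarrow> x \<in> X \<Longrightarrow> D w x \<le> c ^ length w"
proof (induction w)
  case (Cons e w)
  then have "scaling X \<phi> e (word_map \<phi> w x) * D w x \<le> c * c ^ length w"
    using c word_scaling_pos[of w x] by (intro mult_mono scaling_le word_map_in) auto
  then show ?case by simp
qed simp

lemma K_ge_1: "1 \<le> K"
proof -
  have "c powr \<alpha> < 1" using c \<alpha> by (simp add: powr01_less_one)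
  then show ?thesis unfolding K_def using L diameter_nonneg by simp
qed

text \<open>
  Bounded distortion.  After applying the last \<open>j\<close> letters of a word, two points of \<open>X\<close> are at distance
  at most \<open>c\<^sup>j \<Delta>\<close>, so by the multiplicative Hoelder condition the logarithms of the two ratios differ by
  at most a geometric series, independently of the word.
\<close>

lemma distortion:
  assumes "set w \<subseteq> I" "x \<in> X" "y \<in> X"
  shows "D w y \<le> K * D w x"
proof -
  define \<theta> where "\<theta> = c powr \<alpha>"
  have \<theta>: "0 < \<theta>" "\<theta> < 1" using c \<alpha> by (auto simp: \<theta>_def powr01_less_one)
  define M where "M = L * \<Delta> powr \<alpha>"
  have M: "0 \<le> M" using L by (simp add: M_def)
  have "D w y \<le> D w x * exp (M * (\<Sum>j<length w. \<theta> ^ j))"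
    using assms(1)
  proof (induction w)
    case (Cons e w)
    let ?x = "word_map \<phi> w x" and ?y = "word_map \<phi> w y"
    have in_X: "?x \<in> X" "?y \<in> X" using Cons.prems assms word_map_in by auto
    have "dist ?x ?y \<le> c ^ length w * \<Delta>"
      using lipschitz_word_map[of w x y] dist_le_diameter[of x y] Cons.prems assms c
      by (smt (verit) mult_left_mono set_subset_Cons subset_trans zero_le_power)
    then have "dist ?x ?y powr \<alpha> \<le> (c ^ length w * \<Delta>) powr \<alpha>"
      using \<alpha> by (intro powr_mono2) auto
    also have "\<dots> = \<theta> ^ length w * \<Delta> powr \<alpha>"
      using c diameter_nonneg by (simp add: powr_mult \<theta>_def powr_power mult.commute flip: powr_realpow powr_powr)
        (simp add: powr_powr mult.commute)
    finally have "L * dist ?x ?y powr \<alpha> \<le> M * \<theta> ^ length w"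
      using L by (simp add: M_def mult_left_mono mult_ac)
    then have "scaling X \<phi> e ?y \<le> scaling X \<phi> e ?x * exp (M * \<theta> ^ length w)"
      using hoelder[of e ?x ?y] Cons.prems in_X scaling_pos[of e ?x]
      by (smt (verit) exp_le_cancel_iff list.set_intros(1) mult_left_mono subsetD)
    moreover have "D w y \<le> D w x * exp (M * (\<Sum>j<length w. \<theta> ^ j))" using Cons by simp
    ultimately have "scaling X \<phi> e ?y * D w y \<le>
        (scaling X \<phi> e ?x * exp (M * \<theta> ^ length w)) * (D w x * exp (M * (\<Sum>j<length w. \<theta> ^ j)))"
      using Cons.prems in_X scaling_pos[of e ?x] word_scaling_pos[of w y] assms
      by (intro mult_mono) (auto simp: less_imp_le)
    then show ?case by (simp add: distrib_left exp_add mult_ac)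
  qed simp
  also have "\<dots> \<le> D w x * K"
  proof (intro mult_left_mono)
    have "(\<Sum>j<length w. \<theta> ^ j) \<le> 1 / (1 - \<theta>)"
      using \<theta> by (simp add: sum_gp_strict divide_right_mono)
    then have "M * (\<Sum>j<length w. \<theta> ^ j) \<le> M / (1 - \<theta>)"
      using M by (metis mult_left_mono mult.right_neutral times_divide_eq_right)
    then show "exp (M * (\<Sum>j<length w. \<theta> ^ j)) \<le> K" by (simp add: K_def M_def \<theta>_def)
  qed (use word_scaling_pos assms in \<open>auto simp: less_imp_le\<close>)
  finally show ?thesis by (simp add: mult.commute)
qed

lemma has_derivative_word_map:
  assumes "set w \<subseteq> I" "x \<in> X"
  shows "\<exists>T. orthogonal_transformation T \<and>
      (word_map \<phi> w has_derivative (\<lambda>v. D w x *\<^sub>R T v)) (at x within X)"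
  using assms(1)
proof (induction w)
  case Nil
  have "orthogonal_transformation (\<lambda>v :: 'a. v)" by simp
  then show ?case by (intro exI[of _ "\<lambda>v. v"]) (auto simp: word_map_def id_def)
next
  case (Cons e w)
  let ?y = "word_map \<phi> w x"
  have y: "?y \<in> X" using Cons.prems assms word_map_in by auto
  obtain T where T: "orthogonal_transformation T"
      "(word_map \<phi> w has_derivative (\<lambda>v. D w x *\<^sub>R T v)) (at x within X)"
    using Cons by auto
  obtain S where S: "orthogonal_transformation S"
      "(\<phi> e has_derivative (\<lambda>v. scaling X \<phi> e ?y *\<^sub>R S v)) (at ?y within X)"
    using similarity[of e ?y] y Cons.prems by auto
  have "(\<phi> e has_derivative (\<lambda>v. scaling X \<phi> e ?y *\<^sub>R S v)) (at ?y within word_map \<phi> w ` X)"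
    using S(2) by (rule has_derivative_subset) (use Cons.prems word_map_in in auto)
  from has_derivative_in_compose[OF T(2) this]
  have "(word_map \<phi> (e # w) has_derivative (\<lambda>v. D (e # w) x *\<^sub>R (S \<circ> T) v)) (at x within X)"
    using linear_scale[OF orthogonal_transformation_linear[OF S(1)]]
    by (simp add: o_def word_map_def)
  moreover have "orthogonal_transformation (S \<circ> T)"
    using S(1) T(1) by (rule orthogonal_transformation_compose)
  ultimately show ?case by blast
qed

lemma has_derivative_word_map_interior:
  assumes "set w \<subseteq> I" "x \<in> interior X"
  obtains f' where "(word_map \<phi> w has_derivative f') (at x)" "\<And>v. norm (f' v) = D w x * norm v"
proof -
  have x: "x \<in> X" using assms interior_subset by blast
  then obtain T where T: "orthogonal_transformation T"
      "(word_map \<phi> w has_derivative (\<lambda>v. D w x *\<^sub>R T v)) (at x within X)"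
    using has_derivative_word_map assms by blast
  have "(word_map \<phi> w has_derivative (\<lambda>v. D w x *\<^sub>R T v)) (at x)"
    using T(2) at_within_interior[OF assms(2)] by simp
  moreover have "norm (D w x *\<^sub>R T v) = D w x * norm v" for v
    using word_scaling_pos[OF assms(1) x] orthogonal_transformation_norm[OF T(1)] by simp
  ultimately show ?thesis using that by blast
qed

text \<open>
  \<open>X\<close> need not be convex, so a derivative bound is a Lipschitz bound only along segments that lie in
  \<open>X\<close>.
\<close>

lemma dist_word_map_le:
  assumes "set w \<subseteq> I" and sub: "closed_segment x y \<subseteq> X" and B: "\<And>z. z \<in> X \<Longrightarrow> D w z \<le> B"
  shows "dist (word_map \<phi> w x) (word_map \<phi> w y) \<le> B * dist x y"
proof -
  obtain T where T: "\<And>z. z \<in> X \<Longrightarrow> orthogonal_transformation (T z)"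
      "\<And>z. z \<in> X \<Longrightarrow> (word_map \<phi> w has_derivative (\<lambda>v. D w z *\<^sub>R T z v)) (at z within X)"
    using has_derivative_word_map[OF assms(1)] by metis
  have "norm (word_map \<phi> w x - word_map \<phi> w y) \<le> B * norm (x - y)"
  proof (rule differentiable_bound)
    fix z assume z: "z \<in> closed_segment x y"
    then have "z \<in> X" using sub by blast
    then show "(word_map \<phi> w has_derivative (\<lambda>v. D w z *\<^sub>R T z v)) (at z within closed_segment x y)"
      using T(2) sub has_derivative_subset by blast
    have "norm (D w z *\<^sub>R T z v) = D w z * norm v" for v
      using word_scaling_pos[OF assms(1) \<open>z \<in> X\<close>] orthogonal_transformation_norm[OF T(1)[OF \<open>z \<in> X\<close>]] by simp
    then have "onorm (\<lambda>v. D w z *\<^sub>R T z v) = D w z"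
      using word_scaling_pos[OF assms(1) \<open>z \<in> X\<close>] by (intro onorm_similarity) auto
    then show "onorm (\<lambda>v. D w z *\<^sub>R T z v) \<le> B" using B \<open>z \<in> X\<close> by simp
  qed auto
  then show ?thesis by (simp add: dist_norm)
qed

lemma continuous_on_word_map:
  assumes "set w \<subseteq> I" shows "continuous_on X (word_map \<phi> w)"
  unfolding continuous_on_eq_continuous_within
proof
  fix x assume "x \<in> X"
  from has_derivative_word_map[OF assms this]
  show "continuous (at x within X) (word_map \<phi> w)" by (auto dest: has_derivative_continuous)
qed

lemma word_map_interior:
  assumes "set w \<subseteq> I" shows "word_map \<phi> w ` interior X \<subseteq> interior X"
proof (rule interior_maximal)
  show "open (word_map \<phi> w ` interior X)"
    using continuous_on_word_map[OF assms] inj_word_map[OF assms] interior_subset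
    by (intro invariance_of_domain) (auto intro: continuous_on_subset inj_on_subset)
qed (use assms word_map_in interior_subset in blast)

text \<open>
  At the first place where the words differ the open set condition applies; the common prefix is
  removed by injectivity and the common interior is invariant under all maps.
\<close>

lemma word_map_disjoint:
  assumes "set u \<subseteq> I" "set v \<subseteq> I" "parallel u v"
  shows "word_map \<phi> u ` interior X \<inter> word_map \<phi> v ` interior X = {}"
proof -
  obtain p a u' b v' where dec: "a \<noteq> b" "u = p @ a # u'" "v = p @ b # v'"
    using parallel_decomp[OF assms(3)] by blast
  have I: "set p \<subseteq> I" "a \<in> I" "b \<in> I" "set u' \<subseteq> I" "set v' \<subseteq> I" using assms dec by auto
  show ?thesis
  proof (rule ccontr)
    assume "\<not> ?thesis"
    then obtain x y where xy: "x \<in> interior X" "y \<in> interior X" "word_map \<phi> u x = word_map \<phi> v y"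
      by auto
    let ?x = "word_map \<phi> u' x" and ?y = "word_map \<phi> v' y"
    have in_int: "?x \<in> interior X" "?y \<in> interior X"
      using xy I word_map_interior by blast+
    have "word_map \<phi> p (\<phi> a ?x) = word_map \<phi> p (\<phi> b ?y)"
      using xy by (simp add: dec word_map_append)
    moreover have "\<phi> a ?x \<in> X" "\<phi> b ?y \<in> X"
      using in_int I maps interior_subset by blast+
    ultimately have "\<phi> a ?x = \<phi> b ?y"
      using inj_word_map[OF I(1)] by (simp add: inj_on_eq_iff)
    then show False using osc[OF I(2,3) dec(1)] in_int by blast
  qed
qed

text \<open>
  Every point of \<open>X\<close> can be joined inside \<open>X\<close>, by a segment of bounded length, to the centre of
  a ball of fixed radius in the interior.  In both dimension estimates such segments
  and balls take the place of a convexity assumption on \<open>X\<close>.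
\<close>

lemma center_of_cone:
  assumes "x \<in> X"
  obtains q where "ball q \<rho> \<subseteq> interior X" "closed_segment x q \<subseteq> X" "dist x q \<le> h"
proof -
  obtain a where a: "norm a \<le> h"
      "\<And>v t. v \<in> ball a \<rho> \<Longrightarrow> 0 < t \<Longrightarrow> t \<le> 1 \<Longrightarrow> x + t *\<^sub>R v \<in> interior X"
    using cone[OF assms] by blast
  show ?thesis
  proof
    show "ball (x + a) \<rho> \<subseteq> interior X"
    proof
      fix y assume "y \<in> ball (x + a) \<rho>"
      then have "y - x \<in> ball a \<rho>" by (simp add: dist_norm algebra_simps)
      from a(2)[OF this, of 1] show "y \<in> interior X" by simp
    qed
    show "closed_segment x (x + a) \<subseteq> X"
    proof
      fix y assume "y \<in> closed_segment x (x + a)"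
      then obtain t where t: "0 \<le> t" "t \<le> 1" "y = (1 - t) *\<^sub>R x + t *\<^sub>R (x + a)"
        by (auto simp: closed_segment_def)
      then have "y = x + t *\<^sub>R a" by (simp add: algebra_simps)
      then show "y \<in> X"
        using a(2)[of a t] t \<rho> assms interior_subset by (cases "t = 0") auto
    qed
    show "dist x (x + a) \<le> h" using a by (simp add: dist_norm)
  qed
qed

lemma ball_subset_word_map_image:
  assumes "set w \<subseteq> I" "ball q \<rho> \<subseteq> interior X" "0 < m" and m: "\<And>z. z \<in> X \<Longrightarrow> m \<le> D w z"
  shows "ball (word_map \<phi> w q) (m * \<rho>) \<subseteq> word_map \<phi> w ` interior X"
proof -
  obtain f' where f': "\<And>x. x \<in> interior X \<Longrightarrow> (word_map \<phi> w has_derivative f' x) (at x)"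
      "\<And>x v. x \<in> interior X \<Longrightarrow> norm (f' x v) = D w x * norm v"
  proof -
    have "\<forall>x\<in>interior X. \<exists>f'. (word_map \<phi> w has_derivative f') (at x) \<and> (\<forall>v. norm (f' v) = D w x * norm v)"
      using has_derivative_word_map_interior[OF assms(1)] by blast
    from bchoice[OF this] show ?thesis using that by blast
  qed
  have "ball (word_map \<phi> w q) (m * \<rho>) \<subseteq> word_map \<phi> w ` ball q \<rho>"
  proof (rule ball_subset_image_of_expanding)
    show "inj_on (word_map \<phi> w) (ball q \<rho>)"
      using inj_word_map[OF assms(1)] assms(2) interior_subset by (blast intro: inj_on_subset)
    fix x v assume "x \<in> ball q \<rho>"
    then have "x \<in> interior X" using assms(2) by blast
    then show "(word_map \<phi> w has_derivative f' x) (at x)" using f' by blast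
    show "m * norm v \<le> norm (f' x v)"
      using f'(2) m[OF subsetD[OF interior_subset]] \<open>x \<in> interior X\<close> by (simp add: mult_right_mono)
  qed (use \<rho> assms in auto)
  then show ?thesis using assms(2) by blast
qed

lemma prefix_of_subset: "\<omega> \<in> seqs I \<Longrightarrow> set (prefix_of \<omega> k) \<subseteq> I"
  by (auto simp: prefix_of_def seqs_def)

lemma coding_map_sing:
  assumes "\<omega> \<in> seqs I"
  shows "(\<Inter>k. word_map \<phi> (prefix_of \<omega> k) ` X) = {coding_map X \<phi> \<omega>}"
proof -
  have sub: "set (prefix_of \<omega> k) \<subseteq> I" for k using assms prefix_of_subset by blast
  have "\<exists>a. (\<Inter>k. word_map \<phi> (prefix_of \<omega> k) ` X) = {a}"
  proof (rule decreasing_closed_nest_sing)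
    show "closed (word_map \<phi> (prefix_of \<omega> n) ` X)" for n
      using compact continuous_on_word_map[OF sub] by (intro compact_imp_closed compact_continuous_image)
    show "word_map \<phi> (prefix_of \<omega> n) ` X \<noteq> {}" for n using nonempty by simp
    show "word_map \<phi> (prefix_of \<omega> n) ` X \<subseteq> word_map \<phi> (prefix_of \<omega> m) ` X" if "m \<le> n" for m n
    proof -
      obtain k where n: "n = m + k" using \<open>m \<le> n\<close> le_Suc_ex by blast
      have "set (prefix_of ((shift ^^ m) \<omega>) k) \<subseteq> I"
        using assms shift_funpow_seqs prefix_of_subset by blast
      then show ?thesis
        using word_map_in by (auto simp: n prefix_of_add word_map_append)
    qed
    show "\<exists>n. \<forall>x\<in>word_map \<phi> (prefix_of \<omega> n) ` X. \<forall>y\<in>word_map \<phi> (prefix_of \<omega> n) ` X. dist x y < \<epsilon>"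
      if "0 < \<epsilon>" for \<epsilon>
    proof -
      have "0 < \<epsilon> / (\<Delta> + 1)" using that diameter_nonneg by simp
      then obtain n where "c ^ n < \<epsilon> / (\<Delta> + 1)"
        using real_arch_pow_inv[of "\<epsilon> / (\<Delta> + 1)" c] c by blast
      then have n: "c ^ n * (\<Delta> + 1) < \<epsilon>" using diameter_nonneg by (simp add: pos_less_divide_eq)
      have "dist (word_map \<phi> (prefix_of \<omega> n) x) (word_map \<phi> (prefix_of \<omega> n) y) < \<epsilon>"
        if "x \<in> X" "y \<in> X" for x y
      proof -
        have "dist (word_map \<phi> (prefix_of \<omega> n) x) (word_map \<phi> (prefix_of \<omega> n) y) \<le> c ^ n * dist x y"
          using lipschitz_word_map[OF sub that] by simp
        also have "\<dots> \<le> c ^ n * (\<Delta> + 1)"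
          using dist_le_diameter[OF that] c by (intro mult_left_mono) auto
        finally show ?thesis using n by simp
      qed
      then show ?thesis by blast
    qed
  qed
  then obtain a where "(\<Inter>k. word_map \<phi> (prefix_of \<omega> k) ` X) = {a}" by blast
  then show ?thesis by (simp add: coding_map_def)
qed

lemma coding_map_in:
  assumes "\<omega> \<in> seqs I" shows "coding_map X \<phi> \<omega> \<in> X"
proof -
  have "coding_map X \<phi> \<omega> \<in> word_map \<phi> (prefix_of \<omega> 0) ` X" using coding_map_sing[OF assms] by blast
  then show ?thesis by (simp add: prefix_of_def)
qed

text \<open>
  The conjugacy between the shift and the maps of the system, for \<open>k\<close> letters at once.
\<close>

lemma coding_map_prefix:
  assumes "\<omega> \<in> seqs I"
  shows "coding_map X \<phi> \<omega> = word_map \<phi> (prefix_of \<omega> k) (coding_map X \<phi> ((shift ^^ k) \<omega>))"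
proof -
  let ?\<tau> = "(shift ^^ k) \<omega>"
  let ?z = "word_map \<phi> (prefix_of \<omega> k) (coding_map X \<phi> ?\<tau>)"
  have \<tau>: "?\<tau> \<in> seqs I" using assms shift_funpow_seqs by blast
  have "?z \<in> word_map \<phi> (prefix_of \<omega> n) ` X" for n
  proof (cases "k \<le> n")
    case True
    then obtain j where n: "n = k + j" using le_Suc_ex by blast
    have "coding_map X \<phi> ?\<tau> \<in> word_map \<phi> (prefix_of ?\<tau> j) ` X"
      using coding_map_sing[OF \<tau>] by blast
    then show ?thesis by (auto simp: n prefix_of_add word_map_append)
  next
    case False
    then obtain j where k: "k = n + j" using le_Suc_ex nat_le_linear by blast
    have "set (prefix_of ((shift ^^ n) \<omega>) j) \<subseteq> I"
      using assms shift_funpow_seqs prefix_of_subset by blast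
    then show ?thesis
      using coding_map_in[OF \<tau>] word_map_in by (auto simp: k prefix_of_add word_map_append)
  qed
  then have "?z \<in> (\<Inter>n. word_map \<phi> (prefix_of \<omega> n) ` X)" by simp
  then show ?thesis unfolding coding_map_sing[OF assms] by simp
qed

text \<open>
  The Birkhoff sums of the geometric potential are logarithms of derivatives of words.  This is the only
  passage from potentials to maps.
\<close>

lemma exp_birkhoff_sum:
  assumes "\<omega> \<in> seqs I"
  shows "exp (birkhoff_sum k (\<lambda>\<omega>. s * geometric_potential X \<phi> \<omega>) \<omega>)
    = D (prefix_of \<omega> k) (coding_map X \<phi> ((shift ^^ k) \<omega>)) powr s"
  using assms
proof (induction k arbitrary: \<omega>)
  case 0
  then show ?case by (simp add: birkhoff_sum_def prefix_of_def)
next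
  case (Suc k)
  let ?\<pi> = "coding_map X \<phi>"
  have \<sigma>: "shift \<omega> \<in> seqs I" using Suc.prems by (simp add: seqs_def shift_def)
  have e: "\<omega> 0 \<in> I" using Suc.prems by (simp add: seqs_def)
  have "(shift ^^ k) (shift \<omega>) = (shift ^^ Suc k) \<omega>" by (simp add: funpow_swap1)
  with coding_map_prefix[OF \<sigma>, of k]
  have \<pi>: "word_map \<phi> (prefix_of (shift \<omega>) k) (?\<pi> ((shift ^^ Suc k) \<omega>)) = ?\<pi> (shift \<omega>)" by simp
  have pos: "0 < scaling X \<phi> (\<omega> 0) (?\<pi> (shift \<omega>))"
    using scaling_pos[OF e coding_map_in[OF \<sigma>]] .
  let ?g = "\<lambda>\<omega>. s * geometric_potential X \<phi> \<omega>"
  have "birkhoff_sum (Suc k) ?g \<omega> = ?g \<omega> + birkhoff_sum k ?g (shift \<omega>)"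
    using birkhoff_sum_add[of 1 k ?g \<omega>] by (simp add: birkhoff_sum_def)
  then have "exp (birkhoff_sum (Suc k) ?g \<omega>) = exp (?g \<omega>) * exp (birkhoff_sum k ?g (shift \<omega>))"
    by (simp add: exp_add)
  also have "exp (?g \<omega>) = scaling X \<phi> (\<omega> 0) (?\<pi> (shift \<omega>)) powr s"
    using pos by (simp add: geometric_potential_def scaling_def powr_def)
  also have "exp (birkhoff_sum k ?g (shift \<omega>)) = D (prefix_of (shift \<omega>) k) (?\<pi> ((shift ^^ Suc k) \<omega>)) powr s"
    using Suc.IH[OF \<sigma>] by (simp add: funpow_swap1)
  finally show ?case
    unfolding prefix_of_Suc word_scaling.simps \<pi>
    using pos by (subst powr_mult)
qed

lemma exp_sup_cyl_le:
  assumes B: "\<And>y. y \<in> X \<Longrightarrow> D w y powr s \<le> B"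
  shows "exp_sup_cyl I (\<lambda>\<omega>. s * geometric_potential X \<phi> \<omega>) w \<le> ennreal B"
  unfolding exp_sup_cyl_def
proof (rule SUP_least)
  fix \<tau> assume \<tau>: "\<tau> \<in> cylinder w \<inter> seqs I"
  then have seq: "\<tau> \<in> seqs I" "prefix_of \<tau> (length w) = w" by (auto simp: cylinder_def)
  have "coding_map X \<phi> ((shift ^^ length w) \<tau>) \<in> X"
    using seq coding_map_in shift_funpow_seqs by blast
  then show "ennreal (exp (birkhoff_sum (length w) (\<lambda>\<omega>. s * geometric_potential X \<phi> \<omega>) \<tau>)) \<le> ennreal B"
    using exp_birkhoff_sum[OF seq(1)] seq(2) B by (simp add: ennreal_leI)
qed

lemma exp_sup_cyl_ge:
  assumes "set w \<subseteq> I" and B: "\<And>y. y \<in> X \<Longrightarrow> B \<le> D w y powr s"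
  shows "ennreal B \<le> exp_sup_cyl I (\<lambda>\<omega>. s * geometric_potential X \<phi> \<omega>) w"
proof -
  obtain e where e: "e \<in> I" using letters by blast
  define \<tau> where "\<tau> i = (if i < length w then w ! i else e)" for i
  have \<tau>: "\<tau> \<in> seqs I" using e assms by (auto simp: seqs_def \<tau>_def)
  have pre: "prefix_of \<tau> (length w) = w"
    by (rule nth_equalityI) (auto simp: prefix_of_def \<tau>_def)
  have "coding_map X \<phi> ((shift ^^ length w) \<tau>) \<in> X"
    using \<tau> coding_map_in shift_funpow_seqs by blast
  then have "ennreal B \<le> ennreal (exp (birkhoff_sum (length w) (\<lambda>\<omega>. s * geometric_potential X \<phi> \<omega>) \<tau>))"
    using exp_birkhoff_sum[OF \<tau>] pre B by (simp add: ennreal_leI)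
  also have "\<dots> \<le> exp_sup_cyl I (\<lambda>\<omega>. s * geometric_potential X \<phi> \<omega>) w"
    unfolding exp_sup_cyl_def using \<tau> pre by (intro SUP_upper) (auto simp: cylinder_def)
  finally show ?thesis .
qed

lemma limit_set_cover:
  "limit_set X (I, \<phi>) \<subseteq> (\<Union>w\<in>words I m. word_map \<phi> w ` X)"
proof
  fix x assume "x \<in> limit_set X (I, \<phi>)"
  then obtain \<omega> where \<omega>: "\<omega> \<in> seqs I" "x = coding_map X \<phi> \<omega>" by (auto simp: limit_set_def)
  then have "x \<in> word_map \<phi> (prefix_of \<omega> m) ` X"
    using coding_map_sing by blast
  then show "x \<in> (\<Union>w\<in>words I m. word_map \<phi> w ` X)"
    using prefix_of_in_words[OF \<omega>(1)] by blast
qed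

end

section \<open>A lower bound for the dimension\<close>

lemma set_concat_words: "v \<in> lists (words F m) \<Longrightarrow> F \<subseteq> I \<Longrightarrow> set (concat v) \<subseteq> I"
  by (auto simp: words_def)

text \<open>
  Words of length divisible by \<open>m\<close> are treated as words of blocks of length \<open>m\<close>.  As all blocks have the
  same length, the prefix order does not change.
\<close>

lemma prefix_concat_imp_prefix:
  assumes "0 < m" "prefix (concat u) (concat v)"
    and "u \<in> lists (words F m)" "v \<in> lists (words F m)"
  shows "prefix u v"
  using assms(2-4)
proof (induction u arbitrary: v)
  case (Cons a u)
  then have a: "length a = m" by (auto simp: words_def)
  then obtain b v' where v: "v = b # v'" using Cons.prems \<open>0 < m\<close> by (cases v) auto
  then have "length b = m" using Cons.prems by (auto simp: words_def)
  with Cons.prems a have "a = b \<and> prefix (concat u) (concat v')"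
    by (auto simp: v prefix_def)
  then show ?case using Cons v by simp
qed simp

context conformal_system
begin

lemma prod_le_word_scaling:
  assumes "0 < t" "x \<in> X" and v: "v \<in> lists (words F m)" and "F \<subseteq> I"
    and \<delta>: "\<And>w y. w \<in> words F m \<Longrightarrow> y \<in> X \<Longrightarrow> 0 < \<delta> w \<and> \<delta> w \<le> D w y"
  shows "prod_list (map (\<lambda>w. \<delta> w powr t) v) \<le> D (concat v) x powr t"
  using v
proof (induction v)
  case (Cons g v)
  have sub: "set (concat v) \<subseteq> I" using set_concat_words[OF Cons.hyps(2) \<open>F \<subseteq> I\<close>] .
  let ?y = "word_map \<phi> (concat v) x"
  have y: "?y \<in> X" using word_map_in[OF sub \<open>x \<in> X\<close>] .
  have g: "g \<in> words F m" by (rule Cons.hyps)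
  have "\<delta> g powr t * prod_list (map (\<lambda>w. \<delta> w powr t) v) \<le> D g ?y powr t * D (concat v) x powr t"
    using Cons \<delta>[OF g y] \<open>0 < t\<close>
    by (intro mult_mono powr_mono2 prod_list_nonneg) auto
  also have "\<dots> = D (concat (g # v)) x powr t"
    using \<delta>[OF g y] word_scaling_pos[OF sub \<open>x \<in> X\<close>] by (simp add: word_scaling_append powr_mult)
  finally show ?case by simp
qed simp

text \<open>
  The words of blocks whose ratio at \<open>x0\<close> falls to \<open>r\<close> or below for the first time and whose image
  meets \<open>U\<close>.  Stopping at the first time, rather than at any time, makes these words
  pairwise incomparable even though the ratio at a fixed point need not decrease along a word.
\<close>

definition stopping_words :: "nat list set \<Rightarrow> 'a \<Rightarrow> real \<Rightarrow> 'a set \<Rightarrow> nat list list set" where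
  "stopping_words G x0 r U = {v \<in> lists G. v \<noteq> [] \<and> D (concat v) x0 \<le> r \<and>
     (\<forall>j<length v. r < D (concat (take j v)) x0) \<and> word_map \<phi> (concat v) ` X \<inter> U \<noteq> {}}"

text \<open>
  The image of each stopping word contains a ball of radius comparable to \<open>r\<close>: its ratio is at least
  a constant times \<open>r\<close>, since it exceeds \<open>r\<close> before the last block, which multiplies it by at least
  \<open>d\<close>.  The centre of this ball is the image of a centre of a cone whose vertex is mapped into \<open>U\<close>,
  so it is at distance at most a multiple of \<open>r\<close> from \<open>U\<close>.  The balls are disjoint by the open set
  condition, and their number is bounded by comparing volumes.
\<close>

lemma card_stopping_words_le:
  assumes "0 < m" "F \<subseteq> I" "x0 \<in> X" "0 < r" "bounded U" "diameter U \<le> r" "0 < d"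
    and d: "\<And>w y. w \<in> words F m \<Longrightarrow> y \<in> X \<Longrightarrow> d \<le> D w y"
  defines "\<kappa> \<equiv> d * \<rho> / K"
  shows "finite (stopping_words (words F m) x0 r U) \<and>
    real (card (stopping_words (words F m) x0 r U)) \<le> ((K * h + 1 + \<kappa>) / \<kappa>) ^ DIM('a)"
proof -
  let ?W = "stopping_words (words F m) x0 r U"
  let ?N = "((K * h + 1 + \<kappa>) / \<kappa>) ^ DIM('a)"
  have K: "0 < K" using K_ge_1 by simp
  have \<kappa>: "0 < \<kappa>" using assms \<rho> K by (simp add: \<kappa>_def)
  have N: "0 \<le> ?N" using \<kappa> K h by simp
  have sub: "set (concat v) \<subseteq> I" if "v \<in> lists (words F m)" for v
    using set_concat_words[OF that \<open>F \<subseteq> I\<close>] .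
  define P where "P v q z \<longleftrightarrow> ball (word_map \<phi> (concat v) q) (\<kappa> * r) \<subseteq> word_map \<phi> (concat v) ` interior X \<and>
      z \<in> U \<and> dist z (word_map \<phi> (concat v) q) \<le> K * h * r" for v q z
  have "\<exists>q z. P v q z" if "v \<in> ?W" for v
  proof -
    have v: "v \<in> lists (words F m)" "v \<noteq> []" "D (concat v) x0 \<le> r"
        "\<And>j. j < length v \<Longrightarrow> r < D (concat (take j v)) x0" "word_map \<phi> (concat v) ` X \<inter> U \<noteq> {}"
      using that by (auto simp: stopping_words_def)
    then obtain x where x: "x \<in> X" "word_map \<phi> (concat v) x \<in> U" by blast
    obtain q where q: "ball q \<rho> \<subseteq> interior X" "closed_segment x q \<subseteq> X" "dist x q \<le> h"
      using center_of_cone[OF x(1)] .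
    let ?u = "butlast v" and ?g = "last v"
    have dec: "concat v = concat ?u @ ?g" using v(2) by (metis append_butlast_last_id concat_append concat.simps append_Nil2)
    have u: "?u \<in> lists (words F m)" "?g \<in> words F m"
      using v(1,2) by (auto dest: in_set_butlastD)
    have "r < D (concat ?u) x0" using v(2) v(4)[of "length v - 1"] by (simp add: butlast_conv_take)
    have lower: "r * d / K \<le> D (concat v) z" if "z \<in> X" for z
    proof -
      have y: "word_map \<phi> ?g z \<in> X" using word_map_in[OF _ that] u(2) \<open>F \<subseteq> I\<close> by (auto simp: words_def)
      have "r / K \<le> D (concat ?u) (word_map \<phi> ?g z)"
        using distortion[OF sub[OF u(1)] y \<open>x0 \<in> X\<close>] \<open>r < D (concat ?u) x0\<close> K
        by (simp add: field_simps)
      then have "(r / K) * d \<le> D (concat ?u) (word_map \<phi> ?g z) * D ?g z"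
        using d[OF u(2) that] \<open>0 < d\<close> \<open>0 < r\<close> K word_scaling_pos[OF sub[OF u(1)] y]
        by (intro mult_mono) auto
      then show ?thesis unfolding dec word_scaling_append by simp
    qed
    have "ball (word_map \<phi> (concat v) q) (r * d / K * \<rho>) \<subseteq> word_map \<phi> (concat v) ` interior X"
      using sub[OF v(1)] q(1) lower K \<open>0 < r\<close> \<open>0 < d\<close> by (intro ball_subset_word_map_image) auto
    moreover have "r * d / K * \<rho> = \<kappa> * r" by (simp add: \<kappa>_def)
    moreover have "dist (word_map \<phi> (concat v) x) (word_map \<phi> (concat v) q) \<le> (K * r) * dist x q"
    proof (rule dist_word_map_le[OF sub[OF v(1)] q(2)])
      fix z assume "z \<in> X"
      then have "D (concat v) z \<le> K * D (concat v) x0" by (rule distortion[OF sub[OF v(1)] \<open>x0 \<in> X\<close>])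
      also have "\<dots> \<le> K * r" using v(3) K by (simp add: mult_left_mono)
      finally show "D (concat v) z \<le> K * r" .
    qed
    moreover have "(K * r) * dist x q \<le> K * h * r"
      using q(3) K \<open>0 < r\<close> by (simp add: mult_left_mono mult.assoc mult.commute[of h])
    ultimately have "P v q (word_map \<phi> (concat v) x)" using x(2) by (simp add: P_def)
    then show ?thesis by blast
  qed
  then obtain q z where P: "\<And>v. v \<in> ?W \<Longrightarrow> P v (q v) (z v)" by metis
  note ball = P[unfolded P_def, THEN conjunct1]
    and z = P[unfolded P_def, THEN conjunct2, THEN conjunct1] P[unfolded P_def, THEN conjunct2, THEN conjunct2]
  have par: "parallel (concat v) (concat v')" if "v \<in> ?W" "v' \<in> ?W" "v \<noteq> v'" for v v'
  proof -
    have "\<not> prefix (concat a) (concat b)" if ab: "a \<in> ?W" "b \<in> ?W" "a \<noteq> b" for a b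
    proof
      assume "prefix (concat a) (concat b)"
      then have "prefix a b"
        using ab prefix_concat_imp_prefix[OF \<open>0 < m\<close>] by (auto simp: stopping_words_def)
      then have "a = take (length a) b" "length a < length b"
        using \<open>a \<noteq> b\<close> by (auto simp: prefix_def)
      then have "r < D (concat a) x0" using ab(2) by (auto simp: stopping_words_def)
      then show False using ab(1) by (simp add: stopping_words_def)
    qed
    then show ?thesis using that by blast
  qed
  have card: "card S \<le> nat \<lfloor>?N\<rfloor>" if S: "S \<subseteq> ?W" "finite S" for S
  proof (cases "S = {}")
    case False
    then obtain v0 where v0: "v0 \<in> S" by blast
    have "real (card S) \<le> ((r * (K * h + 1 + \<kappa>)) / (\<kappa> * r)) ^ DIM('a)"
    proof (rule card_disjoint_balls_le)
      show "disjoint_family_on (\<lambda>v. ball (word_map \<phi> (concat v) (q v)) (\<kappa> * r)) S"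
        unfolding disjoint_family_on_def
      proof (intro ballI impI)
        fix v v' assume vv: "v \<in> S" "v' \<in> S" "v \<noteq> v'"
        then have "v \<in> ?W" "v' \<in> ?W" using S by auto
        then have "word_map \<phi> (concat v) ` interior X \<inter> word_map \<phi> (concat v') ` interior X = {}"
          using vv par by (intro word_map_disjoint sub) (auto simp: stopping_words_def)
        then show "ball (word_map \<phi> (concat v) (q v)) (\<kappa> * r) \<inter> ball (word_map \<phi> (concat v') (q v')) (\<kappa> * r) = {}"
          using Int_mono[OF ball[OF \<open>v \<in> ?W\<close>] ball[OF \<open>v' \<in> ?W\<close>]] by simp
      qed
      fix v assume "v \<in> S"
      then have "v \<in> ?W" "v0 \<in> ?W" using S v0 by auto
      have "dist (z v0) (z v) \<le> r"
        using diameter_bounded_bound[OF \<open>bounded U\<close>] z(1) \<open>v \<in> ?W\<close> \<open>v0 \<in> ?W\<close> \<open>diameter U \<le> r\<close>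
        by (meson order_trans)
      then have dist0: "dist (z v0) (word_map \<phi> (concat v) (q v)) \<le> r + K * h * r"
        using z(2)[OF \<open>v \<in> ?W\<close>] dist_triangle[of "z v0" _ "z v"] by (meson add_mono order_trans)
      show "ball (word_map \<phi> (concat v) (q v)) (\<kappa> * r) \<subseteq> ball (z v0) (r * (K * h + 1 + \<kappa>))"
      proof
        fix y assume "y \<in> ball (word_map \<phi> (concat v) (q v)) (\<kappa> * r)"
        then have "dist (z v0) y < (r + K * h * r) + \<kappa> * r"
          using dist0 dist_triangle[of "z v0" y "word_map \<phi> (concat v) (q v)"] by simp
        then show "y \<in> ball (z v0) (r * (K * h + 1 + \<kappa>))" by (simp add: algebra_simps)
      qed
    qed (use \<open>finite S\<close> \<open>0 < r\<close> \<kappa> K h in \<open>auto intro!: mult_pos_pos add_pos_pos\<close>)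
    also have "(r * (K * h + 1 + \<kappa>)) / (\<kappa> * r) = (K * h + 1 + \<kappa>) / \<kappa>" using \<open>0 < r\<close> by simp
    finally show ?thesis by (simp add: le_nat_floor)
  qed simp
  have "finite ?W \<and> card ?W \<le> nat \<lfloor>?N\<rfloor>"
    by (rule finite_if_finite_subsets_card_bdd) (use card in auto)
  then show ?thesis using N by (meson le_nat_floor of_nat_le_iff order_trans of_nat_floor)
qed

text \<open>
  Give the word \<open>w\<close> the weight \<open>\<delta>(w)\<^sup>t\<close>, extended multiplicatively to words of blocks.  For a cover of
  the limit set by sets \<open>U\<^sub>i\<close> of diameter at most \<open>r\<^sub>i\<close>, every infinite path passes through a stopping
  word of some \<open>U\<^sub>i\<close>.  Such a word has weight at most \<open>r\<^sub>i\<^sup>t\<close>, and there are at most \<open>N\<close> of them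
  for each \<open>i\<close>.  Therefore \<open>1 \<le> N \<Sum> r\<^sub>i\<^sup>t\<close> by the Kraft inequality, a positive lower bound for
  all covers.
\<close>

lemma hausdorff_dim_limit_set_ge:
  assumes F: "finite F" "F \<subseteq> I" and "0 < m" "0 < t"
    and \<delta>: "\<And>w y. w \<in> words F m \<Longrightarrow> y \<in> X \<Longrightarrow> 0 < \<delta> w \<and> \<delta> w \<le> D w y"
    and sum: "1 \<le> (\<Sum>w\<in>words F m. \<delta> w powr t)"
  shows "ennreal t \<le> hausdorff_dim (limit_set X (I, \<phi>))"
proof -
  let ?G = "words F m"
  obtain x0 where x0: "x0 \<in> X" using nonempty by blast
  have G: "finite ?G" using finite_words[OF F(1)] .
  have "?G \<noteq> {}" using sum by auto
  define d where "d = Min (\<delta> ` ?G)"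
  have d: "0 < d" using G \<open>?G \<noteq> {}\<close> \<delta> x0 by (auto simp: d_def)
  have d_le: "d \<le> D w y" if "w \<in> ?G" "y \<in> X" for w y
  proof -
    have "d \<le> \<delta> w" using G that by (simp add: d_def)
    then show ?thesis using \<delta>[OF that] by simp
  qed
  define \<kappa> where "\<kappa> = d * \<rho> / K"
  define N where "N = ((K * h + 1 + \<kappa>) / \<kappa>) ^ DIM('a)"
  have K: "0 < K" using K_ge_1 by simp
  have \<kappa>: "0 < \<kappa>" using d \<rho> K by (simp add: \<kappa>_def)
  have "1 \<le> (K * h + 1 + \<kappa>) / \<kappa>" using \<kappa> K h by (simp add: pos_le_divide_eq)
  then have N: "1 \<le> N" unfolding N_def by (rule one_le_power)
  define \<epsilon> where "\<epsilon> = 1 / (4 * N)"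
  have \<epsilon>: "0 < \<epsilon>" "\<epsilon> \<le> 1/2" using N by (auto simp: \<epsilon>_def field_simps)
  show ?thesis
  proof (rule hausdorff_dim_geI[OF \<open>0 < t\<close>, of "ennreal \<epsilon>"])
    fix U :: "nat \<Rightarrow> 'a set"
    assume cover: "limit_set X (I, \<phi>) \<subseteq> (\<Union>i. U i)" and bdd: "\<And>i. bounded (U i)"
    show "ennreal \<epsilon> \<le> (\<Sum>i. ennreal (diameter (U i) powr t))"
    proof (rule ccontr)
      assume "\<not> ?thesis"
      then obtain r where r: "\<And>i. 0 < r i" "\<And>i. r i < 1" "\<And>i. diameter (U i) \<le> r i"
          "(\<Sum>i. ennreal (r i powr t)) \<le> ennreal (2 * \<epsilon>)"
        using diameter_powr_cover_sum[OF \<open>0 < t\<close> \<epsilon>, of U] bdd unfolding not_le by blast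
      define W where "W i = stopping_words ?G x0 (r i) (U i)" for i
      have W: "finite (W i)" "real (card (W i)) \<le> N" "W i \<subseteq> lists ?G" for i
        using card_stopping_words_le[OF \<open>0 < m\<close> F(2) x0 r(1) bdd r(3) d d_le, of i]
        by (auto simp: W_def N_def \<kappa>_def stopping_words_def)
      let ?qq = "\<lambda>v. prod_list (map (\<lambda>w. \<delta> w powr t) v)"
      have qq: "?qq v \<le> r i powr t" if "v \<in> W i" for v i
      proof -
        have v: "v \<in> lists ?G" "D (concat v) x0 \<le> r i" using that by (auto simp: W_def stopping_words_def)
        have "set (concat v) \<subseteq> I" using set_concat_words[OF v(1) F(2)] .
        have "?qq v \<le> D (concat v) x0 powr t"
          using prod_le_word_scaling[OF \<open>0 < t\<close> x0 v(1) F(2) \<delta>] by blast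
        also have "\<dots> \<le> r i powr t"
          using v \<open>0 < t\<close> word_scaling_pos[OF \<open>set (concat v) \<subseteq> I\<close> x0] by (intro powr_mono2) auto
        finally show ?thesis .
      qed
      have bar: "\<exists>k. map \<omega> [0..<k] \<in> (\<Union>i. W i)" if \<omega>: "\<forall>i. \<omega> i \<in> ?G" for \<omega>
      proof -
        define \<tau> where "\<tau> i = \<omega> (i div m) ! (i mod m)" for i
        have len: "length (\<omega> i) = m" for i using \<omega> by (auto simp: words_def)
        have "\<tau> i \<in> F" for i
        proof -
          have "\<tau> i \<in> set (\<omega> (i div m))" unfolding \<tau>_def using len \<open>0 < m\<close> by (intro nth_mem) simp
          then show ?thesis using \<omega> by (auto simp: words_def)
        qed
        then have \<tau>: "\<tau> \<in> seqs I" using F by (auto simp: seqs_def)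
        have pre: "prefix_of \<tau> (m * k) = concat (map \<omega> [0..<k])" for k
        proof (induction k)
          case (Suc k)
          have "prefix_of ((shift ^^ (m * k)) \<tau>) m = \<omega> k"
            by (rule nth_equalityI) (auto simp: prefix_of_def shift_funpow \<tau>_def len)
          then show ?case using prefix_of_add[of \<tau> "m * k" m] Suc by (simp add: add.commute)
        qed (simp add: prefix_of_def)
        let ?x = "coding_map X \<phi> \<tau>"
        have "?x \<in> limit_set X (I, \<phi>)" using \<tau> by (auto simp: limit_set_def)
        then obtain i where i: "?x \<in> U i" using cover by blast
        let ?P = "\<lambda>k. D (concat (map \<omega> [0..<k])) x0 \<le> r i"
        obtain n where n: "c ^ n < r i" using real_arch_pow_inv[OF r(1) c(2)] by blast
        have "D (prefix_of \<tau> (m * n)) x0 \<le> c ^ (m * n)"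
          using word_scaling_le[OF prefix_of_subset[OF \<tau>] x0, of "m * n"] by simp
        then have "D (concat (map \<omega> [0..<n])) x0 \<le> c ^ (m * n)" by (simp only: pre)
        also have "\<dots> \<le> c ^ n" using c \<open>0 < m\<close> by (intro power_decreasing) auto
        finally have ex: "?P n" using n by simp
        define k where "k = (LEAST k. ?P k)"
        have k: "?P k" unfolding k_def using ex by (rule LeastI)
        have before: "r i < D (concat (map \<omega> [0..<j])) x0" if "j < k" for j
          using not_less_Least that unfolding k_def by (metis not_le)
        have "k \<noteq> 0" using k r(2)[of i] by (cases "k = 0") simp_all
        have "?x \<in> (\<Inter>k. word_map \<phi> (prefix_of \<tau> k) ` X)"
          unfolding coding_map_sing[OF \<tau>] by simp
        then have "?x \<in> word_map \<phi> (prefix_of \<tau> (m * k)) ` X" by (rule INT_D) simp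
        then have "map \<omega> [0..<k] \<in> W i"
          using i k before \<open>k \<noteq> 0\<close> \<omega> by (auto simp: W_def stopping_words_def pre take_map)
        then show ?thesis by blast
      qed
      have "1 \<le> (\<integral>\<^sup>+v. ennreal (?qq v) * indicator (\<Union>i. W i) v \<partial>count_space (lists ?G))"
        by (rule kraft_inequality[OF G _ sum bar]) auto
      also have "\<dots> \<le> (\<integral>\<^sup>+v. (\<Sum>i. ennreal (?qq v) * indicator (W i) v) \<partial>count_space (lists ?G))"
      proof (intro nn_integral_mono)
        fix v
        show "ennreal (?qq v) * indicator (\<Union>i. W i) v \<le> (\<Sum>i. ennreal (?qq v) * indicator (W i) v)"
        proof (cases "v \<in> (\<Union>i. W i)")
          case True
          then obtain i where "v \<in> W i" by blast
          then show ?thesis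
            using True ennreal_le_suminf[of "\<lambda>i. ennreal (?qq v) * indicator (W i) v" i] by simp
        qed simp
      qed
      also have "\<dots> = (\<Sum>i. \<integral>\<^sup>+v. ennreal (?qq v) * indicator (W i) v \<partial>count_space (lists ?G))"
        by (rule nn_integral_suminf) simp
      also have "\<dots> \<le> (\<Sum>i. ennreal N * ennreal (r i powr t))"
      proof (intro suminf_le allI)
        fix i
        have "(\<integral>\<^sup>+v. ennreal (?qq v) * indicator (W i) v \<partial>count_space (lists ?G))
            \<le> (\<integral>\<^sup>+v. ennreal (r i powr t) * indicator (W i) v \<partial>count_space (lists ?G))"
          using qq by (intro nn_integral_mono) (auto simp: indicator_def intro!: ennreal_leI)
        also have "\<dots> = ennreal (r i powr t) * ennreal (real (card (W i)))"
          using W[of i] by (subst nn_integral_cmult_indicator) (auto simp: emeasure_count_space ennreal_of_nat_eq_real_of_nat)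
        also have "\<dots> \<le> ennreal (r i powr t) * ennreal N"
          using W(2)[of i] by (intro mult_left_mono ennreal_leI) auto
        finally show "(\<integral>\<^sup>+v. ennreal (?qq v) * indicator (W i) v \<partial>count_space (lists ?G)) \<le> ennreal N * ennreal (r i powr t)"
          by (simp add: mult.commute)
      qed auto
      also have "\<dots> = ennreal N * (\<Sum>i. ennreal (r i powr t))" by simp
      also have "\<dots> \<le> ennreal N * ennreal (2 * \<epsilon>)" using r(4) by (intro mult_left_mono) auto
      also have "\<dots> = ennreal (1 / 2)" using N by (simp add: \<epsilon>_def flip: ennreal_mult)
      also have "\<dots> < ennreal 1" by (rule ennreal_lessI) auto
      finally show False by simp
    qed
  qed (use \<epsilon> in simp)
qed

end

section \<open>An upper bound for the dimension\<close>

context conformal_system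
begin

lemma partition_fun_0: "partition_fun I g 0 = 1"
proof -
  obtain e where "e \<in> I" using letters by blast
  then have "(\<lambda>_. e) \<in> seqs I" by (simp add: seqs_def)
  then have "seqs I \<noteq> {}" by blast
  then show ?thesis
    by (simp add: partition_fun_def exp_sup_cyl_def birkhoff_sum_def cylinder_def prefix_of_def)
qed

text \<open>
  Two points of \<open>X\<close> that are close to each other may be far apart within \<open>X\<close>, so the derivative
  of a word does not control the diameter of the image of \<open>X\<close> at once.  It does so on each of finitely
  many pieces: points whose cones have nearby centres are joined by a path of length at most
  \<open>2 * h + \<rho>\<close> that runs through these centres.
\<close>

lemma finite_pieces:
  "\<exists>(n :: nat) Y. X = (\<Union>j<n. Y j) \<and> (\<forall>w j x y B. set w \<subseteq> I \<longrightarrow> (\<forall>z\<in>X. D w z \<le> B) \<longrightarrow>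
      x \<in> Y j \<longrightarrow> y \<in> Y j \<longrightarrow> dist (word_map \<phi> w x) (word_map \<phi> w y) \<le> B * (2 * h + \<rho>)) \<and>
      (\<forall>j. Y j \<subseteq> X)"
proof -
  have "\<forall>x\<in>X. \<exists>q. ball q \<rho> \<subseteq> interior X \<and> closed_segment x q \<subseteq> X \<and> dist x q \<le> h"
    using center_of_cone by metis
  then obtain q where q: "\<And>x. x \<in> X \<Longrightarrow> ball (q x) \<rho> \<subseteq> interior X"
      "\<And>x. x \<in> X \<Longrightarrow> closed_segment x (q x) \<subseteq> X" "\<And>x. x \<in> X \<Longrightarrow> dist x (q x) \<le> h"
    by metis
  obtain P where P: "finite P" "X \<subseteq> (\<Union>p\<in>P. ball p (\<rho> / 2))"
    using compact \<rho> unfolding compact_eq_totally_bounded by (meson half_gt_zero)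
  obtain n :: nat and p where p: "P = p ` {i. i < n}"
    using finite_imp_nat_seg_image_inj_on[OF P(1)] by blast
  define Y where "Y j = {x \<in> X. q x \<in> ball (p j) (\<rho> / 2)}" for j
  have "x \<in> (\<Union>j<n. Y j)" if "x \<in> X" for x
  proof -
    have "q x \<in> X" using q(1)[OF that] \<rho> interior_subset by (meson centre_in_ball subsetD)
    then obtain j where "j < n" "q x \<in> ball (p j) (\<rho> / 2)" using P(2) unfolding p by blast
    then show ?thesis using that by (auto simp: Y_def)
  qed
  then have cover: "X = (\<Union>j<n. Y j)" by (auto simp: Y_def)
  have small: "dist (word_map \<phi> w x) (word_map \<phi> w y) \<le> B * (2 * h + \<rho>)"
    if w: "set w \<subseteq> I" and B: "\<And>z. z \<in> X \<Longrightarrow> D w z \<le> B" and xy: "x \<in> Y j" "y \<in> Y j" for w j x y B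
  proof -
    have X: "x \<in> X" "y \<in> X" using xy by (auto simp: Y_def)
    have "0 \<le> B" using B[OF X(1)] word_scaling_pos[OF w X(1)] by simp
    have near: "dist (q x) (q y) < \<rho>"
      using xy dist_triangle_half_r[of "p j" "q x" \<rho> "q y"] by (simp add: Y_def)
    then have "closed_segment (q x) (q y) \<subseteq> ball (q x) \<rho>"
      using \<rho> by (intro closed_segment_subset) auto
    then have mid: "closed_segment (q x) (q y) \<subseteq> X" using q(1)[OF X(1)] interior_subset by blast
    let ?f = "word_map \<phi> w"
    have 1: "dist (?f x) (?f (q x)) \<le> B * h"
      using dist_word_map_le[OF w q(2)[OF X(1)] B] mult_left_mono[OF q(3)[OF X(1)] \<open>0 \<le> B\<close>] by simp
    have 2: "dist (?f (q x)) (?f (q y)) \<le> B * \<rho>"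
      using dist_word_map_le[OF w mid B] mult_left_mono[OF less_imp_le[OF near] \<open>0 \<le> B\<close>] by simp
    have 3: "dist (?f y) (?f (q y)) \<le> B * h"
      using dist_word_map_le[OF w q(2)[OF X(2)] B] mult_left_mono[OF q(3)[OF X(2)] \<open>0 \<le> B\<close>] by simp
    have "dist (?f x) (?f y) \<le> dist (?f x) (?f (q x)) + dist (?f (q x)) (?f (q y)) + dist (?f y) (?f (q y))"
      by (smt (verit) dist_commute dist_triangle)
    also have "\<dots> \<le> B * h + B * \<rho> + B * h" using 1 2 3 by simp
    finally show ?thesis by (simp add: algebra_simps)
  qed
  show ?thesis
  proof (intro exI[of _ n] exI[of _ Y] conjI allI impI)
    show "X = (\<Union>j<n. Y j)" by (rule cover)
    fix w j x y B
    assume "set w \<subseteq> I" "\<forall>z\<in>X. D w z \<le> B" "x \<in> Y j" "y \<in> Y j"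
    then show "dist (word_map \<phi> w x) (word_map \<phi> w y) \<le> B * (2 * h + \<rho>)"
      by (intro small) auto
  qed (auto simp: Y_def)
qed

text \<open>
  The cover consists of the images of the finitely many pieces of \<open>X\<close> under the words of length
  \<open>m * i\<close>.  Up to a factor that does not depend on \<open>i\<close>, the sum of the powers of the diameters is
  the partition function, hence at most the \<open>i\<close>-th power of a number less than one.
\<close>

lemma hausdorff_dim_limit_set_le:
  assumes "0 < s" and Z: "partition_fun I (\<lambda>\<omega>. s * geometric_potential X \<phi> \<omega>) m < 1"
  shows "hausdorff_dim (limit_set X (I, \<phi>)) \<le> ennreal s"
proof -
  let ?g = "\<lambda>\<omega>. s * geometric_potential X \<phi> \<omega>"
  obtain x0 where x0: "x0 \<in> X" using nonempty by blast
  from finite_pieces obtain n :: nat and Y where X: "X = (\<Union>j<n. Y j)" and YX: "\<And>j. Y j \<subseteq> X"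
    and Y: "\<forall>w j x y B. set w \<subseteq> I \<longrightarrow> (\<forall>z\<in>X. D w z \<le> B) \<longrightarrow> x \<in> Y j \<longrightarrow> y \<in> Y j \<longrightarrow>
      dist (word_map \<phi> w x) (word_map \<phi> w y) \<le> B * (2 * h + \<rho>)"
    by (elim exE conjE) blast
  have K: "0 < K" using K_ge_1 by simp
  have "m \<noteq> 0" using Z partition_fun_0[of ?g] by (metis less_irrefl)
  define C where "C = (K * K * (2 * h + \<rho>)) powr s"
  have gauge: "hausdorff_gauge s (word_map \<phi> w ` Y j) \<le> ennreal C * exp_sup_cyl I ?g w"
    if w: "set w \<subseteq> I" for w j
  proof (cases "Y j = {}")
    case False
    define B where "B = K * D w x0"
    have B: "D w z \<le> B" if "z \<in> X" for z unfolding B_def using distortion[OF w x0 that] .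
    have "0 \<le> B" using K word_scaling_pos[OF w x0] by (simp add: B_def)
    have "diameter (word_map \<phi> w ` Y j) \<le> B * (2 * h + \<rho>)"
      using False Y w B by (intro diameter_le) (auto simp: dist_norm)
    moreover have "0 \<le> diameter (word_map \<phi> w ` Y j)"
      using word_map_in[OF w] YX by (intro diameter_ge_0 bounded_subset[OF bounded]) blast
    ultimately have "diameter (word_map \<phi> w ` Y j) powr s \<le> (B * (2 * h + \<rho>)) powr s"
      using \<open>0 < s\<close> by (intro powr_mono2) auto
    also have "B * (2 * h + \<rho>) = (K * K * (2 * h + \<rho>)) * (D w x0 / K)"
      using K by (simp add: B_def)
    also have "(\<dots>) powr s = C * (D w x0 / K) powr s"
      using K h \<rho> word_scaling_pos[OF w x0] by (simp add: C_def powr_mult del: times_divide_eq_right)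
    finally have "hausdorff_gauge s (word_map \<phi> w ` Y j) \<le> ennreal C * ennreal ((D w x0 / K) powr s)"
      using \<open>0 < s\<close> False by (simp add: hausdorff_gauge_def C_def ennreal_leI flip: ennreal_mult)
    also have "ennreal ((D w x0 / K) powr s) \<le> exp_sup_cyl I ?g w"
    proof (rule exp_sup_cyl_ge[OF w])
      fix y assume "y \<in> X"
      then have "D w x0 / K \<le> D w y" using distortion[OF w _ x0] K by (simp add: divide_le_eq mult.commute)
      then show "(D w x0 / K) powr s \<le> D w y powr s"
        using \<open>0 < s\<close> K word_scaling_pos[OF w x0] by (intro powr_mono2) auto
    qed
    finally show ?thesis by (simp add: mult_left_mono)
  qed (simp add: hausdorff_gauge_def)
  obtain z where z: "partition_fun I ?g m = ennreal z" "0 \<le> z" "z < 1"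
    using Z by (cases "partition_fun I ?g m") (auto simp: ennreal_less_one_iff)
  show ?thesis
  proof (rule hausdorff_dim_leI)
    fix \<delta> \<epsilon> :: real assume \<delta>: "0 < \<delta>" and \<epsilon>: "0 < \<epsilon>"
    have "(\<lambda>i. real n * C * z ^ i) \<longlonglongrightarrow> real n * C * 0"
      using z by (intro tendsto_mult tendsto_const LIMSEQ_realpow_zero) auto
    then have "\<forall>\<^sub>F i in sequentially. real n * C * z ^ i < \<epsilon>" using \<epsilon> by (intro order_tendstoD) auto
    moreover have "(\<lambda>i. c ^ i * \<Delta>) \<longlonglongrightarrow> 0 * \<Delta>"
      using c by (intro tendsto_mult tendsto_const LIMSEQ_realpow_zero) auto
    then have "\<forall>\<^sub>F i in sequentially. c ^ i * \<Delta> < \<delta>" using \<delta> by (intro order_tendstoD) auto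
    ultimately have "\<forall>\<^sub>F i in sequentially. real n * C * z ^ i < \<epsilon> \<and> c ^ i * \<Delta> < \<delta>"
      by (rule eventually_conj)
    then obtain i where i: "real n * C * z ^ i < \<epsilon>" "c ^ i * \<Delta> < \<delta>"
      by (auto dest: eventually_happens)
    define P where "P = words I (m * i) \<times> {..<n}"
    define V where "V = (\<lambda>(w, j). word_map \<phi> w ` Y j)"
    have I: "set w \<subseteq> I" "length w = m * i" if "w \<in> words I (m * i)" for w using that by (auto simp: words_def)
    have "limit_set X (I, \<phi>) \<subseteq> (\<Union>p\<in>P. V p)"
    proof
      fix x assume "x \<in> limit_set X (I, \<phi>)"
      then obtain w y where wy: "w \<in> words I (m * i)" "y \<in> X" "x = word_map \<phi> w y"
        using limit_set_cover[of "m * i"] by blast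
      then obtain j where "j < n" "y \<in> Y j" using X by blast
      then have "(w, j) \<in> P" "x \<in> V (w, j)" using wy by (auto simp: P_def V_def)
      then show "x \<in> (\<Union>p\<in>P. V p)" by blast
    qed
    moreover have "bounded (V p) \<and> diameter (V p) \<le> \<delta>" if "p \<in> P" for p
    proof -
      obtain w j where p: "p = (w, j)" "w \<in> words I (m * i)" "j < n" using \<open>p \<in> P\<close> by (auto simp: P_def)
      have Yj: "Y j \<subseteq> X" by (rule YX)
      have "V p \<subseteq> X" using word_map_in[OF I(1)] p Yj by (auto simp: V_def)
      moreover have "norm (x - y) \<le> \<delta>" if "x \<in> V p" "y \<in> V p" for x y
      proof -
        obtain a b where ab: "a \<in> X" "b \<in> X" "x = word_map \<phi> w a" "y = word_map \<phi> w b"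
          using \<open>x \<in> V p\<close> \<open>y \<in> V p\<close> Yj by (auto simp: V_def p)
        have "dist x y \<le> c ^ (m * i) * dist a b"
          using lipschitz_word_map[OF I(1)[OF p(2)] ab(1,2)] I(2)[OF p(2)] ab by simp
        also have "\<dots> \<le> c ^ i * \<Delta>"
          using c \<open>m \<noteq> 0\<close> dist_le_diameter ab by (intro mult_mono power_decreasing) auto
        finally show ?thesis using i(2) by (simp add: dist_norm)
      qed
      ultimately show ?thesis
        using bounded_subset[OF bounded] \<delta> by (auto intro!: diameter_le)
    qed
    moreover have "(\<Sum>\<^sub>\<infinity>p\<in>P. hausdorff_gauge s (V p)) \<le> ennreal \<epsilon>"
    proof (rule ennreal_infsum_le)
      fix S assume S: "finite S" "S \<subseteq> P"
      have "(\<Sum>p\<in>S. hausdorff_gauge s (V p)) \<le> (\<Sum>p\<in>S. ennreal C * exp_sup_cyl I ?g (fst p))"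
      proof (rule sum_mono)
        fix p assume "p \<in> S"
        then obtain w j where p: "p = (w, j)" "w \<in> words I (m * i)" using S by (auto simp: P_def)
        then show "hausdorff_gauge s (V p) \<le> ennreal C * exp_sup_cyl I ?g (fst p)"
          using gauge[OF I(1)] by (simp add: V_def)
      qed
      also have "\<dots> \<le> (\<Sum>p\<in>fst ` S \<times> {..<n}. ennreal C * exp_sup_cyl I ?g (fst p))"
        using S by (intro sum_mono2) (force simp: P_def)+
      also have "\<dots> = (\<Sum>w\<in>fst ` S. \<Sum>j<n. ennreal C * exp_sup_cyl I ?g w)"
        by (subst sum.cartesian_product) (simp add: case_prod_unfold)
      also have "\<dots> = of_nat n * (ennreal C * (\<Sum>w\<in>fst ` S. exp_sup_cyl I ?g w))"
        by (simp add: sum_distrib_left)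
      also have "(\<Sum>w\<in>fst ` S. exp_sup_cyl I ?g w) \<le> partition_fun I ?g (m * i)"
        unfolding partition_fun_def using S by (intro ennreal_sum_le_infsum) (auto simp: P_def)
      also have "partition_fun I ?g (m * i) \<le> partition_fun I ?g m ^ i"
        by (rule partition_fun_mult_le) (simp add: partition_fun_0)
      also have "partition_fun I ?g m ^ i = ennreal (z ^ i)" using z by (simp add: ennreal_power)
      also have "of_nat n * (ennreal C * ennreal (z ^ i)) = ennreal (real n * C * z ^ i)"
        using z by (simp add: C_def ennreal_mult ennreal_of_nat_eq_real_of_nat mult.assoc)
      also have "\<dots> \<le> ennreal \<epsilon>" using i(1) by (intro ennreal_leI) simp
      finally show "(\<Sum>p\<in>S. hausdorff_gauge s (V p)) \<le> ennreal \<epsilon>" by (simp add: mult_left_mono)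
    qed
    ultimately show "\<exists>(P :: (nat list \<times> nat) set) V. limit_set X (I, \<phi>) \<subseteq> (\<Union>p\<in>P. V p) \<and>
        (\<forall>p\<in>P. bounded (V p) \<and> diameter (V p) \<le> \<delta>) \<and>
        (\<Sum>\<^sub>\<infinity>p\<in>P. hausdorff_gauge s (V p)) \<le> ennreal \<epsilon>"
      by blast
  qed (use \<open>0 < s\<close> in simp)
qed

text \<open>
  Factor \<open>|\<phi>\<^sub>w'|\<^sup>s = |\<phi>\<^sub>w'|\<^sup>s\<^sup>-\<^sup>t |\<phi>\<^sub>w'|\<^sup>t\<close>.  The first factor is exponentially small in the length of \<open>w\<close>, and
  the sum of the second one is bounded by assumption.
\<close>

lemma partition_fun_le:
  assumes "x0 \<in> X" "0 < t" "t < s"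
    and bound: "\<And>F. finite F \<Longrightarrow> F \<subseteq> I \<Longrightarrow> (\<Sum>w\<in>words F m. (D w x0 / K) powr t) \<le> 1"
  shows "partition_fun I (\<lambda>\<omega>. s * geometric_potential X \<phi> \<omega>) m
    \<le> ennreal ((K * K) powr t * (c powr (s - t)) ^ m)"
  unfolding partition_fun_def
proof (rule ennreal_infsum_le)
  let ?g = "\<lambda>\<omega>. s * geometric_potential X \<phi> \<omega>"
  let ?C = "(K * K) powr t * (c powr (s - t)) ^ m"
  have K: "0 < K" using K_ge_1 by simp
  fix S assume S: "finite S" "S \<subseteq> words I m"
  define F where "F = (\<Union>w\<in>S. set w)"
  have F: "finite F" "F \<subseteq> I" "S \<subseteq> words F m" using S by (auto simp: F_def words_def)
  have "exp_sup_cyl I ?g w \<le> ennreal (?C * (D w x0 / K) powr t)" if "w \<in> S" for w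
  proof (rule exp_sup_cyl_le)
    fix y assume y: "y \<in> X"
    have w: "set w \<subseteq> I" "length w = m" using S that by (auto simp: words_def)
    have pos: "0 < D w y" "0 < D w x0" using word_scaling_pos w y \<open>x0 \<in> X\<close> by auto
    have "D w y powr s = D w y powr (s - t) * D w y powr t" by (simp flip: powr_add)
    also have "\<dots> \<le> (c ^ m) powr (s - t) * ((K * K) * (D w x0 / K)) powr t"
      using word_scaling_le[OF w(1) y] distortion[OF w(1) \<open>x0 \<in> X\<close> y] pos assms w K
      by (intro mult_mono powr_mono2) auto
    also have "(c ^ m) powr (s - t) = (c powr (s - t)) ^ m"
      using c by (simp add: powr_power powr_powr mult.commute flip: powr_realpow)
    also have "((K * K) * (D w x0 / K)) powr t = (K * K) powr t * (D w x0 / K) powr t"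
      using pos K by (simp add: powr_mult del: times_divide_eq_right)
    finally show "D w y powr s \<le> ?C * (D w x0 / K) powr t" by (simp add: mult_ac)
  qed
  then have "(\<Sum>w\<in>S. exp_sup_cyl I ?g w) \<le> (\<Sum>w\<in>S. ennreal (?C * (D w x0 / K) powr t))"
    by (rule sum_mono)
  also have "\<dots> = ennreal (?C * (\<Sum>w\<in>S. (D w x0 / K) powr t))"
    by (subst sum_ennreal) (auto simp: sum_distrib_left)
  also have "\<dots> \<le> ennreal ?C"
  proof (rule ennreal_leI)
    have "(\<Sum>w\<in>S. (D w x0 / K) powr t) \<le> (\<Sum>w\<in>words F m. (D w x0 / K) powr t)"
      using F finite_words by (intro sum_mono2) auto
    also have "\<dots> \<le> 1" using bound F by blast
    finally show "?C * (\<Sum>w\<in>S. (D w x0 / K) powr t) \<le> ?C"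
      by (intro mult_left_le) auto
  qed
  finally show "sum (exp_sup_cyl I ?g) S \<le> ennreal ?C" .
qed

end

section \<open>The pressure above the dimension\<close>

context conformal_system
begin

abbreviation "Z s \<equiv> partition_fun I (\<lambda>\<omega>. s * geometric_potential X \<phi> \<omega>)"

lemma distortion_lower: "set w \<subseteq> I \<Longrightarrow> x0 \<in> X \<Longrightarrow> y \<in> X \<Longrightarrow> D w x0 / K \<le> D w y"
  using distortion[of w y x0] K_ge_1 by (simp add: divide_le_eq mult.commute)

lemma sum_word_0_le: "x0 \<in> X \<Longrightarrow> 0 < t \<Longrightarrow> (\<Sum>w\<in>words F 0. (D w x0 / K) powr t) \<le> 1"
  using K_ge_1 by (auto intro!: powr_le1)

text \<open>
  The lower bound for the dimension, read backwards.
\<close>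

lemma partition_fun_le_of_dim_less:
  assumes x0: "x0 \<in> X" and t: "0 < t" "t < s" and dim: "hausdorff_dim (limit_set X (I, \<phi>)) < ennreal t"
  shows "Z s m \<le> ennreal ((K * K) powr t * (c powr (s - t)) ^ m)"
proof (rule partition_fun_le[OF x0 t])
  fix F assume F: "finite F" "F \<subseteq> I"
  show "(\<Sum>w\<in>words F m. (D w x0 / K) powr t) \<le> 1"
  proof (rule ccontr)
    assume gt: "\<not> ?thesis"
    then have "0 < m" using sum_word_0_le[OF x0 t(1)] by (cases m) auto
    have "0 < D w x0 / K \<and> D w x0 / K \<le> D w y" if "w \<in> words F m" "y \<in> X" for w y
      using that F distortion_lower[of w x0 y] word_scaling_pos[of w x0] K_ge_1 x0 by (auto simp: words_def)
    then have "ennreal t \<le> hausdorff_dim (limit_set X (I, \<phi>))"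
      using gt by (intro hausdorff_dim_limit_set_ge[OF F \<open>0 < m\<close> t(1), of "\<lambda>w. D w x0 / K"]) auto
    then show False using dim by simp
  qed
qed

lemma geometric_small: "0 < t \<Longrightarrow> t < s \<Longrightarrow> (\<lambda>m. C * (c powr (s - t)) ^ m) \<longlonglongrightarrow> 0"
  using c tendsto_mult[OF tendsto_const LIMSEQ_realpow_zero[of "c powr (s - t)"], of C]
  by (simp add: powr01_less_one)

text \<open>
  The minimum of two powers covers both signs of \<open>s\<close>.
\<close>

lemma partition_fun_nonzero: "Z s m \<noteq> 0"
proof -
  obtain e x0 where e: "e \<in> I" and x0: "x0 \<in> X" using letters nonempty by blast
  define w where "w = replicate m e"
  have w: "w \<in> words I m" "set w \<subseteq> I" using e by (auto simp: w_def words_def)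
  let ?p = "min ((D w x0 / K) powr s) ((K * D w x0) powr s)"
  have K: "0 < K" using K_ge_1 by simp
  have pos: "0 < D w x0" using word_scaling_pos[OF w(2) x0] .
  have "ennreal (?p) \<le> exp_sup_cyl I (\<lambda>\<omega>. s * geometric_potential X \<phi> \<omega>) w"
  proof (rule exp_sup_cyl_ge[OF w(2)])
    fix y assume y: "y \<in> X"
    show "?p \<le> D w y powr s"
    proof (cases "0 \<le> s")
      case True
      then have "(D w x0 / K) powr s \<le> D w y powr s"
        using distortion_lower[OF w(2) x0 y] pos K by (intro powr_mono2) auto
      then show ?thesis by simp
    next
      case False
      then have "(K * D w x0) powr s \<le> D w y powr s"
        using distortion[OF w(2) x0 y] word_scaling_pos[OF w(2) y] by (intro powr_mono2') auto
      then show ?thesis by simp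
    qed
  qed
  also have "\<dots> \<le> Z s m"
    unfolding partition_fun_def using ennreal_sum_le_infsum[of "{w}" "words I m"] w by simp
  finally have "ennreal (?p) \<le> Z s m" .
  moreover have "0 < ?p" using pos K by simp
  ultimately show ?thesis by (metis ennreal_eq_0_iff le_zero_eq not_less)
qed

end

section \<open>Extracting a conformal system from the axioms\<close>

text \<open>
  The radius \<open>l / 4 * (1 - cos (\<gamma> / 2))\<close> is chosen such that a ball of this radius around the point at
  height \<open>l / 2\<close> on the axis stays inside the cone; the cone is invariant under shrinking
  towards its vertex.
\<close>

lemma open_cone_contains_scaled_ball:
  fixes u :: "'a::euclidean_space"
  assumes "norm u = 1" "0 < \<gamma>" "\<gamma> < pi / 2" "0 < l"
    and v: "v \<in> ball ((l / 2) *\<^sub>R u) (l / 4 * (1 - cos (\<gamma> / 2)))" and t: "0 < t" "t \<le> 1"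
  shows "x + t *\<^sub>R v \<in> open_cone x u \<gamma> l"
proof -
  define k where "k = cos (\<gamma> / 2)"
  have k: "0 \<le> k" "k < 1"
    using assms cos_monotone_0_pi[of 0 "\<gamma> / 2"] by (auto simp: k_def intro!: cos_ge_zero)
  define e where "e = norm (v - (l / 2) *\<^sub>R u)"
  have e: "0 \<le> e" "e < l / 4 * (1 - k)" using v by (auto simp: e_def k_def dist_norm norm_minus_commute)
  have norm_v: "norm v \<le> l / 2 + e"
    using norm_triangle_ineq[of "(l / 2) *\<^sub>R u" "v - (l / 2) *\<^sub>R u"] assms by (simp add: e_def)
  have "\<bar>(v - (l / 2) *\<^sub>R u) \<bullet> u\<bar> \<le> e"
    using Cauchy_Schwarz_ineq2[of "v - (l / 2) *\<^sub>R u" u] assms by (simp add: e_def)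
  then have inner_v: "l / 2 - e \<le> v \<bullet> u" "v \<bullet> u \<le> l / 2 + e"
    using assms by (auto simp: inner_diff_left dot_square_norm)
  have "e * (1 + k) \<le> e * 2" using e k by (intro mult_left_mono) auto
  then have "(l / 2 + e) * k < l / 2 - e" using e by (simp add: algebra_simps)
  then have "norm v * k < v \<bullet> u" using mult_right_mono[OF norm_v k(1)] inner_v by linarith
  then have "t * (norm v * k) < t * (v \<bullet> u)" using t by (intro mult_strict_left_mono)
  moreover have "t * (v \<bullet> u) < l"
  proof -
    have "l / 4 * (1 - k) \<le> l / 4 * 1" using k assms by (intro mult_left_mono) auto
    then have "v \<bullet> u < l" using inner_v e \<open>0 < l\<close> by linarith
    moreover have "0 < v \<bullet> u" using \<open>norm v * k < v \<bullet> u\<close> k by (smt (verit) norm_ge_zero mult_nonneg_nonneg)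
    ultimately show ?thesis using t by (smt (verit) mult_left_le_one_le)
  qed
  ultimately show ?thesis using t by (simp add: open_cone_def k_def mult.assoc)
qed

lemma cone_property_uniform:
  fixes X :: "'a::euclidean_space set"
  assumes "cone_property X"
  shows "\<exists>h>0. \<exists>\<rho>>0. \<forall>x\<in>X. \<exists>a. norm a = h \<and> (\<forall>v\<in>ball a \<rho>. \<forall>t. 0 < t \<and> t \<le> 1 \<longrightarrow> x + t *\<^sub>R v \<in> interior X)"
proof -
  obtain \<gamma> l where \<gamma>: "0 < \<gamma>" "\<gamma> < pi / 2" "0 < l"
    and cone: "\<And>x. x \<in> X \<Longrightarrow> \<exists>u. norm u = 1 \<and> open_cone x u \<gamma> l \<subseteq> interior X"
    using assms unfolding cone_property_def by blast
  have "cos (\<gamma> / 2) < 1" using \<gamma> cos_monotone_0_pi[of 0 "\<gamma> / 2"] by auto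
  define h \<rho> where "h = l / 2" and "\<rho> = l / 4 * (1 - cos (\<gamma> / 2))"
  have "0 < h" "0 < \<rho>" using \<gamma> \<open>cos (\<gamma> / 2) < 1\<close> by (auto simp: h_def \<rho>_def)
  moreover have "\<exists>a. norm a = h \<and> (\<forall>v\<in>ball a \<rho>. \<forall>t. 0 < t \<and> t \<le> 1 \<longrightarrow> x + t *\<^sub>R v \<in> interior X)"
    if "x \<in> X" for x
  proof -
    obtain u where u: "norm u = 1" "open_cone x u \<gamma> l \<subseteq> interior X" using cone[OF \<open>x \<in> X\<close>] by blast
    have "norm (h *\<^sub>R u) = h" using u \<open>0 < h\<close> by simp
    moreover have "x + t *\<^sub>R v \<in> interior X" if "v \<in> ball (h *\<^sub>R u) \<rho>" "0 < t \<and> t \<le> 1" for v t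
      using open_cone_contains_scaled_ball[OF u(1) \<gamma>, of v t x] u(2) that
      unfolding h_def \<rho>_def by blast
    ultimately show ?thesis by blast
  qed
  ultimately show ?thesis by blast
qed

lemma onorm_inv_similarity:
  fixes T :: "'a::euclidean_space \<Rightarrow> 'a"
  assumes T: "orthogonal_transformation T" and "0 < k"
  shows "onorm (inv (\<lambda>v. k *\<^sub>R T v)) = 1 / k"
proof (rule onorm_similarity)
  let ?f = "\<lambda>v. k *\<^sub>R T v"
  have "surj T" using orthogonal_transformation_surj[OF T] .
  have "surj ?f"
  proof (rule surjI)
    fix y show "?f (inv T ((1 / k) *\<^sub>R y)) = y" using \<open>0 < k\<close> surj_f_inv_f[OF \<open>surj T\<close>] by simp
  qed
  fix v
  have "norm (?f (inv ?f v)) = k * norm (inv ?f v)"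
    using \<open>0 < k\<close> orthogonal_transformation_norm[OF T] by simp
  then show "norm (inv ?f v) = 1 / k * norm v"
    using surj_f_inv_f[OF \<open>surj ?f\<close>, of v] \<open>0 < k\<close> by (simp add: field_simps)
qed (use \<open>0 < k\<close> in simp)

text \<open>
  Three points need care.  The derivative within \<open>X\<close> has to be identified with that of the conformal
  extension at boundary points too, for which the cones are used.  The supremum of the norms of the
  inverse derivatives has to be finite in order to be meaningful; this holds because the derivative of
  the extension is continuous and \<open>X\<close> is compact.  Finally the additive condition (e) is turned into
  the multiplicative one by \<open>1 / |\<phi>\<^sub>e'(x)| \<le> \<parallel>(\<phi>\<^sub>e')\<^sup>-\<^sup>1\<parallel>\<close> and \<open>1 + u \<le> exp u\<close>.
\<close>

lemma CIFS_imp_conformal_system: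
  fixes X :: "'a::euclidean_space set"
  assumes sys: "(I, \<phi>) \<in> CIFS X" and X: "compact X" "X \<noteq> {}"
  shows "\<exists>c h \<rho> L \<alpha>. conformal_system X I \<phi> c h \<rho> L \<alpha>"
proof -
  have letters: "I \<noteq> {}"
    and maps: "\<And>e. e \<in> I \<Longrightarrow> \<phi> e ` X \<subseteq> X" and inj: "\<And>e. e \<in> I \<Longrightarrow> inj_on (\<phi> e) X"
    and osc: "\<And>a b. a \<in> I \<Longrightarrow> b \<in> I \<Longrightarrow> a \<noteq> b \<Longrightarrow> \<phi> a ` interior X \<inter> \<phi> b ` interior X = {}"
    and cone: "cone_property X"
    using sys by (auto simp: CIFS_def)
  note conditions = sys[unfolded CIFS_def mem_Collect_eq case_prod_conv]
  have lip': "\<exists>c<1. \<forall>e\<in>I. c-lipschitz_on X (\<phi> e)"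
    using conditions by (elim conjE)
  have ext': "\<exists>W. open W \<and> connected W \<and> X \<subseteq> W \<and>
        (\<forall>e\<in>I. \<exists>\<psi>. (\<forall>x\<in>X. \<psi> x = \<phi> e x) \<and> C1_conformal_diffeo_into W \<psi>)"
    using conditions by (elim conjE)
  have hoelder': "\<exists>L\<ge>1. \<exists>\<alpha>>0. \<forall>e\<in>I. \<forall>x\<in>X. \<forall>y\<in>X.
        \<bar>onorm (deriv_on X (\<phi> e) y) - onorm (deriv_on X (\<phi> e) x)\<bar>
          \<le> L / sup_onorm_on X (\<lambda>z. inv (deriv_on X (\<phi> e) z)) * norm (y - x) powr \<alpha>"
    using conditions by (elim conjE)
  obtain c0 where c0: "c0 < 1" "\<And>e. e \<in> I \<Longrightarrow> c0-lipschitz_on X (\<phi> e)"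
    using lip' by blast
  obtain W where W: "open W" "X \<subseteq> W"
    and ext: "\<And>e. e \<in> I \<Longrightarrow> \<exists>\<psi>. (\<forall>x\<in>X. \<psi> x = \<phi> e x) \<and> C1_conformal_diffeo_into W \<psi>"
    using ext' by blast
  obtain L \<alpha> where L: "1 \<le> L" "0 < \<alpha>"
    and hoelder: "\<And>e x y. e \<in> I \<Longrightarrow> x \<in> X \<Longrightarrow> y \<in> X \<Longrightarrow>
        \<bar>onorm (deriv_on X (\<phi> e) y) - onorm (deriv_on X (\<phi> e) x)\<bar>
          \<le> L / sup_onorm_on X (\<lambda>z. inv (deriv_on X (\<phi> e) z)) * norm (y - x) powr \<alpha>"
    using hoelder' by blast
  obtain h \<rho> where h: "0 < h" "0 < \<rho>"
    and ball: "\<And>x. x \<in> X \<Longrightarrow> \<exists>a. norm a = h \<and> (\<forall>v\<in>ball a \<rho>. \<forall>t. 0 < t \<and> t \<le> 1 \<longrightarrow> x + t *\<^sub>R v \<in> interior X)"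
    using cone_property_uniform[OF cone] by blast
  define c where "c = max c0 (1 / 2)"
  have lip: "c-lipschitz_on X (\<phi> e)" if "e \<in> I" for e
    using c0(2)[OF that] by (rule lipschitz_on_mono) (simp_all add: c_def)
  have deriv: "\<exists>T. orthogonal_transformation T \<and> deriv_on X (\<phi> e) x = (\<lambda>v. scaling X \<phi> e x *\<^sub>R T v) \<and>
      (\<phi> e has_derivative (\<lambda>v. scaling X \<phi> e x *\<^sub>R T v)) (at x within X) \<and> 0 < scaling X \<phi> e x \<and>
      (\<psi> has_derivative (\<lambda>v. scaling X \<phi> e x *\<^sub>R T v)) (at x)"
    if e: "e \<in> I" and x: "x \<in> X" and \<psi>: "\<forall>x\<in>X. \<psi> x = \<phi> e x" "C1_conformal_diffeo_into W \<psi>" for e x \<psi>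
  proof -
    obtain k T where T: "0 < k" "orthogonal_transformation T" "(\<psi> has_derivative (\<lambda>v. k *\<^sub>R T v)) (at x)"
      using \<psi>(2) x W(2) unfolding C1_conformal_diffeo_into_def conformal_on_def by blast
    have der: "(\<phi> e has_derivative (\<lambda>v. k *\<^sub>R T v)) (at x within X)"
      using has_derivative_transform[OF x, of "\<phi> e" \<psi>] \<psi>(1) T(3) has_derivative_at_withinI by fastforce
    then have "\<phi> e differentiable (at x within X)" unfolding differentiable_def by blast
    then have der': "(\<phi> e has_derivative deriv_on X (\<phi> e) x) (at x within X)"
      unfolding deriv_on_def frechet_derivative_works .
    obtain a where a: "\<And>v t. v \<in> ball a \<rho> \<Longrightarrow> 0 < t \<Longrightarrow> t \<le> 1 \<Longrightarrow> x + t *\<^sub>R v \<in> X"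
      using ball[OF x] interior_subset by blast
    have eq: "deriv_on X (\<phi> e) x = (\<lambda>v. k *\<^sub>R T v)"
      using has_derivative_within_cone_unique[OF der' der h(2) a] .
    have "scaling X \<phi> e x = k"
      unfolding scaling_def eq
      using T(1) orthogonal_transformation_norm[OF T(2)] by (intro onorm_similarity) auto
    then show ?thesis using T eq der by (intro exI[of _ T]) simp
  qed
  have sim: "\<exists>T. orthogonal_transformation T \<and> deriv_on X (\<phi> e) x = (\<lambda>v. scaling X \<phi> e x *\<^sub>R T v) \<and>
      (\<phi> e has_derivative (\<lambda>v. scaling X \<phi> e x *\<^sub>R T v)) (at x within X) \<and> 0 < scaling X \<phi> e x"
    if "e \<in> I" "x \<in> X" for e x
    using ext[OF that(1)] deriv[OF that] by blast
  have pos: "0 < scaling X \<phi> e x" if "e \<in> I" "x \<in> X" for e x using sim[OF that] by blast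
  have "scaling X \<phi> e x \<le> c" if e: "e \<in> I" and x: "x \<in> X" for e x
  proof -
    obtain a where a: "norm a = h" "\<And>v t. v \<in> ball a \<rho> \<Longrightarrow> 0 < t \<Longrightarrow> t \<le> 1 \<Longrightarrow> x + t *\<^sub>R v \<in> interior X"
      using ball[OF x] by blast
    have ray: "x + t *\<^sub>R a \<in> X" if "0 < t" "t \<le> 1" for t
      using a(2)[of a t] that h interior_subset by auto
    obtain T where T: "orthogonal_transformation T"
        "(\<phi> e has_derivative (\<lambda>v. scaling X \<phi> e x *\<^sub>R T v)) (at x within X)"
      using sim[OF e x] by blast
    have "norm (scaling X \<phi> e x *\<^sub>R T a) \<le> c * norm a"
      using lipschitz_derivative_bound[OF T(2) lip[OF e] x ray] .
    then have "scaling X \<phi> e x * h \<le> c * h"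
      using pos[OF e x] orthogonal_transformation_norm[OF T(1)] a(1) by simp
    then show ?thesis using h by simp
  qed
  moreover have "scaling X \<phi> e y \<le> scaling X \<phi> e x * exp (L * dist x y powr \<alpha>)"
    if e: "e \<in> I" and x: "x \<in> X" and y: "y \<in> X" for e x y
  proof -
    obtain \<psi> where \<psi>: "\<forall>x\<in>X. \<psi> x = \<phi> e x" "C1_conformal_diffeo_into W \<psi>" using ext[OF e] by blast
    then obtain f' :: "'a \<Rightarrow> 'a \<Rightarrow>\<^sub>L 'a" where
        f': "\<And>w. w \<in> W \<Longrightarrow> (\<psi> has_derivative blinfun_apply (f' w)) (at w)" "continuous_on W f'"
      unfolding C1_conformal_diffeo_into_def C1_on_def by blast
    have scal: "scaling X \<phi> e z = norm (f' z)" if "z \<in> X" for z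
    proof -
      obtain T where T: "orthogonal_transformation T"
          "(\<psi> has_derivative (\<lambda>v. scaling X \<phi> e z *\<^sub>R T v)) (at z)"
        using deriv[OF e \<open>z \<in> X\<close> \<psi>] by blast
      have "blinfun_apply (f' z) = (\<lambda>v. scaling X \<phi> e z *\<^sub>R T v)"
        using has_derivative_unique[OF f'(1) T(2)] that W(2) by blast
      then have "norm (f' z) = onorm (\<lambda>v. scaling X \<phi> e z *\<^sub>R T v)" by (simp add: norm_blinfun.rep_eq)
      also have "\<dots> = scaling X \<phi> e z"
        using pos[OF e that] orthogonal_transformation_norm[OF T(1)] by (intro onorm_similarity) auto
      finally show ?thesis by simp
    qed
    have "continuous_on X (\<lambda>z. norm (f' z))"
      using f'(2) W(2) by (intro continuous_on_norm) (rule continuous_on_subset)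
    then obtain z0 where z0: "z0 \<in> X" "\<And>z. z \<in> X \<Longrightarrow> norm (f' z0) \<le> norm (f' z)"
      using continuous_attains_inf[OF X] by blast
    define S where "S = sup_onorm_on X (\<lambda>z. inv (deriv_on X (\<phi> e) z))"
    have inv: "onorm (inv (deriv_on X (\<phi> e) z)) = 1 / scaling X \<phi> e z" if "z \<in> X" for z
      using sim[OF e that] onorm_inv_similarity by metis
    have "1 / scaling X \<phi> e x \<le> S"
      unfolding S_def sup_onorm_on_def inv[OF x, symmetric]
    proof (rule cSUP_upper[OF x bdd_aboveI2])
      fix z assume z: "z \<in> X"
      show "onorm (inv (deriv_on X (\<phi> e) z)) \<le> 1 / scaling X \<phi> e z0"
        unfolding inv[OF z] using z0(2)[OF z] scal[OF z] scal[OF z0(1)] pos[OF e z0(1)]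
        by (intro frac_le) auto
    qed
    then have "1 / S \<le> 1 / (1 / scaling X \<phi> e x)"
      using pos[OF e x] by (intro frac_le) auto
    then have "L / S \<le> L * scaling X \<phi> e x"
      using L(1) mult_left_mono[of "1 / S" "scaling X \<phi> e x" L] by simp
    then have "L / S * dist x y powr \<alpha> \<le> L * scaling X \<phi> e x * dist x y powr \<alpha>"
      by (intro mult_right_mono) auto
    moreover have "scaling X \<phi> e y - scaling X \<phi> e x \<le> L / S * dist x y powr \<alpha>"
      using hoelder[OF e x y] unfolding scaling_def S_def by (simp add: dist_norm norm_minus_commute)
    ultimately have "scaling X \<phi> e y \<le> scaling X \<phi> e x * (1 + L * dist x y powr \<alpha>)"
      by (simp add: algebra_simps)
    also have "\<dots> \<le> scaling X \<phi> e x * exp (L * dist x y powr \<alpha>)"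
      using pos[OF e x] exp_ge_add_one_self by (intro mult_left_mono) auto
    finally show ?thesis .
  qed
  moreover have "\<exists>a. norm a \<le> h \<and> (\<forall>v\<in>ball a \<rho>. \<forall>t. 0 < t \<and> t \<le> 1 \<longrightarrow> x + t *\<^sub>R v \<in> interior X)"
    if "x \<in> X" for x using ball[OF that] by (metis order_refl)
  moreover have "\<exists>T. orthogonal_transformation T \<and>
      (\<phi> e has_derivative (\<lambda>v. scaling X \<phi> e x *\<^sub>R T v)) (at x within X)"
    if "e \<in> I" "x \<in> X" for e x using sim[OF that] by blast
  ultimately have "conformal_system X I \<phi> c h \<rho> L \<alpha>"
    using X letters maps inj lip osc pos L h c0(1)
    by unfold_locales (auto simp: c_def)
  then show ?thesis by blast
qed

section \<open>Convergence of the maps\<close>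

context conformal_system
begin

lemma bounded_linear_deriv_on:
  assumes "e \<in> I" "x \<in> X" shows "bounded_linear (deriv_on X (\<phi> e) x)"
proof -
  have "\<phi> e differentiable (at x within X)"
    using similarity[OF assms] unfolding differentiable_def by blast
  then show ?thesis
    unfolding deriv_on_def frechet_derivative_works by (rule has_derivative_bounded_linear)
qed

end

text \<open>
  Each letter contributes one term to \<open>\<rho>\<close>, and all terms are nonnegative.  The series converges,
  since its terms are bounded by \<open>(\<Delta> + 2) 2\<^sup>-\<^sup>i\<close>; without this its value would carry no information.
\<close>

lemma rho_dist_bounds:
  assumes "conformal_system X J \<psi> c' h' \<rho>' L' \<alpha>'" "conformal_system X I \<phi> c h \<rho> L \<alpha>" and e: "e \<in> I"
  defines "r \<equiv> rho_dist X (J, \<psi>) (I, \<phi>)"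
  shows "0 \<le> r" "e \<notin> J \<Longrightarrow> (1 / 2) ^ e \<le> r"
    "e \<in> J \<Longrightarrow> x \<in> X \<Longrightarrow> (1 / 2) ^ e * (dist (\<psi> e x) (\<phi> e x) + \<bar>scaling X \<psi> e x - scaling X \<phi> e x\<bar>) \<le> r"
proof -
  interpret A: conformal_system X J \<psi> c' h' \<rho>' L' \<alpha>' by fact
  interpret B: conformal_system X I \<phi> c h \<rho> L \<alpha> by fact
  obtain x0 where x0: "x0 \<in> X" using A.nonempty by blast
  define a where "a i = sup_norm_on X (\<lambda>x. \<psi> i x - \<phi> i x)" for i
  define b where "b i = sup_onorm_on X (\<lambda>x v. deriv_on X (\<psi> i) x v - deriv_on X (\<phi> i) x v)" for i
  have diff: "norm (\<psi> i y - \<phi> i y) \<le> diameter X" if "i \<in> J \<inter> I" "y \<in> X" for i y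
  proof -
    have "\<psi> i y \<in> X" "\<phi> i y \<in> X" using that A.maps B.maps by blast+
    then show ?thesis using A.dist_le_diameter by (simp add: dist_norm[symmetric])
  qed
  have ddiff: "onorm (\<lambda>v. deriv_on X (\<psi> i) y v - deriv_on X (\<phi> i) y v) \<le> 2"
      "\<bar>scaling X \<psi> i y - scaling X \<phi> i y\<bar> \<le> onorm (\<lambda>v. deriv_on X (\<psi> i) y v - deriv_on X (\<phi> i) y v)"
    if "i \<in> J \<inter> I" "y \<in> X" for i y
  proof -
    let ?A = "deriv_on X (\<psi> i) y" and ?B = "deriv_on X (\<phi> i) y"
    have lin: "bounded_linear ?A" "bounded_linear ?B"
      using that A.bounded_linear_deriv_on B.bounded_linear_deriv_on by auto
    have lin': "bounded_linear (\<lambda>v. ?A v - ?B v)" "bounded_linear (\<lambda>v. ?B v - ?A v)" "bounded_linear (\<lambda>v. - ?B v)"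
      using lin by (auto intro: bounded_linear_sub bounded_linear_minus)
    have "onorm ?A \<le> 1" "onorm ?B \<le> 1"
      using that A.scaling_le[of i y] B.scaling_le[of i y] A.c B.c by (auto simp: scaling_def)
    moreover have "onorm (\<lambda>v. ?A v + - ?B v) \<le> onorm ?A + onorm (\<lambda>v. - ?B v)"
      using lin(1) lin'(3) by (rule onorm_triangle)
    ultimately show "onorm (\<lambda>v. ?A v - ?B v) \<le> 2" by (simp add: onorm_neg)
    have "onorm (\<lambda>v. (?A v - ?B v) + ?B v) \<le> onorm (\<lambda>v. ?A v - ?B v) + onorm ?B"
      using lin'(1) lin(2) by (rule onorm_triangle)
    moreover have "onorm (\<lambda>v. (?B v - ?A v) + ?A v) \<le> onorm (\<lambda>v. ?B v - ?A v) + onorm ?A"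
      using lin'(2) lin(1) by (rule onorm_triangle)
    moreover have "onorm (\<lambda>v. ?B v - ?A v) = onorm (\<lambda>v. ?A v - ?B v)"
      using onorm_neg[of "\<lambda>v. ?A v - ?B v"] by simp
    ultimately show "\<bar>scaling X \<psi> i y - scaling X \<phi> i y\<bar> \<le> onorm (\<lambda>v. ?A v - ?B v)"
      by (simp add: scaling_def)
  qed
  have a: "norm (\<psi> i y - \<phi> i y) \<le> a i" "a i \<le> diameter X" if "i \<in> J \<inter> I" "y \<in> X" for i y
    unfolding a_def sup_norm_on_def using diff[OF that(1)] that
    by (auto intro!: cSUP_upper cSUP_least bdd_aboveI2)
  have b: "\<bar>scaling X \<psi> i y - scaling X \<phi> i y\<bar> \<le> b i" "b i \<le> 2" if "i \<in> J \<inter> I" "y \<in> X" for i y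
  proof -
    have "onorm (\<lambda>v. deriv_on X (\<psi> i) y v - deriv_on X (\<phi> i) y v) \<le> b i"
      unfolding b_def sup_onorm_on_def using ddiff(1)[OF that(1)] that
      by (intro cSUP_upper bdd_aboveI2)
    then show "\<bar>scaling X \<psi> i y - scaling X \<phi> i y\<bar> \<le> b i" using ddiff(2)[OF that] by linarith
    show "b i \<le> 2" unfolding b_def sup_onorm_on_def using ddiff(1)[OF that(1)] that by (intro cSUP_least) auto
  qed
  have ab: "0 \<le> a i" "0 \<le> b i" if "i \<in> J \<inter> I" for i
    using a(1)[OF that x0] b(1)[OF that x0] norm_ge_zero abs_ge_zero order_trans by blast+
  let ?f = "\<lambda>i. (1 / 2) ^ i * (a i + b i)" and ?g = "\<lambda>i::nat. (1 / 2 :: real) ^ i"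
  let ?D = "(J - I) \<union> (I - J)"
  have geo: "(\<lambda>i::nat. C * (1 / 2 :: real) ^ i) summable_on S" if "0 \<le> C" for C S
  proof -
    have "(\<lambda>i::nat. C * (1 / 2 :: real) ^ i) summable_on UNIV"
      using that by (subst summable_on_UNIV_nonneg_real_iff) (auto intro!: summable_mult summable_geometric)
    then show ?thesis by (rule summable_on_subset_banach) simp
  qed
  have sum_f: "?f summable_on (J \<inter> I)"
  proof (rule summable_on_comparison_test[OF geo[of "diameter X + 2"]])
    fix i assume i: "i \<in> J \<inter> I"
    show "?f i \<le> (diameter X + 2) * (1 / 2) ^ i"
      using a(2)[OF i x0] b(2)[OF i x0] by (simp add: mult.commute[of _ "(1/2)^i"] mult_left_mono)
    show "0 \<le> ?f i" using ab[OF i] by simp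
  qed (use A.diameter_nonneg in simp)
  have sum_g: "?g summable_on ?D" using geo[of 1] by simp
  have r: "r = infsum ?f (J \<inter> I) + infsum ?g ?D"
    by (simp add: r_def rho_dist_def a_def b_def)
  have nonneg: "0 \<le> infsum ?f (J \<inter> I)" "0 \<le> infsum ?g ?D"
    using ab by (auto intro!: infsum_nonneg)
  show "0 \<le> r" using nonneg r by simp
  show "(1 / 2) ^ e \<le> r" if "e \<notin> J"
  proof -
    have "infsum ?g {e} \<le> infsum ?g ?D"
      using sum_g that e by (intro infsum_mono2) auto
    then show ?thesis using nonneg r by simp
  qed
  show "(1 / 2) ^ e * (dist (\<psi> e x) (\<phi> e x) + \<bar>scaling X \<psi> e x - scaling X \<phi> e x\<bar>) \<le> r"
    if "e \<in> J" "x \<in> X"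
  proof -
    have e': "e \<in> J \<inter> I" using that e by simp
    have "infsum ?f {e} \<le> infsum ?f (J \<inter> I)"
      using sum_f e' ab by (intro infsum_mono2) auto
    moreover have "(1 / 2) ^ e * (dist (\<psi> e x) (\<phi> e x) + \<bar>scaling X \<psi> e x - scaling X \<phi> e x\<bar>) \<le> ?f e"
      using a(1)[OF e' that(2)] b(1)[OF e' that(2)] by (intro mult_left_mono) (auto simp: dist_norm)
    moreover have "infsum ?f {e} = ?f e" by simp
    ultimately show ?thesis using nonneg(2) r by linarith
  qed
qed

text \<open>
  Each approximating system may have its own constants.
\<close>

locale conformal_approximation = conformal_system X I \<phi> c h \<rho> L \<alpha>
  for X :: "'a::euclidean_space set" and I \<phi> c h \<rho> L \<alpha> +
  fixes J :: "nat \<Rightarrow> nat set" and \<psi> :: "nat \<Rightarrow> nat \<Rightarrow> 'a \<Rightarrow> 'a"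
  assumes systems: "\<And>n. \<exists>c h \<rho> L \<alpha>. conformal_system X (J n) (\<psi> n) c h \<rho> L \<alpha>"
    and sub: "\<And>n. J n \<subseteq> I"
    and rho: "(\<lambda>n. rho_dist X (J n, \<psi> n) (I, \<phi>)) \<longlonglongrightarrow> 0"
begin

lemma letter_convergence:
  assumes "e \<in> I" "0 < \<epsilon>"
  shows "\<forall>\<^sub>F n in sequentially. e \<in> J n \<and>
    (\<forall>x\<in>X. dist (\<psi> n e x) (\<phi> e x) < \<epsilon> \<and> \<bar>scaling X (\<psi> n) e x - scaling X \<phi> e x\<bar> < \<epsilon>)"
proof -
  have "\<forall>\<^sub>F n in sequentially. rho_dist X (J n, \<psi> n) (I, \<phi>) < (1 / 2) ^ e * min 1 \<epsilon>"
    using rho assms by (intro order_tendstoD) auto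
  then show ?thesis
  proof eventually_elim
    case (elim n)
    obtain c' h' \<rho>' L' \<alpha>' where sys: "conformal_system X (J n) (\<psi> n) c' h' \<rho>' L' \<alpha>'"
      using systems by blast
    note bounds = rho_dist_bounds[OF sys conformal_system_axioms \<open>e \<in> I\<close>]
    have "(1 / 2 :: real) ^ e * min 1 \<epsilon> \<le> (1 / 2) ^ e * 1" by (intro mult_left_mono) auto
    then have "e \<in> J n" using bounds(2) elim by linarith
    moreover have "dist (\<psi> n e x) (\<phi> e x) + \<bar>scaling X (\<psi> n) e x - scaling X \<phi> e x\<bar> < \<epsilon>" if "x \<in> X" for x
    proof -
      have "(1 / 2) ^ e * (dist (\<psi> n e x) (\<phi> e x) + \<bar>scaling X (\<psi> n) e x - scaling X \<phi> e x\<bar>) < (1 / 2) ^ e * min 1 \<epsilon>"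
        using bounds(3)[OF \<open>e \<in> J n\<close> that] elim by linarith
      then show ?thesis by (simp add: mult_less_cancel_left_pos)
    qed
    then have "\<forall>x\<in>X. dist (\<psi> n e x) (\<phi> e x) < \<epsilon> \<and> \<bar>scaling X (\<psi> n) e x - scaling X \<phi> e x\<bar> < \<epsilon>"
      by (smt (verit) zero_le_dist)
    ultimately show ?case by blast
  qed
qed

lemma approx_word_map_in: "set w \<subseteq> J n \<Longrightarrow> x \<in> X \<Longrightarrow> word_map (\<psi> n) w x \<in> X"
  using systems[of n] conformal_system.word_map_in by blast

lemma approx_scaling_pos: "set w \<subseteq> J n \<Longrightarrow> x \<in> X \<Longrightarrow> 0 < word_scaling X (\<psi> n) w x"
  using systems[of n] conformal_system.word_scaling_pos by blast

lemma word_map_convergence: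
  assumes "set w \<subseteq> I" "0 < \<epsilon>"
  shows "\<forall>\<^sub>F n in sequentially. set w \<subseteq> J n \<and> (\<forall>x\<in>X. dist (word_map (\<psi> n) w x) (word_map \<phi> w x) < \<epsilon>)"
  using assms
proof (induction w arbitrary: \<epsilon>)
  case (Cons e w)
  have e: "e \<in> I" and w: "set w \<subseteq> I" and half: "0 < \<epsilon> / 2" using Cons.prems by auto
  show ?case
    using letter_convergence[OF e half] Cons.IH[OF w half]
  proof eventually_elim
    case (elim n)
    have "dist (word_map (\<psi> n) (e # w) x) (word_map \<phi> (e # w) x) < \<epsilon>" if x: "x \<in> X" for x
    proof -
      let ?y = "word_map \<phi> w x" and ?y' = "word_map (\<psi> n) w x"
      have y: "?y \<in> X" "?y' \<in> X" using word_map_in[OF w x] approx_word_map_in elim x by auto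
      have "dist (\<phi> e ?y') (\<phi> e ?y) \<le> c * dist ?y' ?y"
        using lipschitz_onD[OF lipschitz[OF e] y(2,1)] .
      also have "\<dots> \<le> 1 * dist ?y' ?y" using c by (intro mult_right_mono) auto
      finally have "dist (\<phi> e ?y') (\<phi> e ?y) < \<epsilon> / 2" using elim x by force
      moreover have "dist (\<psi> n e ?y') (\<phi> e ?y') < \<epsilon> / 2" using elim y by blast
      ultimately show ?thesis
        using dist_triangle[of "\<psi> n e ?y'" "\<phi> e ?y" "\<phi> e ?y'"] by simp
    qed
    then show ?case using elim by auto
  qed
qed simp

text \<open>
  The multiplicative form of convergence is the one that is needed in sums over words.  It is available
  since, for a fixed word of the limit system, the ratio is bounded away from zero on \<open>X\<close>.
\<close>

lemma word_scaling_convergence: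
  assumes "set w \<subseteq> I" "1 < \<theta>"
  shows "\<forall>\<^sub>F n in sequentially. set w \<subseteq> J n \<and>
    (\<forall>x\<in>X. D w x \<le> \<theta> * word_scaling X (\<psi> n) w x \<and> word_scaling X (\<psi> n) w x \<le> \<theta> * D w x)"
  using assms
proof (induction w arbitrary: \<theta>)
  case (Cons e w)
  have e: "e \<in> I" and w: "set w \<subseteq> I" using Cons.prems by auto
  obtain x0 where x0: "x0 \<in> X" using nonempty by blast
  \<comment> \<open>Three errors are multiplied: the ratio of the letter is taken at a different point, for a
      different map, and the rest of the word has its own error.\<close>
  define \<eta> where "\<eta> = root 3 \<theta>"
  have \<eta>: "1 < \<eta>" "\<eta> * \<eta> * \<eta> = \<theta>"
    using Cons.prems real_root_pow_pos2[of 3 \<theta>] by (auto simp: \<eta>_def power3_eq_cube)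
  have K: "0 < K" using K_ge_1 by simp
  define m where "m = scaling X \<phi> e x0 / K"
  have m: "0 < m" using scaling_pos[OF e x0] K by (simp add: m_def)
  have m_le: "m \<le> scaling X \<phi> e y" if "y \<in> X" for y
    using distortion[of "[e]" y x0] e that x0 K by (simp add: m_def divide_le_eq mult.commute)
  \<comment> \<open>At distance less than \<open>d\<close> the Hoelder condition changes the ratio by a factor of at most \<open>\<eta>\<close>.\<close>
  define d where "d = (ln \<eta> / (L + 1)) powr (1 / \<alpha>)"
  have d: "0 < d" using \<eta> L by (simp add: d_def)
  have close: "scaling X \<phi> e y \<le> \<eta> * scaling X \<phi> e y'" if "y \<in> X" "y' \<in> X" "dist y' y < d" for y y'
  proof -
    have "dist y' y powr \<alpha> \<le> d powr \<alpha>" using that \<alpha> by (intro powr_mono2) auto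
    also have "\<dots> = ln \<eta> / (L + 1)" using \<alpha> \<eta> L by (simp add: d_def powr_powr)
    finally have "L * dist y' y powr \<alpha> \<le> L * (ln \<eta> / (L + 1))" using L by (rule mult_left_mono)
    also have "\<dots> \<le> ln \<eta>" using L \<eta> by (simp add: field_simps)
    finally have "exp (L * dist y' y powr \<alpha>) \<le> \<eta>" using \<eta> by (simp add: ln_ge_iff)
    then have "scaling X \<phi> e y' * exp (L * dist y' y powr \<alpha>) \<le> scaling X \<phi> e y' * \<eta>"
      using scaling_pos[OF e that(2)] by (intro mult_left_mono) auto
    with hoelder[OF e that(2,1)] show ?thesis by (simp add: mult.commute)
  qed
  define \<epsilon> where "\<epsilon> = m * (1 - 1 / \<eta>)"
  have \<epsilon>: "0 < \<epsilon>" using m \<eta> by (simp add: \<epsilon>_def)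
  show ?case
    using letter_convergence[OF e \<epsilon>] word_map_convergence[OF w d] Cons.IH[OF w \<eta>(1)]
  proof eventually_elim
    case (elim n)
    have "D (e # w) x \<le> \<theta> * word_scaling X (\<psi> n) (e # w) x \<and>
        word_scaling X (\<psi> n) (e # w) x \<le> \<theta> * D (e # w) x" if x: "x \<in> X" for x
    proof -
      let ?y = "word_map \<phi> w x" and ?y' = "word_map (\<psi> n) w x"
      have y: "?y \<in> X" "?y' \<in> X" using word_map_in[OF w x] approx_word_map_in elim x by auto
      have dst: "dist ?y' ?y < d" "dist ?y ?y' < d" using elim x by (auto simp: dist_commute)
      let ?s = "scaling X \<phi> e ?y" and ?s' = "scaling X \<phi> e ?y'" and ?t = "scaling X (\<psi> n) e ?y'"
      let ?Dn = "word_scaling X (\<psi> n) w x"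
      have st: "?s \<le> \<eta> * ?s'" "?s' \<le> \<eta> * ?s" using close y dst by auto
      have "\<bar>?t - ?s'\<bar> < \<epsilon>" using elim y by blast
      moreover have "\<epsilon> \<le> ?s' * (1 - 1 / \<eta>)"
        unfolding \<epsilon>_def using m_le[OF y(2)] \<eta> by (intro mult_right_mono) auto
      ultimately have "?s' / \<eta> \<le> ?t" "?t \<le> ?s' * (2 - 1 / \<eta>)" by (auto simp: algebra_simps)
      moreover have "2 - 1 / \<eta> \<le> \<eta>"
      proof -
        have "0 \<le> (\<eta> - 1) * (\<eta> - 1)" by simp
        then show ?thesis using \<eta>(1) by (simp add: field_simps)
      qed
      then have "?s' * (2 - 1 / \<eta>) \<le> ?s' * \<eta>"
        using scaling_pos[OF e y(2)] by (intro mult_left_mono) auto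
      ultimately have tt: "?s' \<le> \<eta> * ?t" "?t \<le> \<eta> * ?s'"
        using \<eta>(1) by (simp add: pos_divide_le_eq mult.commute, simp add: mult.commute[of \<eta>])
      have pos: "0 < ?s" "0 < ?s'" "0 < D w x" "0 < ?Dn"
        using scaling_pos[OF e] y word_scaling_pos[OF w x] approx_scaling_pos elim x by auto
      have "0 < \<eta> * ?t" using tt pos by linarith
      then have "0 < ?t" using \<eta>(1) by (simp add: zero_less_mult_iff)
      have Dn: "D w x \<le> \<eta> * ?Dn" "?Dn \<le> \<eta> * D w x" using elim x by auto
      have 1: "?s \<le> \<eta> * \<eta> * ?t" "?t \<le> \<eta> * \<eta> * ?s"
        using order_trans[OF st(1) mult_left_mono[OF tt(1)]] order_trans[OF tt(2) mult_left_mono[OF st(2)]] \<eta>(1)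
        by (auto simp: mult.assoc)
      have "?s * D w x \<le> (\<eta> * \<eta> * ?t) * (\<eta> * ?Dn)"
        using 1(1) Dn(1) pos \<open>0 < ?t\<close> \<eta>(1) by (intro mult_mono) auto
      moreover have "?t * ?Dn \<le> (\<eta> * \<eta> * ?s) * (\<eta> * D w x)"
        using 1(2) Dn(2) pos \<open>0 < ?t\<close> \<eta>(1) by (intro mult_mono) auto
      ultimately show ?thesis by (simp add: \<eta>(2)[symmetric] mult_ac)
    qed
    then show ?case using elim by auto
  qed
qed simp

end

section \<open>Continuity of the dimension\<close>

context conformal_approximation
begin

abbreviation "Zn n s \<equiv> partition_fun (J n) (\<lambda>\<omega>. s * geometric_potential X (\<psi> n) \<omega>)"

text \<open>
  The majorant for words of length \<open>k * j\<close> that results from applying the comparison of regular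
  convergence to each of the \<open>j\<close> blocks of length \<open>k\<close>.
\<close>

primrec block_bound :: "real \<Rightarrow> real \<Rightarrow> nat \<Rightarrow> nat \<Rightarrow> nat list \<Rightarrow> ennreal" where
  "block_bound s C k 0 w = 1"
| "block_bound s C k (Suc j) w =
     (ennreal C * exp_sup_cyl I (\<lambda>\<omega>. s * geometric_potential X \<phi> \<omega>) (take k w)) * block_bound s C k j (drop k w)"

lemma infsum_block_bound: "(\<Sum>\<^sub>\<infinity>w\<in>words I (k * j). block_bound s C k j w) \<le> (ennreal C * Z s k) ^ j"
proof (induction j)
  case (Suc j)
  let ?g = "\<lambda>\<omega>. s * geometric_potential X \<phi> \<omega>"
  have "(\<Sum>\<^sub>\<infinity>w\<in>words I (k * Suc j). block_bound s C k (Suc j) w)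
      \<le> (\<Sum>\<^sub>\<infinity>u\<in>words I k. ennreal C * exp_sup_cyl I ?g u) * (\<Sum>\<^sub>\<infinity>w\<in>words I (k * j). block_bound s C k j w)"
    using infsum_words_add_le[of "\<lambda>u. ennreal C * exp_sup_cyl I ?g u" k "block_bound s C k j" I "k * j"] by simp
  also have "\<dots> \<le> (ennreal C * Z s k) * (ennreal C * Z s k) ^ j"
  proof (intro mult_mono Suc)
    show "(\<Sum>\<^sub>\<infinity>u\<in>words I k. ennreal C * exp_sup_cyl I ?g u) \<le> ennreal C * Z s k"
    proof (rule ennreal_infsum_le)
      fix S assume "finite S" "S \<subseteq> words I k"
      then show "(\<Sum>u\<in>S. ennreal C * exp_sup_cyl I ?g u) \<le> ennreal C * Z s k"
        unfolding partition_fun_def sum_distrib_left[symmetric]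
        by (intro mult_left_mono ennreal_sum_le_infsum) auto
    qed
  qed auto
  finally show ?case by simp
qed simp

lemma exp_sup_cyl_le_block_bound:
  assumes dom: "\<And>w. w \<in> words (J n) k \<Longrightarrow>
      exp_sup_cyl (J n) (\<lambda>\<omega>. s * geometric_potential X (\<psi> n) \<omega>) w
        \<le> ennreal C * exp_sup_cyl I (\<lambda>\<omega>. s * geometric_potential X \<phi> \<omega>) w"
  shows "w \<in> words (J n) (k * j) \<Longrightarrow>
    exp_sup_cyl (J n) (\<lambda>\<omega>. s * geometric_potential X (\<psi> n) \<omega>) w \<le> block_bound s C k j w"
proof (induction j arbitrary: w)
  case 0
  then show ?case by (auto simp: exp_sup_cyl_def birkhoff_sum_def intro!: SUP_least)
next
  case (Suc j)
  let ?g = "\<lambda>\<omega>. s * geometric_potential X (\<psi> n) \<omega>"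
  have w: "take k w \<in> words (J n) k" "drop k w \<in> words (J n) (k * j)"
    using Suc.prems by (auto simp: words_def dest: in_set_takeD in_set_dropD)
  have "exp_sup_cyl (J n) ?g w \<le> exp_sup_cyl (J n) ?g (take k w) * exp_sup_cyl (J n) ?g (drop k w)"
    using exp_sup_cyl_append[of "J n" ?g "take k w" "drop k w"] by simp
  also have "\<dots> \<le> block_bound s C k (Suc j) w"
    unfolding block_bound.simps using dom[OF w(1)] Suc.IH[OF w(2)] by (intro mult_mono) auto
  finally show ?case .
qed

text \<open>
  A strict inequality between finite sums leaves room to divide all lower bounds by some \<open>\<theta> > 1\<close>, and
  thereby to pass to the approximating systems.
\<close>

lemma eventually_dim_ge:
  assumes t: "0 < t" and x0: "x0 \<in> X" and F: "finite F" "F \<subseteq> I" and "0 < m"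
    and gt: "1 < (\<Sum>w\<in>words F m. (D w x0 / K) powr t)"
  shows "\<forall>\<^sub>F n in sequentially. ennreal t \<le> hausdorff_dim (limit_set X (J n, \<psi> n))"
proof -
  define S where "S = (\<Sum>w\<in>words F m. (D w x0 / K) powr t)"
  \<comment> \<open>With this \<open>\<theta>\<close> the reduced bounds still satisfy \<open>\<Sum> \<delta>(w)\<^sup>t = 1\<close>.\<close>
  define \<theta> where "\<theta> = S powr (1 / t)"
  have "1 < \<theta>" using gt t by (simp add: \<theta>_def S_def gr_one_powr)
  have \<theta>t: "\<theta> powr t = S" using gt t by (simp add: \<theta>_def S_def powr_powr)
  have w: "set w \<subseteq> I" if "w \<in> words F m" for w using that F by (auto simp: words_def)
  define \<delta> where "\<delta> w = (D w x0 / K) / \<theta>" for w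
  have K: "0 < K" using K_ge_1 by simp
  have "\<forall>\<^sub>F n in sequentially. \<forall>w\<in>words F m. set w \<subseteq> J n \<and> (\<forall>x\<in>X. D w x \<le> \<theta> * word_scaling X (\<psi> n) w x \<and>
      word_scaling X (\<psi> n) w x \<le> \<theta> * D w x)"
    using word_scaling_convergence[OF w \<open>1 < \<theta>\<close>] finite_words[OF F(1)] by (intro eventually_ball_finite) auto
  moreover have "\<forall>\<^sub>F n in sequentially. e \<in> J n" if "e \<in> F" for e
  proof -
    have "e \<in> I" using that F by blast
    from letter_convergence[OF this zero_less_one] show ?thesis by (rule eventually_mono) blast
  qed
  then have "\<forall>\<^sub>F n in sequentially. \<forall>e\<in>F. e \<in> J n"
    using F(1) by (intro eventually_ball_finite) auto
  ultimately show ?thesis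
  proof eventually_elim
    case (elim n)
    obtain c' h' \<rho>' L' \<alpha>' where sys: "conformal_system X (J n) (\<psi> n) c' h' \<rho>' L' \<alpha>'" using systems by blast
    show ?case
    proof (rule conformal_system.hausdorff_dim_limit_set_ge[OF sys F(1) _ \<open>0 < m\<close> t])
      show "F \<subseteq> J n" using elim by blast
      fix w y assume wy: "w \<in> words F m" "y \<in> X"
      have "D w x0 / K \<le> D w y" using distortion_lower[OF w[OF wy(1)] x0 wy(2)] .
      also have "\<dots> \<le> \<theta> * word_scaling X (\<psi> n) w y" using elim wy by blast
      finally have "D w x0 / K \<le> word_scaling X (\<psi> n) w y * \<theta>" by (simp only: mult.commute)
      then have "\<delta> w \<le> word_scaling X (\<psi> n) w y"
        using \<open>1 < \<theta>\<close> unfolding \<delta>_def by (subst pos_divide_le_eq) auto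
      moreover have "0 < \<delta> w" using word_scaling_pos[OF w[OF wy(1)] x0] K \<open>1 < \<theta>\<close> by (simp add: \<delta>_def)
      ultimately show "0 < \<delta> w \<and> \<delta> w \<le> word_scaling X (\<psi> n) w y" by blast
    next
      have "(\<Sum>w\<in>words F m. \<delta> w powr t) = (\<Sum>w\<in>words F m. (D w x0 / K) powr t / S)"
      proof (rule sum.cong)
        fix v assume "v \<in> words F m"
        then have "0 \<le> D v x0 / K" using word_scaling_pos[OF w x0] K by (simp add: less_imp_le)
        then show "\<delta> v powr t = (D v x0 / K) powr t / S"
          unfolding \<delta>_def \<theta>t[symmetric] using \<open>1 < \<theta>\<close> by (subst powr_divide) auto
      qed simp
      also have "\<dots> = S / S" unfolding sum_divide_distrib[symmetric] by (simp only: S_def)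
      finally show "1 \<le> (\<Sum>w\<in>words F m. \<delta> w powr t)" using gt by (simp add: S_def)
    qed
  qed
qed

lemma eventually_dim_greater:
  assumes "a < hausdorff_dim (limit_set X (I, \<phi>))"
  shows "\<forall>\<^sub>F n in sequentially. a < hausdorff_dim (limit_set X (J n, \<psi> n))"
proof -
  obtain z2 where z2: "a < z2" "z2 < hausdorff_dim (limit_set X (I, \<phi>))" using dense[OF assms] by blast
  obtain z1 where z1: "a < z1" "z1 < z2" using dense[OF z2(1)] by blast
  obtain s where s: "z2 = ennreal s" "0 \<le> s" using z2 by (cases z2) auto
  obtain t where t: "z1 = ennreal t" "0 \<le> t" using z1 s by (cases z1) auto
  have ts: "0 < t" "t < s"
    using z1 s t by (auto simp: ennreal_less_iff) (metis ennreal_0 le_less not_less_zero)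
  obtain x0 where x0: "x0 \<in> X" using nonempty by blast
  have "\<exists>F m. finite F \<and> F \<subseteq> I \<and> 1 < (\<Sum>w\<in>words F m. (D w x0 / K) powr t)"
  proof (rule ccontr)
    assume none: "\<not> ?thesis"
    then have Z: "Z s m \<le> ennreal ((K * K) powr t * (c powr (s - t)) ^ m)" for m
      by (intro partition_fun_le[OF x0 ts]) (metis not_less)
    have "\<forall>\<^sub>F m in sequentially. (K * K) powr t * (c powr (s - t)) ^ m < 1"
      using geometric_small[OF ts] by (intro order_tendstoD) auto
    then obtain m where "(K * K) powr t * (c powr (s - t)) ^ m < 1"
      by (auto dest: eventually_happens)
    then have "Z s m < 1" using Z[of m] by (simp add: ennreal_less_one_iff order_le_less_trans)
    then have "hausdorff_dim (limit_set X (I, \<phi>)) \<le> ennreal s"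
      using ts by (intro hausdorff_dim_limit_set_le) auto
    then show False using z2 s by simp
  qed
  then obtain F m where F: "finite F" "F \<subseteq> I" "1 < (\<Sum>w\<in>words F m. (D w x0 / K) powr t)" by blast
  then have "0 < m" using sum_word_0_le[OF x0 ts(1), of F] by (cases m) auto
  have "\<forall>\<^sub>F n in sequentially. ennreal t \<le> hausdorff_dim (limit_set X (J n, \<psi> n))"
    using eventually_dim_ge[OF ts(1) x0 F(1,2) \<open>0 < m\<close> F(3)] .
  then show ?thesis
    by eventually_elim (use z1 t in \<open>simp add: less_le_trans\<close>)
qed

text \<open>
  Choose \<open>s\<close> strictly between the dimension and \<open>a\<close>, and a length \<open>M = k * j\<close> for which the partition
  function of the limit system is small.  The words of length \<open>M\<close> are split into a finite set, on which
  eventually the derivatives of the approximating systems are at most twice those of the limit system, and the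
  rest, on which the majorant has sum less than one half.
\<close>

lemma eventually_dim_less:
  assumes regular: "\<And>s. pressure I (\<lambda>\<omega>. s * geometric_potential X \<phi> \<omega>) < \<infinity> \<Longrightarrow>
      \<exists>k\<ge>1. \<exists>C>0. \<forall>n. \<forall>w\<in>words (J n) k.
        exp_sup_cyl (J n) (\<lambda>\<omega>. s * geometric_potential X (\<psi> n) \<omega>) w
          \<le> ennreal C * exp_sup_cyl I (\<lambda>\<omega>. s * geometric_potential X \<phi> \<omega>) w"
    and dim: "hausdorff_dim (limit_set X (I, \<phi>)) < a"
  shows "\<forall>\<^sub>F n in sequentially. hausdorff_dim (limit_set X (J n, \<psi> n)) < a"
proof -
  obtain z2 where z2: "hausdorff_dim (limit_set X (I, \<phi>)) < z2" "z2 < a" using dense[OF dim] by blast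
  obtain z1 where z1: "hausdorff_dim (limit_set X (I, \<phi>)) < z1" "z1 < z2" using dense[OF z2(1)] by blast
  obtain s where s: "z2 = ennreal s" "0 \<le> s" using z2 by (cases z2) auto
  obtain t where t: "z1 = ennreal t" "0 \<le> t" using z1 s by (cases z1) auto
  have ts: "0 < t" "t < s"
    using z1 s t by (auto simp: ennreal_less_iff) (metis ennreal_0 le_less not_less_zero)
  obtain x0 where x0: "x0 \<in> X" using nonempty by blast
  have K: "0 < K" using K_ge_1 by simp
  let ?g = "\<lambda>\<omega>. s * geometric_potential X \<phi> \<omega>" and ?gn = "\<lambda>n \<omega>. s * geometric_potential X (\<psi> n) \<omega>"
  have Z: "Z s m \<le> ennreal ((K * K) powr t * (c powr (s - t)) ^ m)" for m
    using partition_fun_le_of_dim_less[OF x0 ts] z1(1) t by simp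
  have Zfin: "Z s m < \<infinity>" for m using Z[of m] by (simp add: order_le_less_trans)
  then have "pressure I ?g < \<infinity>" using partition_fun_nonzero by (intro pressure_less_top) auto
  then obtain k C where k: "1 \<le> k" "0 < C" "\<And>n w. w \<in> words (J n) k \<Longrightarrow>
      exp_sup_cyl (J n) (?gn n) w \<le> ennreal C * exp_sup_cyl I ?g w"
    using regular by blast
  \<comment> \<open>The factor 2 is the error of the approximation; each \<open>K\<close> pays for a change of the point at which
      the derivative is evaluated.\<close>
  define B where "B = (2 * (K * K)) powr s"
  have "\<forall>\<^sub>F m in sequentially. (B * (K * K) powr t) * (c powr (s - t)) ^ m < 1 / 2"
    using geometric_small[OF ts] by (intro order_tendstoD) auto
  then obtain j where j: "\<And>m. j \<le> m \<Longrightarrow> (B * (K * K) powr t) * (c powr (s - t)) ^ m < 1 / 2"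
    unfolding eventually_sequentially by blast
  define M where "M = k * j"
  have "j \<le> M" using k(1) by (simp add: M_def)
  have "ennreal B * Z s M \<le> ennreal B * ennreal ((K * K) powr t * (c powr (s - t)) ^ M)"
    using Z by (intro mult_left_mono) auto
  also have "\<dots> = ennreal ((B * (K * K) powr t) * (c powr (s - t)) ^ M)"
    by (simp add: B_def mult.assoc flip: ennreal_mult)
  also have "\<dots> \<le> ennreal (1 / 2)" using j[OF \<open>j \<le> M\<close>] by (intro ennreal_leI) simp
  finally have BZ: "ennreal B * Z s M \<le> ennreal (1 / 2)" .
  have "(\<Sum>\<^sub>\<infinity>w\<in>words I M. block_bound s C k j w) \<le> (ennreal C * Z s k) ^ j"
    unfolding M_def by (rule infsum_block_bound)
  also have "\<dots> < \<infinity>" using Zfin[of k] by (simp add: power_less_top_ennreal ennreal_mult_less_top)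
  finally have fin: "(\<Sum>\<^sub>\<infinity>w\<in>words I M. block_bound s C k j w) < \<infinity>" .
  have half: "0 < ennreal (1 / 2)" unfolding ennreal_less_zero_iff by simp
  obtain S where S: "finite S" "S \<subseteq> words I M"
      "(\<Sum>\<^sub>\<infinity>w\<in>words I M - S. block_bound s C k j w) < ennreal (1 / 2)"
    using ennreal_infsum_small_tail[OF fin half] by blast
  have Sw: "set w \<subseteq> I" if "w \<in> S" for w using that S by (auto simp: words_def)
  have "\<forall>\<^sub>F n in sequentially. \<forall>w\<in>S. set w \<subseteq> J n \<and> (\<forall>x\<in>X. D w x \<le> 2 * word_scaling X (\<psi> n) w x \<and>
      word_scaling X (\<psi> n) w x \<le> 2 * D w x)"
    using word_scaling_convergence[OF Sw, of _ 2] S(1) by (intro eventually_ball_finite) auto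
  then show ?thesis
  proof eventually_elim
    case (elim n)
    obtain c' h' \<rho>' L' \<alpha>' where sys: "conformal_system X (J n) (\<psi> n) c' h' \<rho>' L' \<alpha>'" using systems by blast
    have head: "exp_sup_cyl (J n) (?gn n) w \<le> ennreal B * exp_sup_cyl I ?g w" if "w \<in> S" for w
    proof -
      note w = Sw[OF that]
      have pos: "0 < D w x0" using word_scaling_pos[OF w x0] .
      have "exp_sup_cyl (J n) (?gn n) w \<le> ennreal (B * (D w x0 / K) powr s)"
      proof (rule conformal_system.exp_sup_cyl_le[OF sys])
        fix y assume y: "y \<in> X"
        have "word_scaling X (\<psi> n) w y \<le> 2 * (K * D w x0)"
          using elim that y distortion[OF w x0 y] by force
        also have "\<dots> = (2 * (K * K)) * (D w x0 / K)" using K by simp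
        finally have "word_scaling X (\<psi> n) w y powr s \<le> ((2 * (K * K)) * (D w x0 / K)) powr s"
          using approx_scaling_pos[of w n y] elim that y ts by (intro powr_mono2) auto
        also have "\<dots> = B * (D w x0 / K) powr s"
          unfolding B_def using K pos by (subst powr_mult) auto
        finally show "word_scaling X (\<psi> n) w y powr s \<le> B * (D w x0 / K) powr s" .
      qed
      also have "\<dots> = ennreal B * ennreal ((D w x0 / K) powr s)" by (simp add: B_def ennreal_mult)
      also have "ennreal ((D w x0 / K) powr s) \<le> exp_sup_cyl I ?g w"
        using distortion_lower[OF w x0] pos K ts by (intro exp_sup_cyl_ge[OF w] powr_mono2) auto
      finally show ?thesis by (simp add: mult_left_mono)
    qed
    have "Zn n s M \<le> ennreal B * Z s M + (\<Sum>\<^sub>\<infinity>w\<in>words I M - S. block_bound s C k j w)"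
      unfolding partition_fun_def[of "J n"]
    proof (rule ennreal_infsum_le)
      fix T assume T: "finite T" "T \<subseteq> words (J n) M"
      have TI: "T \<subseteq> words I M" using T sub by (fastforce simp: words_def)
      have "(\<Sum>w\<in>T. exp_sup_cyl (J n) (?gn n) w)
          = (\<Sum>w\<in>T \<inter> S. exp_sup_cyl (J n) (?gn n) w) + (\<Sum>w\<in>T - S. exp_sup_cyl (J n) (?gn n) w)"
        using T(1) by (rule sum.Int_Diff)
      also have "\<dots> \<le> (\<Sum>w\<in>T \<inter> S. ennreal B * exp_sup_cyl I ?g w) + (\<Sum>w\<in>T - S. block_bound s C k j w)"
        using T exp_sup_cyl_le_block_bound[OF k(3), of n] head
        by (intro add_mono sum_mono) (auto simp: M_def)
      also have "\<dots> \<le> ennreal B * Z s M + (\<Sum>\<^sub>\<infinity>w\<in>words I M - S. block_bound s C k j w)"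
        unfolding partition_fun_def sum_distrib_left[symmetric] using T TI
        by (intro add_mono mult_left_mono ennreal_sum_le_infsum) auto
      finally show "(\<Sum>w\<in>T. exp_sup_cyl (J n) (?gn n) w)
          \<le> ennreal B * Z s M + (\<Sum>\<^sub>\<infinity>w\<in>words I M - S. block_bound s C k j w)" .
    qed
    also have "\<dots> \<le> ennreal (1 / 2) + (\<Sum>\<^sub>\<infinity>w\<in>words I M - S. block_bound s C k j w)"
      using BZ by (rule add_right_mono)
    also have "\<dots> < ennreal (1 / 2) + ennreal (1 / 2)"
      using S(3) by (simp only: ennreal_add_left_cancel_less) simp
    also have "\<dots> = ennreal (1 / 2 + 1 / 2)" by (rule ennreal_plus[symmetric]) auto
    also have "\<dots> = 1" by simp
    finally have "Zn n s M < 1" .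
    then have "hausdorff_dim (limit_set X (J n, \<psi> n)) \<le> ennreal s"
      using ts conformal_system.hausdorff_dim_limit_set_le[OF sys] by simp
    then show ?case using z2 s by simp
  qed
qed

end

text \<open>
  For empty \<open>X\<close> the coding map has a constant default value, the same for all systems.
\<close>

lemma limit_set_empty:
  assumes "(I, \<phi>) \<in> CIFS {}"
  shows "limit_set {} (I, \<phi>) = {the_elem {}}"
proof -
  obtain e where "e \<in> I" using assms by (auto simp: CIFS_def)
  then have "(\<lambda>_. e) \<in> seqs I" by (simp add: seqs_def)
  then show ?thesis by (auto simp: limit_set_def coding_map_def)
qed

theorem corollary1p10:
  fixes X :: "'a::euclidean_space set"
    and \<Phi>s :: "nat \<Rightarrow> nat set \<times> (nat \<Rightarrow> 'a \<Rightarrow> 'a)"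
    and \<Phi> :: "nat set \<times> (nat \<Rightarrow> 'a \<Rightarrow> 'a)"
  assumes "compact X" and "connected X" and "X = closure (interior X)"
    and "\<Phi> \<in> CIFS X" and "\<And>n. \<Phi>s n \<in> CIFS X"
    and "\<And>n. fst (\<Phi>s n) \<subseteq> fst \<Phi>"
    and "converges_regularly_zero X \<Phi>s \<Phi>"
  shows "(\<lambda>n. hausdorff_dim (limit_set X (\<Phi>s n))) \<longlonglongrightarrow> hausdorff_dim (limit_set X \<Phi>)"
proof -
  obtain I \<phi> where \<Phi>: "\<Phi> = (I, \<phi>)" by (cases \<Phi>)
  define J where "J n = fst (\<Phi>s n)" for n
  define \<psi> where "\<psi> n = snd (\<Phi>s n)" for n
  have \<Phi>s: "\<Phi>s n = (J n, \<psi> n)" for n by (simp add: J_def \<psi>_def)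
  show ?thesis
  proof (cases "X = {}")
    case True
    have "limit_set X (\<Phi>s n) = limit_set X \<Phi>" for n
      using limit_set_empty[of I \<phi>] limit_set_empty[of "J n" "\<psi> n"] assms(4) assms(5)[of n]
      unfolding \<Phi> \<Phi>s True by simp
    then show ?thesis by simp
  next
    case False
    obtain c h \<rho> L \<alpha> where sys: "conformal_system X I \<phi> c h \<rho> L \<alpha>"
      using CIFS_imp_conformal_system[OF _ assms(1) False] assms(4) unfolding \<Phi> by blast
    interpret conformal_system X I \<phi> c h \<rho> L \<alpha> by (rule sys)
    interpret conformal_approximation X I \<phi> c h \<rho> L \<alpha> J \<psi>
    proof unfold_locales
      fix n
      show "\<exists>c h \<rho> L \<alpha>. conformal_system X (J n) (\<psi> n) c h \<rho> L \<alpha>"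
        using CIFS_imp_conformal_system[OF _ assms(1) False] assms(5)[of n] unfolding \<Phi>s by blast
      show "J n \<subseteq> I" using assms(6)[of n] by (simp add: \<Phi> J_def)
    next
      show "(\<lambda>n. rho_dist X (J n, \<psi> n) (I, \<phi>)) \<longlonglongrightarrow> 0"
        using assms(7) by (simp add: converges_regularly_zero_def \<Phi> \<Phi>s)
    qed
    have regular: "\<exists>k\<ge>1. \<exists>C>0. \<forall>n. \<forall>w\<in>words (J n) k.
        exp_sup_cyl (J n) (\<lambda>\<omega>. s * geometric_potential X (\<psi> n) \<omega>) w
          \<le> ennreal C * exp_sup_cyl I (\<lambda>\<omega>. s * geometric_potential X \<phi> \<omega>) w"
      if "pressure I (\<lambda>\<omega>. s * geometric_potential X \<phi> \<omega>) < \<infinity>" for s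
      using assms(7) that unfolding converges_regularly_zero_def \<Phi> \<Phi>s fst_conv snd_conv by blast
    show ?thesis
      unfolding \<Phi> \<Phi>s
    proof (rule order_tendstoI)
      fix a assume "a < hausdorff_dim (limit_set X (I, \<phi>))"
      then show "\<forall>\<^sub>F n in sequentially. a < hausdorff_dim (limit_set X (J n, \<psi> n))"
        by (rule eventually_dim_greater)
    next
      fix a assume "hausdorff_dim (limit_set X (I, \<phi>)) < a"
      then show "\<forall>\<^sub>F n in sequentially. hausdorff_dim (limit_set X (J n, \<psi> n)) < a"
        by (intro eventually_dim_less) (rule regular)
    qed
  qed
qed

end
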